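(* Consider the closed-loop multi-sided interconnection of $M$ ensembles described in the context, where ensemble $q\in\{1,\dots,M\}$ consists of $N_q$ systems with affine stochastic dynamics $$x^q_i(k+1)=A^q_i x^q_i(k)+b^q_i(k),\qquad y^q_i(k)=(c^q_i)^T x^q_i(k)+d^q_i(k),\qquad i=1,\dots,N_q.$$ Assume that all $A^q_i$ are Schur matrices, and that at each time $k$ the vector $b^q_i(k)$ is chosen from a finite set $\{b^q_{ij}\}_j\subset\mathbb{R}^{n^q_i}$ with probabilities $p^q_{ij}(\pi^q(k))$ and the scalar $d^q_i(k)$ from a finite set $\{d^q_{i\ell}\}_\ell\subset\mathbb{R}$ with probabilities $p'^q_{i\ell}(\pi^q(k))$, where $p^q_{ij},p'^q_{i\ell}:\Pi^q\to[0,1]$ are Dini continuous, satisfy $\sum_j p^q_{ij}(\pi)=\sum_\ell p'^q_{i\ell}(\pi)=1$ for all $\pi\in\Pi^q$, and are bounded below on $\Pi^q$ by scalars strictly greater than $0$. Then, for any stable linear controllers $\mathcal{C}^1,\dots,\mathcal{C}^M$ and any stable linear filters $\mathcal{F}^1,\dots,\mathcal{F}^M$ compatible with the system structure, the feedback loop converges in distribution to a unique invariant measure: the Markov chain $\{\xi(k)\}$ has exactly one invariant probability measure $\mu^\star$, and for every initial probability distribution the law of $\xi(k)$ converges weakly to $\mu^\star$ as $k\to\infty$.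
   Context: **Closed-loop model.** For $q=1,\dots,M$, ensemble $q$ has systems with states $x^q_i(k)\in\mathbb{R}^{n^q_i}$ and scalar outputs $y^q_i(k)$, $i=1,\dots,N_q$; $y^q(k)=\sum_{i=1}^{N_q}y^q_i(k)$. There are linear filters and controllers $$\mathcal{F}^q:\quad x^q_f(k+1)=A^q_f x^q_f(k)+B^q_f y^q(k),\qquad \hat y^q(k)=C^q_f x^q_f(k),$$ $$\mathcal{C}^p:\quad x^p_c(k+1)=A^p_c x^p_c(k)+B^p_c e^p(k),\qquad \pi^p(k)=C^p_c x^p_c(k)+D^p_c e^p(k),$$ with real matrices and scalar control signals $\pi^p$, interconnected by $$e^p(k)=u^p-\sum_{q=1}^M H_{pq}\,\hat y^q(k),\qquad p=1,\dots,M,$$ where $u^p$ are constant external inputs and $H_{pq}$ are constant real matrices (scalars if the signals $e^p,\hat y^q$ are scalar). "Compatible with the system structure" means that all dimensions match. Ensemble $q$ responds to the signal $\pi^q$. $\Pi^q\subseteq\mathbb{R}$ is the set of admissible control signals and contains every value $\pi^q(k)$ that can occur. A linear controller (filter) is stable if $A^q_c$ ($A^q_f$) is Schur. A square matrix is Schur if all its eigenvalues have modulus $<1$. **Randomness.** The augmented state $\xi(k)$ collects all $x^q_i(k)$, $x^q_f(k)$, $x^q_c(k)$ over all $q$ and $i$, and lies in a Euclidean space. Note that all $\pi^q(k)$ are functions of $\xi(k)$. Conditionally on $\xi(k)$ (and on the past), all the random choices made at time $k$ (over all $q$, $i$, for both $b$ and $d$) are independent with the stated probabilities. Thus $\{\xi(k)\}$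 is a time-homogeneous Markov chain. **Dini continuity.** A function $p$ on $\Pi^q$ is Dini continuous if its modulus of continuity $\omega(t)=\sup\{|p(\pi)-p(\pi')|:|\pi-\pi'|\le t\}$ satisfies $\int_0^{1}\omega(t)/t\,dt<\infty$. **Invariant measure.** With $P(x,\cdot)$ the transition kernel of the chain, a probability measure $\mu^\star$ is invariant if $\int P(x,G)\,\mu^\star(dx)=\mu^\star(G)$ for all Borel $G$. *)

theory Defs
  imports "HOL-Probability.Probability" "Jordan_Normal_Form.Char_Poly"
begin

section \<open>The data of the closed loop\<close>

text \<open>
  Dimensions vary with the ensemble and the system, so vectors and matrices are those of
  \<open>Jordan_Normal_Form\<close>: their entries are counted from 0, and the declared dimensions are
  imposed by \<open>compatible\<close> below. Ensembles, systems and the alternatives for \<open>b\<close> and \<open>d\<close>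
  are counted from 1; values of a field outside the stated index ranges are never used.
\<close>

record loop =
  ens_num :: nat  \<comment> \<open>\<open>M\<close>\<close>
  sys_num :: "nat \<Rightarrow> nat"  \<comment> \<open>\<open>N\<^sub>q\<close>\<close>

  sys_dim :: "nat \<Rightarrow> nat \<Rightarrow> nat"
  sys_A :: "nat \<Rightarrow> nat \<Rightarrow> real mat"
  sys_c :: "nat \<Rightarrow> nat \<Rightarrow> real Matrix.vec"

  b_num :: "nat \<Rightarrow> nat \<Rightarrow> nat"
  b_val :: "nat \<Rightarrow> nat \<Rightarrow> nat \<Rightarrow> real Matrix.vec"
  b_prob :: "nat \<Rightarrow> nat \<Rightarrow> nat \<Rightarrow> real \<Rightarrow> real"

  d_num :: "nat \<Rightarrow> nat \<Rightarrow> nat"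
  d_val :: "nat \<Rightarrow> nat \<Rightarrow> nat \<Rightarrow> real"
  d_prob :: "nat \<Rightarrow> nat \<Rightarrow> nat \<Rightarrow> real \<Rightarrow> real"

  filt_dim :: "nat \<Rightarrow> nat"
  filt_out :: "nat \<Rightarrow> nat"  \<comment> \<open>dimension of the filtered output \<open>\<hat>y\<^sup>q\<close>\<close>
  filt_A :: "nat \<Rightarrow> real mat"
  filt_B :: "nat \<Rightarrow> real mat"
  filt_C :: "nat \<Rightarrow> real mat"

  ctrl_dim :: "nat \<Rightarrow> nat"
  ctrl_in :: "nat \<Rightarrow> nat"  \<comment> \<open>dimension of the error signal \<open>e\<^sup>p\<close>\<close>
  ctrl_A :: "nat \<Rightarrow> real mat"
  ctrl_B :: "nat \<Rightarrow> real mat"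
  ctrl_C :: "nat \<Rightarrow> real mat"
  ctrl_D :: "nat \<Rightarrow> real mat"

  ext_input :: "nat \<Rightarrow> real Matrix.vec"  \<comment> \<open>\<open>u\<^sup>p\<close>\<close>
  coupling :: "nat \<Rightarrow> nat \<Rightarrow> real mat"  \<comment> \<open>\<open>H\<^sub>p\<^sub>q\<close>\<close>
  admissible :: "nat \<Rightarrow> real set"  \<comment> \<open>\<open>\<Pi>\<^sup>q\<close>\<close>

definition compatible :: "loop \<Rightarrow> bool" where
  "compatible L \<longleftrightarrow>
     (\<forall>q\<in>{1..ens_num L}. \<forall>i\<in>{1..sys_num L q}.
        sys_A L q i \<in> carrier_mat (sys_dim L q i) (sys_dim L q i) \<and>
        sys_c L q i \<in> carrier_vec (sys_dim L q i) \<and>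
        (\<forall>j\<in>{1..b_num L q i}. b_val L q i j \<in> carrier_vec (sys_dim L q i))) \<and>
     (\<forall>q\<in>{1..ens_num L}.
        filt_A L q \<in> carrier_mat (filt_dim L q) (filt_dim L q) \<and>
        filt_B L q \<in> carrier_mat (filt_dim L q) 1 \<and>
        filt_C L q \<in> carrier_mat (filt_out L q) (filt_dim L q)) \<and>
     (\<forall>p\<in>{1..ens_num L}.
        ctrl_A L p \<in> carrier_mat (ctrl_dim L p) (ctrl_dim L p) \<and>
        ctrl_B L p \<in> carrier_mat (ctrl_dim L p) (ctrl_in L p) \<and>
        ctrl_C L p \<in> carrier_mat 1 (ctrl_dim L p) \<and>
        ctrl_D L p \<in> carrier_mat 1 (ctrl_in L p) \<and>
        ext_input L p \<in> carrier_vec (ctrl_in L p)) \<and>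
     (\<forall>p\<in>{1..ens_num L}. \<forall>q\<in>{1..ens_num L}.
        coupling L p q \<in> carrier_mat (ctrl_in L p) (filt_out L q))"

text \<open>The eigenvalues are the complex ones.\<close>

definition schur :: "real mat \<Rightarrow> bool" where
  "schur A \<longleftrightarrow> square_mat A \<and>
     (\<forall>z. eigenvalue (map_mat complex_of_real A) z \<longrightarrow> cmod z < 1)"

text \<open>The supremum is taken in \<open>[0, \<infinity>]\<close>, so that it is meaningful for unbounded functions too.\<close>

definition modulus_of_continuity :: "real set \<Rightarrow> (real \<Rightarrow> real) \<Rightarrow> real \<Rightarrow> ennreal" where
  "modulus_of_continuity S f t =
     (SUP (x, y) \<in> {(x, y). x \<in> S \<and> y \<in> S \<and> \<bar>x - y\<bar> \<le> t}. ennreal \<bar>f x - f y\<bar>)"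

definition dini_continuous_on :: "real set \<Rightarrow> (real \<Rightarrow> real) \<Rightarrow> bool" where
  "dini_continuous_on S f \<longleftrightarrow>
     (\<integral>\<^sup>+t\<in>{0<..1}. modulus_of_continuity S f t / ennreal t \<partial>lborel) < \<infinity>"

section \<open>The augmented state\<close>

text \<open>
  An augmented state is a point of the Euclidean space of real functions on the finite set
  \<open>state_index L\<close> of scalar coordinates (extended by \<open>undefined\<close> outside that set, as
  for all product spaces \<open>\<Pi>\<^sub>M\<close>). \<open>Sys q i j\<close>, \<open>Filt q j\<close> and \<open>Ctrl q j\<close> name the \<open>j\<close>-th
  entry of the state of system \<open>i\<close> in ensemble \<open>q\<close>, of filter \<open>q\<close> and of controller \<open>q\<close>.
\<close>

datatype coord = Sys nat nat nat | Filt nat nat | Ctrl nat nat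

type_synonym state = "coord \<Rightarrow> real"

definition state_index :: "loop \<Rightarrow> coord set" where
  "state_index L =
     {Sys q i j | q i j. q \<in> {1..ens_num L} \<and> i \<in> {1..sys_num L q} \<and> j < sys_dim L q i} \<union>
     {Filt q j | q j. q \<in> {1..ens_num L} \<and> j < filt_dim L q} \<union>
     {Ctrl q j | q j. q \<in> {1..ens_num L} \<and> j < ctrl_dim L q}"

definition state_space :: "loop \<Rightarrow> state measure" where
  "state_space L = (\<Pi>\<^sub>M c\<in>state_index L. borel)"

definition state_topology :: "loop \<Rightarrow> state topology" where
  "state_topology L = product_topology (\<lambda>_. euclidean) (state_index L)"

definition sys_state :: "loop \<Rightarrow> state \<Rightarrow> nat \<Rightarrow> nat \<Rightarrow> real Matrix.vec" where
  "sys_state L \<xi> q i = Matrix.vec (sys_dim L q i) (\<lambda>j. \<xi> (Sys q i j))"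

definition filt_state :: "loop \<Rightarrow> state \<Rightarrow> nat \<Rightarrow> real Matrix.vec" where
  "filt_state L \<xi> q = Matrix.vec (filt_dim L q) (\<lambda>j. \<xi> (Filt q j))"

definition ctrl_state :: "loop \<Rightarrow> state \<Rightarrow> nat \<Rightarrow> real Matrix.vec" where
  "ctrl_state L \<xi> q = Matrix.vec (ctrl_dim L q) (\<lambda>j. \<xi> (Ctrl q j))"

section \<open>The signals and the state update\<close>

definition error_signal :: "loop \<Rightarrow> state \<Rightarrow> nat \<Rightarrow> real Matrix.vec" where
  "error_signal L \<xi> p =
     ext_input L p -
     finsum_vec TYPE(real) (ctrl_in L p)
       (\<lambda>q. coupling L p q *\<^sub>v (filt_C L q *\<^sub>v filt_state L \<xi> q)) {1..ens_num L}"

definition control_signal :: "loop \<Rightarrow> state \<Rightarrow> nat \<Rightarrow> real" where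
  "control_signal L \<xi> p =
     vec_index (ctrl_C L p *\<^sub>v ctrl_state L \<xi> p + ctrl_D L p *\<^sub>v error_signal L \<xi> p) 0"

text \<open>
  The random choices of one time step: \<open>\<sigma> (q, i) = (j, l)\<close> means that system \<open>i\<close> of
  ensemble \<open>q\<close> uses the \<open>j\<close>-th vector \<open>b\<close> and the \<open>l\<close>-th scalar \<open>d\<close>.
\<close>

type_synonym choices = "nat \<times> nat \<Rightarrow> nat \<times> nat"

definition ensemble_output :: "loop \<Rightarrow> state \<Rightarrow> choices \<Rightarrow> nat \<Rightarrow> real" where
  "ensemble_output L \<xi> \<sigma> q =
     (\<Sum>i = 1..sys_num L q.
        scalar_prod (sys_c L q i) (sys_state L \<xi> q i) + d_val L q i (snd (\<sigma> (q, i))))"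

definition next_sys :: "loop \<Rightarrow> state \<Rightarrow> choices \<Rightarrow> nat \<Rightarrow> nat \<Rightarrow> real Matrix.vec" where
  "next_sys L \<xi> \<sigma> q i = sys_A L q i *\<^sub>v sys_state L \<xi> q i + b_val L q i (fst (\<sigma> (q, i)))"

definition next_filt :: "loop \<Rightarrow> state \<Rightarrow> choices \<Rightarrow> nat \<Rightarrow> real Matrix.vec" where
  "next_filt L \<xi> \<sigma> q =
     filt_A L q *\<^sub>v filt_state L \<xi> q +
     filt_B L q *\<^sub>v Matrix.vec 1 (\<lambda>_. ensemble_output L \<xi> \<sigma> q)"

definition next_ctrl :: "loop \<Rightarrow> state \<Rightarrow> nat \<Rightarrow> real Matrix.vec" where
  "next_ctrl L \<xi> p = ctrl_A L p *\<^sub>v ctrl_state L \<xi> p + ctrl_B L p *\<^sub>v error_signal L \<xi> p"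

definition next_state :: "loop \<Rightarrow> state \<Rightarrow> choices \<Rightarrow> state" where
  "next_state L \<xi> \<sigma> =
     (\<lambda>c\<in>state_index L. case c of
          Sys q i j \<Rightarrow> vec_index (next_sys L \<xi> \<sigma> q i) j
        | Filt q j \<Rightarrow> vec_index (next_filt L \<xi> \<sigma> q) j
        | Ctrl q j \<Rightarrow> vec_index (next_ctrl L \<xi> q) j)"

section \<open>The Markov chain\<close>

text \<open>
  \<open>embed_pmf\<close> yields the intended distribution when the weights are nonnegative and sum to 1,
  which is a hypothesis of the theorem for every admissible value of the control signal.
\<close>

definition index_pmf :: "nat \<Rightarrow> (nat \<Rightarrow> real) \<Rightarrow> nat pmf" where
  "index_pmf n w = embed_pmf (\<lambda>j. if j \<in> {1..n} then w j else 0)"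

text \<open>All choices are independent, conditionally on the current state.\<close>

definition choice_pmf :: "loop \<Rightarrow> state \<Rightarrow> choices pmf" where
  "choice_pmf L \<xi> =
     Pi_pmf (SIGMA q:{1..ens_num L}. {1..sys_num L q}) undefined
       (\<lambda>(q, i). pair_pmf
          (index_pmf (b_num L q i) (\<lambda>j. b_prob L q i j (control_signal L \<xi> q)))
          (index_pmf (d_num L q i) (\<lambda>l. d_prob L q i l (control_signal L \<xi> q))))"

definition transition_kernel :: "loop \<Rightarrow> state \<Rightarrow> state measure" where
  "transition_kernel L \<xi> = distr (measure_pmf (choice_pmf L \<xi>)) (state_space L) (next_state L \<xi>)"

primrec law :: "loop \<Rightarrow> state measure \<Rightarrow> nat \<Rightarrow> state measure" where
  "law L \<nu> 0 = \<nu>"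
| "law L \<nu> (Suc k) = law L \<nu> k \<bind> transition_kernel L"

definition prob_measure_on :: "'a measure \<Rightarrow> 'a measure \<Rightarrow> bool" where
  "prob_measure_on S \<mu> \<longleftrightarrow> prob_space \<mu> \<and> sets \<mu> = sets S"

definition invariant_measure :: "loop \<Rightarrow> state measure \<Rightarrow> bool" where
  "invariant_measure L \<mu> \<longleftrightarrow>
     prob_measure_on (state_space L) \<mu> \<and>
     (\<forall>G\<in>sets (state_space L).
        (\<integral>\<^sup>+\<xi>. emeasure (transition_kernel L \<xi>) G \<partial>\<mu>) = emeasure \<mu> G)"

definition converges_weakly ::
  "'a topology \<Rightarrow> (nat \<Rightarrow> 'a measure) \<Rightarrow> 'a measure \<Rightarrow> bool" where
  "converges_weakly T \<mu>s \<mu> \<longleftrightarrow>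
     (\<forall>f :: 'a \<Rightarrow> real. continuous_map T euclidean f \<and> bounded (f ` topspace T) \<longrightarrow>
        (\<lambda>k. \<integral>x. f x \<partial>\<mu>s k) \<longlonglongrightarrow> (\<integral>x. f x \<partial>\<mu>))"

end

theory Submission
  imports Defs "Jordan_Normal_Form.Spectral_Radius"
begin

text \<open>
  All maps of the random update share one affine part, which contracts an adapted norm: the systems
  drive the filters and the filters drive the controllers, so the linear part is block triangular with
  Schur diagonal blocks. If the choices made from two states are coupled maximally, the states merge
  geometrically as long as the choices agree. At distance \<open>t\<close> the choices disagree with probability at
  most \<open>\<eta> t\<close>, and the Dini condition makes \<open>\<Sum>n. \<eta> (\<rho>\<^sup>n t)\<close> finite, so the iterates \<open>P\<^sup>n f\<close> of
  the transition operator on a bounded invariant set are equicontinuous. Since each choice has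
  probability at least \<open>\<delta>\<close>, the oscillation of \<open>P\<^sup>n f\<close> tends to 0: if its limit \<open>l\<close> were positive,
  equicontinuity would provide an \<open>n\<close> with \<open>l \<le> \<delta>\<^sup>n l / 2 + (1 - \<delta>\<^sup>n) l\<close>. So \<open>P\<^sup>n f\<close> converges
  to a constant. That this constant is the integral of \<open>f\<close> against a measure follows without
  Riesz representation: the attractor is a continuous image of the real line on which the chain is
  coded by a chain of reals in \<open>[0, 1]\<close>, and Helly's selection theorem applies to the latter.
\<close>

section \<open>Measures on finite products of the real line\<close>

text \<open>The laws of the next state are finitely supported, so from different states they may be
  mutually singular and total variation between them need not shrink. A transport distance is no
  better: one coupled step costs about \<rho> t + \<eta> t, and \<eta> may vanish more slowly than
  t. Hence the argument follows the oscillation of the functions P^n f instead of a distance of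
  measures. In the inequality for l, \<delta>^n is a lower bound for the probability that the same n
  choices are made from both states; n is so large that the states have then come within the scale
  at which every P^k f varies by at most l / 2. Every state lies in a bounded invariant ball around
  a fixed origin, so the limiting constant is the same for all starting points. Uniqueness follows
  from attraction, as an invariant measure is its own law at all times. A state is an extensional
  function on finitely many coordinates; topology and measure theory are moved between these
  functions and the full function type, which is a metric space.\<close>

lemma measure_eqI_continuous:
  fixes M N :: "'a::metric_space measure"
  assumes fin: "finite_measure M" "finite_measure N" and sets: "sets M = sets borel" "sets N = sets borel"
    and eq: "\<And>f :: 'a \<Rightarrow> real. continuous_on UNIV f \<Longrightarrow> (\<And>x. f x \<in> {0..1}) \<Longrightarrow>
      integral\<^sup>L M f = integral\<^sup>L N f"
  shows "M = N"
proof (rule measure_eqI_generator_eq[where E = "Collect closed" and A = "\<lambda>_. UNIV" and \<Omega> = UNIV])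
  interpret M: finite_measure M by fact
  interpret N: finite_measure N by fact
  fix A :: "'a set" assume "A \<in> Collect closed"
  then have A: "closed A" by simp
  show "emeasure M A = emeasure N A"
  \<comment> \<open>The empty set is split off because \<open>infdist\<close> to it is 0 by
    convention, which would make the functions below constantly 1.\<close>
  proof (cases "A = {}")
    case False
    \<comment> \<open>The functions \<open>f n\<close> are 1 on \<open>A\<close> and,
      \<open>A\<close> being closed, vanish at any given point off \<open>A\<close> for large
      \<open>n\<close>. Dominated convergence then yields equal measure on closed sets, an
      intersection-stable generator of the Borel sets.\<close>
    define f where "f n x = max 0 (1 - real n * infdist x A)" for n :: nat and x
    have cont: "continuous_on UNIV (f n)" for n
      unfolding f_def by (intro continuous_intros)
    have range: "f n x \<in> {0..1}" for n x
      by (simp add: f_def infdist_nonneg)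
    have lim: "(\<lambda>n. f n x) \<longlonglongrightarrow> indicator A x" for x
    proof (cases "x \<in> A")
      case True
      then show ?thesis by (simp add: f_def)
    next
      case notin: False
      have pos: "infdist x A > 0"
        using infdist_pos_not_in_closed[OF A False notin] .
      obtain k :: nat where k: "real k * infdist x A > 1"
        using reals_Archimedean3[OF pos] by blast
      have "f n x = 0" if "n \<ge> k" for n
      proof -
        have "real n * infdist x A \<ge> real k * infdist x A"
          using that pos by (intro mult_right_mono) auto
        then show ?thesis using k by (simp add: f_def)
      qed
      then have "eventually (\<lambda>n. f n x = 0) sequentially"
        using eventually_sequentially by blast
      then show ?thesis using notin by (simp add: tendsto_eventually)
    qed
    have lim_int: "(\<lambda>n. \<integral>x. f n x \<partial>Q) \<longlonglongrightarrow> measure Q A"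
      if Q: "finite_measure Q" "sets Q = sets borel" for Q :: "'a measure"
    proof -
      interpret Q: finite_measure Q by fact
      have meas: "g \<in> borel_measurable Q" if "g \<in> borel_measurable borel" for g :: "'a \<Rightarrow> real"
        using that Q(2) by (simp cong: measurable_cong_sets)
      have "(\<lambda>n. \<integral>x. f n x \<partial>Q) \<longlonglongrightarrow> (\<integral>x. indicator A x \<partial>Q)"
      proof (rule integral_dominated_convergence[where w = "\<lambda>_. 1"])
        show "indicat_real A \<in> borel_measurable Q"
          using A by (intro meas) auto
        show "f n \<in> borel_measurable Q" for n
          by (intro meas borel_measurable_continuous_onI cont)
        show "AE x in Q. (\<lambda>n. f n x) \<longlonglongrightarrow> indicat_real A x" using lim by simp
        show "AE x in Q. norm (f n x) \<le> 1" for n using range[of n] by (simp add: abs_le_iff)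
      qed simp
      moreover have "A \<in> sets Q" using A Q(2) by simp
      then have "A \<inter> space Q = A" using sets.sets_into_space by blast
      ultimately show ?thesis by simp
    qed
    have "measure M A = measure N A"
      using lim_int[OF fin(1) sets(1)] lim_int[OF fin(2) sets(2)] eq[OF cont range]
      by (simp add: LIMSEQ_unique)
    then show ?thesis by (simp add: M.emeasure_eq_measure N.emeasure_eq_measure)
  qed simp
next
  show "emeasure M UNIV \<noteq> \<infinity>"
    using fin(1) sets(1) by (metis finite_measure.emeasure_finite infinity_ennreal_def)
qed (auto simp: sets borel_eq_closed Int_stable_def)

text \<open>Restriction is a continuous retraction of the full function type onto the extensional
  functions, so composing with it extends a function continuous there to the whole metric
  space.\<close>

lemma continuous_on_restrict_extensional:
  fixes f :: "('i \<Rightarrow> real) \<Rightarrow> 'b::topological_space"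
  assumes "continuous_on (extensional S) f"
  shows "continuous_on UNIV (\<lambda>x. f (restrict x S))"
proof -
  have "continuous_on UNIV (\<lambda>x :: 'i \<Rightarrow> real. restrict x S)"
  proof (rule continuous_on_coordinatewise_then_product)
    show "continuous_on UNIV (\<lambda>x :: 'i \<Rightarrow> real. restrict x S i)" for i
      by (cases "i \<in> S") (auto intro!: continuous_intros continuous_on_product_then_coordinatewise)
  qed
  then show ?thesis
    using continuous_on_compose2[OF assms, of UNIV "\<lambda>x. restrict x S"] by auto
qed

lemma continuous_on_extensional_coordinatewise:
  fixes g :: "'b::topological_space \<Rightarrow> 'i \<Rightarrow> real"
  assumes "\<And>x. x \<in> A \<Longrightarrow> g x \<in> extensional S" "\<And>i. i \<in> S \<Longrightarrow> continuous_on A (\<lambda>x. g x i)"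
  shows "continuous_on A g"
proof (rule continuous_on_coordinatewise_then_product)
  fix i
  show "continuous_on A (\<lambda>x. g x i)"
  proof (cases "i \<in> S")
    case False
    then have "g x i = undefined" if "x \<in> A" for x
      using assms(1)[OF that] by (simp add: extensional_def)
    then show ?thesis by (simp cong: continuous_on_cong)
  qed (rule assms(2))
qed

text \<open>The points of the product topology over \<open>S\<close> are the extensional functions,
  and the identity from the subspace of the full function type is continuous in each coordinate.
  This translates the test functions of \<open>converges_weakly\<close> into type-class
  continuity.\<close>

lemma continuous_map_product_imp_continuous_on:
  fixes f :: "('i \<Rightarrow> real) \<Rightarrow> real"
  assumes "continuous_map (product_topology (\<lambda>_. euclidean) S) euclidean f"
  shows "continuous_on (extensional S) f"
proof -
  have "continuous_map (subtopology euclidean (extensional S)) (product_topology (\<lambda>_. euclidean :: real topology) S)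
     (\<lambda>x. x)"
    by (auto simp: continuous_map_componentwise topspace_subtopology
        intro: continuous_on_product_then_coordinatewise)
  from continuous_map_compose[OF this assms] show ?thesis
    by (simp add: comp_def)
qed

text \<open>On the space of the product measure the coordinates outside \<open>S\<close> are
  constantly \<open>undefined\<close>, hence measurable. Countability of the index type makes the
  Borel sets of the function type those of the full product.\<close>

lemma measurable_ident_PiM_borel:
  "(\<lambda>x. x) \<in> measurable (\<Pi>\<^sub>M i\<in>S. borel :: real measure) (borel :: ('i::countable \<Rightarrow> real) measure)"
  unfolding measurable_cong_sets[OF refl sets_PiM_equal_borel[symmetric]]
proof (rule measurable_PiM_single')
  fix i :: 'i
  show "(\<lambda>x. x i) \<in> borel_measurable (\<Pi>\<^sub>M i\<in>S. borel :: real measure)"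
  proof (cases "i \<in> S")
    case False
    then have "x i = undefined" if "x \<in> space (\<Pi>\<^sub>M i\<in>S. borel :: real measure)" for x
      using that by (auto simp: space_PiM PiE_def extensional_def)
    then show ?thesis by (subst measurable_cong[where g = "\<lambda>_. undefined"]) auto
  qed measurable
qed auto

lemma borel_measurable_PiM_continuous:
  fixes f :: "('i::countable \<Rightarrow> real) \<Rightarrow> real"
  assumes "continuous_on (extensional S) f"
  shows "f \<in> borel_measurable (\<Pi>\<^sub>M i\<in>S. borel)"
proof -
  have "(\<lambda>x. f (restrict x S)) \<in> borel_measurable borel"
    by (intro borel_measurable_continuous_onI continuous_on_restrict_extensional assms)
  from measurable_compose[OF measurable_ident_PiM_borel this] show ?thesis
    by (subst measurable_cong[where g = "\<lambda>x. f (restrict x S)"])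
      (auto simp: space_PiM PiE_def extensional_restrict)
qed

text \<open>Both measures are pushed to the full function type, which is a metric space, compared
  there by \<open>measure_eqI_continuous\<close>, and recovered by pushing back along the retraction
  \<open>restrict\<close>.\<close>

lemma measure_eqI_PiM_continuous:
  fixes M N :: "('i::countable \<Rightarrow> real) measure"
  assumes fin: "finite_measure M" "finite_measure N"
    and sets: "sets M = sets (\<Pi>\<^sub>M i\<in>S. borel)" "sets N = sets (\<Pi>\<^sub>M i\<in>S. borel)"
    and eq: "\<And>f :: ('i \<Rightarrow> real) \<Rightarrow> real. continuous_on (extensional S) f \<Longrightarrow> (\<And>x. f x \<in> {0..1}) \<Longrightarrow>
      integral\<^sup>L M f = integral\<^sup>L N f"
  shows "M = N"
proof -
  let ?S = "\<Pi>\<^sub>M i\<in>S. borel :: real measure"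
  have res: "(\<lambda>x. restrict x S) \<in> measurable (borel :: ('i \<Rightarrow> real) measure) ?S"
    unfolding measurable_cong_sets[OF sets_PiM_equal_borel[symmetric] refl]
    by (rule measurable_restrict_subset) simp
  have meas: "(\<lambda>x. x) \<in> measurable Q (borel :: ('i \<Rightarrow> real) measure)" if "sets Q = sets ?S" for Q
    using measurable_ident_PiM_borel that by (simp cong: measurable_cong_sets)
  have retract: "distr (distr Q borel (\<lambda>x. x)) ?S (\<lambda>x. restrict x S) = Q"
    if Q: "sets Q = sets ?S" for Q
  proof -
    have "distr (distr Q borel (\<lambda>x. x)) ?S (\<lambda>x. restrict x S) = distr Q ?S (\<lambda>x. restrict x S)"
      by (subst distr_distr[OF res meas[OF Q]]) (simp add: comp_def)
    also have "\<dots> = distr Q Q (\<lambda>x. x)"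
      using sets_eq_imp_space_eq[OF Q]
      by (intro distr_cong) (auto simp: Q space_PiM PiE_def extensional_restrict)
    finally show ?thesis by (simp add: distr_id)
  qed
  have "distr M borel (\<lambda>x. x) = distr N borel (\<lambda>x. x)"
  proof (rule measure_eqI_continuous)
    fix f :: "('i \<Rightarrow> real) \<Rightarrow> real" assume f: "continuous_on UNIV f" "\<And>x. f x \<in> {0..1}"
    have [measurable]: "f \<in> borel_measurable borel"
      by (intro borel_measurable_continuous_onI f)
    show "(\<integral>x. f x \<partial>distr M borel (\<lambda>x. x)) = (\<integral>x. f x \<partial>distr N borel (\<lambda>x. x))"
      using eq[OF continuous_on_subset[OF f(1)] f(2)] meas[OF sets(1)] meas[OF sets(2)]
      by (simp add: integral_distr)
  qed (use finite_measure.finite_measure_distr[OF fin(1) meas[OF sets(1)]]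
      finite_measure.finite_measure_distr[OF fin(2) meas[OF sets(2)]] in auto)
  then show ?thesis using retract[OF sets(1)] retract[OF sets(2)] by metis
qed

text \<open>Filling the coordinates outside \<open>S\<close> with the singleton
  \<open>{undefined}\<close> gives a product over the whole index type, to which Tychonoff's theorem
  applies.\<close>

lemma compact_PiE_cbox:
  "compact (\<Pi>\<^sub>E i\<in>S. {a i .. b i :: real})"
proof -
  have "(\<Pi>\<^sub>E i\<in>S. {a i .. b i}) = (\<Pi>\<^sub>E i\<in>UNIV. if i \<in> S then {a i .. b i} else {undefined})"
    by (auto simp: PiE_def Pi_def extensional_def split: if_splits)
  moreover have "compactin (product_topology (\<lambda>_. euclidean) UNIV) (\<Pi>\<^sub>E i\<in>UNIV. if i \<in> S then {a i .. b i} else {undefined})"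
    unfolding compactin_PiE by auto
  ultimately show ?thesis by (simp add: euclidean_product_topology)
qed

text \<open>The metric of the function type weights the n-th coordinate by (1/2)^n; the 2 is the sum
  of these weights.\<close>

lemma dist_fun_le:
  fixes x y :: "'i::countable \<Rightarrow> real"
  assumes "\<And>i. \<bar>x i - y i\<bar> \<le> e"
  shows "dist x y \<le> 2 * e"
proof -
  have e: "e \<ge> 0" using assms[of undefined] by linarith
  have "dist x y = (\<Sum>n. (1/2)^n * min (dist (x (from_nat n)) (y (from_nat n))) 1)"
    by (simp add: dist_fun_def)
  also have "\<dots> \<le> (\<Sum>n. (1/2)^n * e)"
  proof (rule suminf_le)
    show s: "summable (\<lambda>n. (1/2)^n * e)" by (intro summable_mult2) simp
    show *: "(1/2)^n * min (dist (x (from_nat n)) (y (from_nat n))) 1 \<le> (1/2)^n * e" for n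
      using assms[of "from_nat n"] by (intro mult_left_mono) (auto simp: dist_real_def)
    show "summable (\<lambda>n. (1/2)^n * min (dist (x (from_nat n)) (y (from_nat n))) 1)"
      by (rule summable_comparison_test'[OF s, of 0]) (use * in auto)
  qed
  also have "\<dots> = 2 * e" by (simp add: suminf_mult2[symmetric] suminf_geometric)
  finally show ?thesis .
qed

section \<open>Affine iterated function systems with place-dependent probabilities\<close>

text \<open>\<open>H\<close> is the part common to all maps, \<open>v s\<close> the translation
  selected by the choice \<open>s\<close>, \<open>N\<close> the adapted norm, and
  \<open>\<eta>\<close> a modulus for the variation of the choice probabilities. The Dini condition
  enters as \<open>\<eta>_summable\<close>, along the ratio at which distances shrink.
  \<open>N\<close> takes arbitrary functions because the difference of two extensional functions
  need not be extensional; \<open>N_upper\<close> makes it blind to coordinates outside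
  \<open>S\<close>.\<close>

locale contractive_chain =
  fixes S :: "'i::countable set"
    and H :: "('i \<Rightarrow> real) \<Rightarrow> 'i \<Rightarrow> real"
    and N :: "('i \<Rightarrow> real) \<Rightarrow> real"
    and Sig :: "'s set"
    and v :: "'s \<Rightarrow> 'i \<Rightarrow> real"
    and p :: "('i \<Rightarrow> real) \<Rightarrow> 's pmf"
    and ker :: "('i \<Rightarrow> real) \<Rightarrow> ('i \<Rightarrow> real) measure"
    and \<rho> C \<delta> :: real and \<eta> :: "real \<Rightarrow> real"
  assumes finite_S: "finite S" and finite_Sig: "finite Sig"
    and N_nonneg: "0 \<le> N z"
    and N_lower: "i \<in> S \<Longrightarrow> \<bar>z i\<bar> \<le> N z"
    and N_upper: "N z \<le> C * (\<Sum>i\<in>S. \<bar>z i\<bar>)"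
    and N_add: "N (\<lambda>i. z i + z' i) \<le> N z + N z'"
    and N_minus: "N (\<lambda>i. - z i) = N z"
    and contraction: "N (\<lambda>i. H x i - H y i) \<le> \<rho> * N (\<lambda>i. x i - y i)"
    and \<rho>: "0 < \<rho>" "\<rho> < 1" and C: "0 \<le> C"
    and support: "x \<in> extensional S \<Longrightarrow> set_pmf (p x) \<subseteq> Sig"
    and variation: "x \<in> extensional S \<Longrightarrow> y \<in> extensional S \<Longrightarrow>
      (\<Sum>s\<in>Sig. \<bar>pmf (p x) s - pmf (p y) s\<bar>) \<le> \<eta> (N (\<lambda>i. x i - y i))"
    and \<eta>_nonneg: "0 \<le> t \<Longrightarrow> 0 \<le> \<eta> t"
    and \<eta>_mono: "0 \<le> t \<Longrightarrow> t \<le> t' \<Longrightarrow> \<eta> t \<le> \<eta> t'"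
    and \<eta>_summable: "0 \<le> t \<Longrightarrow> summable (\<lambda>n. \<eta> (\<rho> ^ n * t))"
    and \<delta>: "0 < \<delta>"
    and minorized: "x \<in> extensional S \<Longrightarrow> s \<in> Sig \<Longrightarrow> \<delta> \<le> pmf (p x) s"
    and ker: "x \<in> extensional S \<Longrightarrow> ker x =
      distr (measure_pmf (p x)) (\<Pi>\<^sub>M i\<in>S. borel) (\<lambda>s. \<lambda>i\<in>S. H x i + v s i)"
begin

abbreviation "E \<equiv> extensional S :: ('i \<Rightarrow> real) set"

section \<open>The contracting distance and the transition operator\<close>

definition d :: "('i \<Rightarrow> real) \<Rightarrow> ('i \<Rightarrow> real) \<Rightarrow> real" where
  "d x y = N (\<lambda>i. x i - y i)"

definition F :: "'s \<Rightarrow> ('i \<Rightarrow> real) \<Rightarrow> 'i \<Rightarrow> real" where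
  "F s x = (\<lambda>i\<in>S. H x i + v s i)"

definition P :: "(('i \<Rightarrow> real) \<Rightarrow> real) \<Rightarrow> ('i \<Rightarrow> real) \<Rightarrow> real" where
  "P f x = (\<Sum>s\<in>Sig. pmf (p x) s * f (F s x))"

lemma d_nonneg: "0 \<le> d x y"
  by (simp add: d_def N_nonneg)

lemma d_commute: "d x y = d y x"
  using N_minus[of "\<lambda>i. x i - y i"] by (simp add: d_def)

lemma d_triangle: "d x z \<le> d x y + d y z"
  using N_add[of "\<lambda>i. x i - y i" "\<lambda>i. y i - z i"] by (simp add: d_def)

lemma coord_le_d: "i \<in> S \<Longrightarrow> \<bar>x i - y i\<bar> \<le> d x y"
  using N_lower[of i "\<lambda>i. x i - y i"] by (simp add: d_def)

lemma d_le_sum: "d x y \<le> C * (\<Sum>i\<in>S. \<bar>x i - y i\<bar>)"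
  using N_upper[of "\<lambda>i. x i - y i"] by (simp add: d_def)

lemma d_eq_0: "(\<And>i. i \<in> S \<Longrightarrow> x i = y i) \<Longrightarrow> d x y = 0"
  using d_le_sum[of x y] d_nonneg[of x y] by simp

text \<open>Points that agree on \<open>S\<close> are at distance 0, so the triangle inequality
  allows either argument to be exchanged.\<close>

lemma d_cong:
  assumes "\<And>i. i \<in> S \<Longrightarrow> x i = x' i" "\<And>i. i \<in> S \<Longrightarrow> y i = y' i"
  shows "d x y = d x' y'"
proof -
  have "d x x' = 0" "d y y' = 0" using assms by (auto intro: d_eq_0)
  then show ?thesis
    using d_triangle[of x y x'] d_triangle[of x' y y'] d_triangle[of x' y' x] d_triangle[of x y' y]
    by (simp add: d_commute)
qed

lemma d_affine: "d (\<lambda>i\<in>S. H x i + w i) (\<lambda>i\<in>S. H y i + w i) \<le> \<rho> * d x y"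
proof -
  have "d (\<lambda>i\<in>S. H x i + w i) (\<lambda>i\<in>S. H y i + w i) = d (\<lambda>i. H x i + w i) (\<lambda>i. H y i + w i)"
    by (rule d_cong) auto
  then show ?thesis using contraction[of x y] by (simp add: d_def)
qed

lemma F_in_E [simp]: "F s x \<in> E"
  by (simp add: F_def)

lemma d_F: "d (F s x) (F s y) \<le> \<rho> * d x y"
  unfolding F_def by (rule d_affine)

lemma \<rho>_le: "0 \<le> t \<Longrightarrow> \<rho> * t \<le> t"
  using \<rho> mult_right_mono[of \<rho> 1 t] by simp

lemma Sig_nonempty: "Sig \<noteq> {}"
  using support[of "restrict undefined S"] set_pmf_not_empty by fastforce

lemma sum_pmf: "x \<in> E \<Longrightarrow> (\<Sum>s\<in>Sig. pmf (p x) s) = 1"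
  using sum_pmf_eq_1[OF finite_Sig support] by simp

text \<open>The terms of the summable series at \<open>t = 1\<close> tend to 0, and monotonicity
  extends a small value at \<open>\<rho> ^ n\<close> to all smaller arguments.\<close>

lemma \<eta>_tendsto_0:
  assumes "0 < e" obtains t where "0 < t" "\<And>u. 0 \<le> u \<Longrightarrow> u \<le> t \<Longrightarrow> \<eta> u < e"
proof -
  have "(\<lambda>n. \<eta> (\<rho> ^ n * 1)) \<longlonglongrightarrow> 0"
    by (rule summable_LIMSEQ_zero) (rule \<eta>_summable, simp)
  from order_tendstoD(2)[OF this assms] obtain n where "\<eta> (\<rho> ^ n) < e"
    by (auto simp: eventually_sequentially)
  then show ?thesis
    using \<eta>_mono \<rho> by (intro that[of "\<rho> ^ n"]) (auto intro: le_less_trans)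
qed

text \<open>\<open>d\<close> is dominated by a multiple of the coordinate sum, which is continuous
  in the product topology; a modulus in terms of \<open>d\<close> therefore gives continuity in that
  topology.\<close>

lemma continuous_on_E:
  fixes f g :: "_ \<Rightarrow> real"
  assumes mod: "\<And>x y. x \<in> E \<Longrightarrow> y \<in> E \<Longrightarrow> \<bar>f x - f y\<bar> \<le> g (d x y)"
    and g: "\<And>e. 0 < e \<Longrightarrow> \<exists>t>0. \<forall>u. 0 \<le> u \<and> u < t \<longrightarrow> g u < e"
  shows "continuous_on E f"
proof (unfold continuous_on_def, intro ballI tendstoI)
  fix x and e :: real assume x: "x \<in> E" and e: "0 < e"
  obtain t where t: "t > 0" "\<And>u. 0 \<le> u \<Longrightarrow> u < t \<Longrightarrow> g u < e" using g[OF e] by blast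
  have coord: "((\<lambda>y. y i) \<longlongrightarrow> x i) (at x within E)" for i
    using continuous_on_product_then_coordinatewise[OF continuous_on_id, of E i] x
    by (simp add: continuous_on_def)
  have "((\<lambda>y. C * (\<Sum>i\<in>S. \<bar>y i - x i\<bar>)) \<longlongrightarrow> C * (\<Sum>i\<in>S. \<bar>x i - x i\<bar>)) (at x within E)"
    by (intro tendsto_intros coord)
  then have "eventually (\<lambda>y. C * (\<Sum>i\<in>S. \<bar>y i - x i\<bar>) < t) (at x within E)"
    by (rule order_tendstoD) (simp add: t)
  moreover have "eventually (\<lambda>y. y \<in> E) (at x within E)"
    by (simp add: eventually_at_topological) (metis open_UNIV UNIV_I)
  ultimately show "eventually (\<lambda>y. dist (f y) (f x) < e) (at x within E)"
  proof eventually_elim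
    case (elim y)
    then have "g (d y x) < e"
      using d_le_sum[of y x] by (intro t d_nonneg) linarith
    then show ?case using mod[OF elim(2) x] by (simp add: dist_real_def)
  qed
qed

lemma H_lipschitz: "i \<in> S \<Longrightarrow> \<bar>H x i - H y i\<bar> \<le> \<rho> * d x y"
  unfolding d_def by (rule order_trans[OF N_lower[of i "\<lambda>i. H x i - H y i"] contraction])

lemma continuous_on_H:
  assumes "i \<in> S"
  shows "continuous_on E (\<lambda>x. H x i)"
proof (rule continuous_on_E[where g = "\<lambda>t. \<rho> * t"])
  show "\<bar>H x i - H y i\<bar> \<le> \<rho> * d x y" for x y
    using assms by (rule H_lipschitz)
next
  fix e :: real assume "0 < e"
  then show "\<exists>t>0. \<forall>u. 0 \<le> u \<and> u < t \<longrightarrow> \<rho> * u < e"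
    using \<rho>_le by (metis le_less_trans)
qed

lemma continuous_on_F: "continuous_on E (F s)"
  unfolding F_def
  by (rule continuous_on_extensional_coordinatewise[where S = S]) (auto intro!: continuous_intros continuous_on_H)

lemma continuous_on_pmf: "continuous_on E (\<lambda>x. pmf (p x) s)"
proof (cases "s \<in> Sig")
  case True
  show ?thesis
  proof (rule continuous_on_E[where g = \<eta>])
    fix x y assume xy: "x \<in> E" "y \<in> E"
    have "\<bar>pmf (p x) s - pmf (p y) s\<bar> \<le> (\<Sum>s\<in>Sig. \<bar>pmf (p x) s - pmf (p y) s\<bar>)"
      by (rule member_le_sum[OF True]) (auto simp: finite_Sig)
    then show "\<bar>pmf (p x) s - pmf (p y) s\<bar> \<le> \<eta> (d x y)"
      using variation[OF xy] by (simp add: d_def)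
  next
    fix e :: real assume "0 < e"
    then show "\<exists>t>0. \<forall>u. 0 \<le> u \<and> u < t \<longrightarrow> \<eta> u < e"
      by (metis \<eta>_tendsto_0 less_imp_le)
  qed
next
  case False
  then have "pmf (p x) s = 0" if "x \<in> E" for x
    using support[OF that] by (auto simp: set_pmf_iff)
  then show ?thesis by (simp cong: continuous_on_cong)
qed

lemma continuous_on_P: "continuous_on E f \<Longrightarrow> continuous_on E (P f)"
  unfolding P_def
  by (intro continuous_intros continuous_on_pmf continuous_on_compose2[OF _ continuous_on_F]) auto

lemma P_mono:
  assumes x: "x \<in> E" and "\<And>s. s \<in> Sig \<Longrightarrow> f (F s x) \<le> g (F s x)"
  shows "P f x \<le> P g x"
  unfolding P_def by (intro sum_mono mult_left_mono assms) auto

lemma P_const: "x \<in> E \<Longrightarrow> P (\<lambda>_. c) x = c"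
  by (simp add: P_def sum_pmf flip: sum_distrib_right)

lemma P_le: "x \<in> E \<Longrightarrow> (\<And>s. s \<in> Sig \<Longrightarrow> f (F s x) \<le> c) \<Longrightarrow> P f x \<le> c"
  using P_mono[of x f "\<lambda>_. c"] P_const by simp

lemma P_ge: "x \<in> E \<Longrightarrow> (\<And>s. s \<in> Sig \<Longrightarrow> c \<le> f (F s x)) \<Longrightarrow> c \<le> P f x"
  using P_mono[of x "\<lambda>_. c" f] P_const by simp

lemma P_bounded:
  assumes "x \<in> E" "\<And>y. y \<in> E \<Longrightarrow> \<bar>f y\<bar> \<le> B"
  shows "\<bar>P f x\<bar> \<le> B"
proof -
  have "- B \<le> f (F s x) \<and> f (F s x) \<le> B" for s
    using assms(2)[OF F_in_E, of s x] by (simp add: abs_le_iff)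
  then show ?thesis using P_le[OF assms(1), of f B] P_ge[OF assms(1), of "-B" f] by (simp add: abs_le_iff)
qed

lemma P_iter_continuous: "continuous_on E f \<Longrightarrow> continuous_on E ((P ^^ n) f)"
  by (induction n) (auto intro: continuous_on_P)

lemma P_iter_bounded: "(\<And>y. y \<in> E \<Longrightarrow> \<bar>f y\<bar> \<le> B) \<Longrightarrow> x \<in> E \<Longrightarrow> \<bar>(P ^^ n) f x\<bar> \<le> B"
  by (induction n arbitrary: x) (auto intro: P_bounded)

text \<open>
  The choices made at \<open>x\<close> and at \<open>y\<close> are coupled maximally: with probability \<open>1 - \<theta>\<close> the same map
  is applied to both points.
\<close>

lemma P_coupling:
  assumes xy: "x \<in> E" "y \<in> E"
    and range: "\<And>s z. s \<in> Sig \<Longrightarrow> z \<in> {x, y} \<Longrightarrow> f (F s z) \<in> {lo..lo + D}"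
    and close: "\<And>s. s \<in> Sig \<Longrightarrow> \<bar>f (F s x) - f (F s y)\<bar> \<le> e"
  obtains \<theta> where "0 \<le> \<theta>" "\<theta> \<le> 1 - \<delta>" "\<theta> \<le> \<eta> (d x y)" "\<bar>P f x - P f y\<bar> \<le> (1 - \<theta>) * e + \<theta> * D"
proof
  \<comment> \<open>\<open>m\<close> is the mass common to both distributions, on which the same map
    is applied; \<open>\<theta>\<close> is the mass left over on either side.\<close>
  define m where "m s = min (pmf (p x) s) (pmf (p y) s)" for s
  define \<theta> where "\<theta> = 1 - (\<Sum>s\<in>Sig. m s)"
  have m: "0 \<le> m s" "m s \<le> pmf (p x) s" "m s \<le> pmf (p y) s" for s by (auto simp: m_def)
  have \<theta>x: "(\<Sum>s\<in>Sig. pmf (p x) s - m s) = \<theta>" and \<theta>y: "(\<Sum>s\<in>Sig. pmf (p y) s - m s) = \<theta>"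
    by (simp_all add: \<theta>_def sum_subtractf sum_pmf xy)
  show "0 \<le> \<theta>" unfolding \<theta>x[symmetric] by (intro sum_nonneg) (simp add: m)
  \<comment> \<open>A single choice already contributes common mass at least
    \<open>\<delta>\<close>.\<close>
  obtain s0 where s0: "s0 \<in> Sig" using Sig_nonempty by blast
  have "m s0 \<le> (\<Sum>s\<in>Sig. m s)" by (rule member_le_sum[OF s0]) (auto simp: m finite_Sig)
  moreover have "\<delta> \<le> m s0" using minorized[OF _ s0] xy by (simp add: m_def)
  ultimately show "\<theta> \<le> 1 - \<delta>" by (simp add: \<theta>_def)
  have "\<theta> \<le> (\<Sum>s\<in>Sig. \<bar>pmf (p x) s - pmf (p y) s\<bar>)"
    unfolding \<theta>x[symmetric] by (intro sum_mono) (auto simp: m_def)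
  then show "\<theta> \<le> \<eta> (d x y)" using variation[OF xy] by (simp add: d_def)
  have split: "P f x - P f y = (\<Sum>s\<in>Sig. m s * (f (F s x) - f (F s y)))
      + (\<Sum>s\<in>Sig. (pmf (p x) s - m s) * f (F s x)) - (\<Sum>s\<in>Sig. (pmf (p y) s - m s) * f (F s y))"
    by (simp add: P_def algebra_simps sum_subtractf sum.distrib)
  have "\<bar>\<Sum>s\<in>Sig. m s * (f (F s x) - f (F s y))\<bar> \<le> (\<Sum>s\<in>Sig. m s * e)"
    by (rule order_trans[OF sum_abs]) (intro sum_mono, simp add: abs_mult m mult_left_mono close)
  then have main: "\<bar>\<Sum>s\<in>Sig. m s * (f (F s x) - f (F s y))\<bar> \<le> (1 - \<theta>) * e"
    by (simp add: \<theta>_def flip: sum_distrib_right)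
  \<comment> \<open>Both leftover parts have mass \<open>\<theta>\<close> and values in the same
    interval of length \<open>D\<close>, so they differ by at most \<open>\<theta> * D\<close>,
    however the leftover mass is distributed.\<close>
  have rest: "(\<Sum>s\<in>Sig. (pmf (p z) s - m s) * f (F s z)) \<in> {\<theta> * lo .. \<theta> * (lo + D)}"
    if z: "z \<in> {x, y}" for z
  proof -
    have "\<theta> = (\<Sum>s\<in>Sig. pmf (p z) s - m s)" using z \<theta>x \<theta>y by auto
    moreover have "0 \<le> pmf (p z) s - m s" for s using z m[of s] by auto
    ultimately show ?thesis
      using range[OF _ z]
      by (auto simp: sum_distrib_right intro!: sum_mono mult_left_mono)
  qed
  have "\<theta> * (lo + D) = \<theta> * lo + \<theta> * D" by (simp add: algebra_simps)
  then show "\<bar>P f x - P f y\<bar> \<le> (1 - \<theta>) * e + \<theta> * D"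
    using rest[of x] rest[of y] main unfolding split by auto
qed

section \<open>Iterates of the operator on an invariant set\<close>

context
  fixes K :: "('i \<Rightarrow> real) set"
  assumes K_sub: "K \<subseteq> E" and K_inv: "\<And>s x. s \<in> Sig \<Longrightarrow> x \<in> K \<Longrightarrow> F s x \<in> K"
begin

lemma P_iter_range:
  assumes "\<And>x. x \<in> K \<Longrightarrow> f x \<in> {lo..hi}" "x \<in> K"
  shows "(P ^^ n) f x \<in> {lo..hi}"
  using assms(2)
proof (induction n arbitrary: x)
  case (Suc n)
  then show ?case
    using K_sub K_inv by (auto intro!: P_le P_ge)
qed (use assms in auto)

text \<open>As long as the choices agree, the distance after \<open>j\<close> steps is at most
  \<open>\<rho> ^ j * s\<close>, so the next choices disagree with probability at most
  \<open>\<eta>\<close> of that; a disagreement costs at most \<open>D\<close>. Conditioning on the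
  first step replaces \<open>s\<close> by \<open>\<rho> * s\<close>, hence the induction over
  arbitrary \<open>s\<close> and the shifted sum.\<close>

lemma P_iter_equicontinuous:
  assumes range: "\<And>x. x \<in> K \<Longrightarrow> f x \<in> {lo..lo + D}"
    and mod: "\<And>x y. x \<in> K \<Longrightarrow> y \<in> K \<Longrightarrow> d x y \<le> t \<Longrightarrow> \<bar>f x - f y\<bar> \<le> e"
    and "s \<le> t" "x \<in> K" "y \<in> K" "d x y \<le> s"
  shows "\<bar>(P ^^ n) f x - (P ^^ n) f y\<bar> \<le> e + (\<Sum>j<n. \<eta> (\<rho> ^ j * s)) * D"
  using assms(3-)
proof (induction n arbitrary: x y s)
  case 0
  then show ?case using mod by simp
next
  case (Suc n)
  have D: "0 \<le> D" using range[OF Suc.prems(2)] by auto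
  have s: "0 \<le> s" using d_nonneg Suc.prems(4) by (rule order_trans)
  have e: "0 \<le> e" using mod[of x x] Suc.prems d_eq_0[of x x] s by simp
  let ?e = "e + (\<Sum>j<n. \<eta> (\<rho> ^ j * (\<rho> * s))) * D"
  have pos: "0 \<le> ?e"
    using e s \<rho> by (auto intro!: add_nonneg_nonneg mult_nonneg_nonneg sum_nonneg \<eta>_nonneg D)
  have xy: "x \<in> E" "y \<in> E" using Suc.prems K_sub by auto
  have rng: "(P ^^ n) f (F s z) \<in> {lo..lo + D}" if "s \<in> Sig" "z \<in> {x, y}" for s z
    using that Suc.prems by (intro P_iter_range range K_inv) auto
  have cls: "\<bar>(P ^^ n) f (F s' x) - (P ^^ n) f (F s' y)\<bar> \<le> ?e" if "s' \<in> Sig" for s'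
  proof (rule Suc.IH)
    show "\<rho> * s \<le> t" using \<rho>_le[OF s] Suc.prems(1) by linarith
    show "d (F s' x) (F s' y) \<le> \<rho> * s"
      using d_F[of s' x y] mult_left_mono[OF Suc.prems(4), of \<rho>] \<rho> by linarith
  qed (use that Suc.prems K_inv in auto)
  obtain \<theta> where \<theta>: "0 \<le> \<theta>" "\<theta> \<le> 1 - \<delta>" "\<theta> \<le> \<eta> (d x y)"
    "\<bar>P ((P ^^ n) f) x - P ((P ^^ n) f) y\<bar> \<le> (1 - \<theta>) * ?e + \<theta> * D"
    using P_coupling[OF xy rng cls] by blast
  have "\<theta> \<le> \<eta> s" using \<theta>(3) \<eta>_mono[OF d_nonneg Suc.prems(4)] by linarith
  then have "\<theta> * D \<le> \<eta> s * D" using D by (rule mult_right_mono)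
  moreover have "(1 - \<theta>) * ?e \<le> ?e" using \<theta>(1) pos mult_right_mono[of "1 - \<theta>" 1 ?e] by simp
  moreover have "?e + \<eta> s * D = e + (\<Sum>j<Suc n. \<eta> (\<rho> ^ j * s)) * D"
    unfolding sum.lessThan_Suc_shift by (simp add: algebra_simps)
  ultimately show ?case using \<theta>(4) by simp
qed

text \<open>With probability at least \<open>\<delta> ^ n\<close> all \<open>n\<close> choices
  agree; the points are then within \<open>t\<close> and the values within \<open>e\<close>. In the
  remaining cases the values differ by at most \<open>D\<close>.\<close>

lemma P_iter_contracts:
  assumes range: "\<And>x. x \<in> K \<Longrightarrow> f x \<in> {lo..lo + D}"
    and mod: "\<And>x y. x \<in> K \<Longrightarrow> y \<in> K \<Longrightarrow> d x y \<le> t \<Longrightarrow> \<bar>f x - f y\<bar> \<le> e" and "e \<le> D"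
    and "\<rho> ^ n * s \<le> t" "x \<in> K" "y \<in> K" "d x y \<le> s"
  shows "\<bar>(P ^^ n) f x - (P ^^ n) f y\<bar> \<le> \<delta> ^ n * e + (1 - \<delta> ^ n) * D"
  using assms(4-)
proof (induction n arbitrary: x y s)
  case 0
  then show ?case using mod by simp
next
  case (Suc n)
  let ?e = "\<delta> ^ n * e + (1 - \<delta> ^ n) * D"
  have xy: "x \<in> E" "y \<in> E" using Suc.prems K_sub by auto
  have rng: "(P ^^ n) f (F s z) \<in> {lo..lo + D}" if "s \<in> Sig" "z \<in> {x, y}" for s z
    using that Suc.prems by (intro P_iter_range range K_inv) auto
  have cls: "\<bar>(P ^^ n) f (F s' x) - (P ^^ n) f (F s' y)\<bar> \<le> ?e" if "s' \<in> Sig" for s'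
  proof (rule Suc.IH)
    show "\<rho> ^ n * (\<rho> * s) \<le> t" using Suc.prems(1) by (simp add: algebra_simps)
    show "d (F s' x) (F s' y) \<le> \<rho> * s"
      using d_F[of s' x y] mult_left_mono[OF Suc.prems(4), of \<rho>] \<rho> by linarith
  qed (use that Suc.prems K_inv in auto)
  obtain \<theta> where \<theta>: "0 \<le> \<theta>" "\<theta> \<le> 1 - \<delta>"
    "\<bar>P ((P ^^ n) f) x - P ((P ^^ n) f) y\<bar> \<le> (1 - \<theta>) * ?e + \<theta> * D"
    using P_coupling[OF xy rng cls] by blast
  have "\<delta> ^ n * (D - e) \<ge> 0" using \<open>e \<le> D\<close> \<delta> by simp
  then have "?e \<le> D" by (simp add: algebra_simps)
  \<comment> \<open>As \<open>?e\<close> is at most \<open>D\<close>, the coupling bound increases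
    with \<open>\<theta>\<close>, so the worst case \<open>\<theta> = 1 - \<delta>\<close> may be
    inserted.\<close>
  then have "(1 - \<delta> - \<theta>) * (D - ?e) \<ge> 0" using \<theta>(2) by (intro mult_nonneg_nonneg) auto
  then have "(1 - \<theta>) * ?e + \<theta> * D \<le> \<delta> * ?e + (1 - \<delta>) * D" by (simp add: algebra_simps)
  also have "\<dots> = \<delta> ^ Suc n * e + (1 - \<delta> ^ Suc n) * D" by (simp add: algebra_simps)
  finally show ?case using \<theta>(3) by simp
qed

lemma P_iter_tendsto_const:
  assumes ne: "K \<noteq> {}" and bounded: "\<And>x. x \<in> K \<Longrightarrow> \<bar>f x\<bar> \<le> B"
    and diam: "\<And>x y. x \<in> K \<Longrightarrow> y \<in> K \<Longrightarrow> d x y \<le> R"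
    and uc: "\<And>e. 0 < e \<Longrightarrow> \<exists>t>0. \<forall>x\<in>K. \<forall>y\<in>K. d x y \<le> t \<longrightarrow> \<bar>f x - f y\<bar> \<le> e"
  shows "\<exists>m. \<forall>x\<in>K. (\<lambda>n. (P ^^ n) f x) \<longlonglongrightarrow> m"
proof -
  define hi where "hi n = (SUP x\<in>K. (P ^^ n) f x)" for n
  define lo where "lo n = (INF x\<in>K. (P ^^ n) f x)" for n
  have B: "(P ^^ n) f x \<in> {-B..B}" if "x \<in> K" for n x
    using that bounded by (intro P_iter_range) (auto simp: abs_le_iff minus_le_iff)
  have bdd: "bdd_above ((P ^^ n) f ` K)" "bdd_below ((P ^^ n) f ` K)" for n
    using B by (auto intro!: bdd_aboveI2[where M = B] bdd_belowI2[where m = "-B"])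
  have between: "(P ^^ n) f x \<in> {lo n..hi n}" if "x \<in> K" for n x
    using that bdd by (auto simp: hi_def lo_def intro: cSUP_upper cINF_lower)
  have later: "(P ^^ (n + k)) f x \<in> {lo n..hi n}" if "x \<in> K" for n k x
    using P_iter_range[of "(P ^^ n) f" "lo n" "hi n", OF between that, of k] by (simp add: add.commute funpow_add)
  have hi_dec: "hi (n + k) \<le> hi n" for n k
    unfolding hi_def[of "n + k"] using ne later by (intro cSUP_least) auto
  have lo_inc: "lo n \<le> lo (n + k)" for n k
    unfolding lo_def[of "n + k"] using ne later by (intro cINF_greatest) auto
  define D where "D n = hi n - lo n" for n
  have D_le: "D n \<le> c" if c: "\<And>x y. x \<in> K \<Longrightarrow> y \<in> K \<Longrightarrow> \<bar>(P ^^ n) f x - (P ^^ n) f y\<bar> \<le> c" for n c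
  proof -
    have "hi n \<le> c + (P ^^ n) f y" if y: "y \<in> K" for y
      unfolding hi_def using ne c[OF _ y]
      by (intro cSUP_least) (auto simp: abs_le_iff algebra_simps)
    then have "hi n - c \<le> lo n"
      unfolding lo_def using ne by (intro cINF_greatest) (auto simp: algebra_simps)
    then show ?thesis by (simp add: D_def)
  qed
  have D_nonneg: "0 \<le> D n" for n using between[of _ n] ne by (fastforce simp: D_def)
  have "decseq hi" "incseq lo"
    using hi_dec lo_inc by (auto simp: decseq_def incseq_def le_iff_add)
  have lo_hi: "-B \<le> hi n" "lo n \<le> B" for n
    using between[of _ n] B[of _ n] ne by fastforce+
  obtain h where h: "hi \<longlonglongrightarrow> h"
    using decseq_convergent[OF \<open>decseq hi\<close>, of "-B"] lo_hi by metis
  obtain l where l: "lo \<longlonglongrightarrow> l"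
    using incseq_convergent[OF \<open>incseq lo\<close>, of B] lo_hi by metis
  have D_lim: "D \<longlonglongrightarrow> h - l" unfolding D_def by (intro tendsto_intros h l)
  have D_ge: "h - l \<le> D n" for n
    unfolding D_def using decseq_ge[OF \<open>decseq hi\<close> h, of n] incseq_le[OF \<open>incseq lo\<close> l, of n] by linarith
  have "h - l \<le> 0"
  proof (rule ccontr)
    assume "\<not> h - l \<le> 0"
    \<comment> \<open>Half of the supposed limiting oscillation: a value strictly below the limit on
      an event of positive probability is what produces the contradiction.\<close>
    define e where "e = (h - l) / 2"
    have e: "0 < e" and e_le: "e \<le> D n" for n using \<open>\<not> h - l \<le> 0\<close> D_ge[of n] by (auto simp: e_def)
    obtain t where t: "t > 0" "\<And>x y. x \<in> K \<Longrightarrow> y \<in> K \<Longrightarrow> d x y \<le> t \<Longrightarrow> \<bar>f x - f y\<bar> \<le> e / 2"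
      using uc[of "e / 2"] e by auto
    \<comment> \<open>\<open>G k\<close> is the tail of the modulus series from index
      \<open>k\<close>. Shrinking the scale from \<open>t\<close> to \<open>\<rho> ^ k * t\<close>
      leaves only this tail as accumulated loss, uniformly in the number of iterates.\<close>
    define G where "G k = (\<Sum>j. \<eta> (\<rho> ^ (j + k) * t))" for k
    have sm: "summable (\<lambda>j. \<eta> (\<rho> ^ j * t))" using t by (intro \<eta>_summable) simp
    have "(\<lambda>k. G k * D 0) \<longlonglongrightarrow> 0 * D 0"
      unfolding G_def using suminf_exist_split2[OF sm] by (intro tendsto_intros) 
    then have "eventually (\<lambda>k. G k * D 0 < e / 2) sequentially"
      using e by (intro order_tendstoD(2)) auto
    then obtain k where k: "G k * D 0 < e / 2" by (auto simp: eventually_sequentially)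
    define u where "u = \<rho> ^ k * t"
    have u: "0 < u" "u \<le> t" using t \<rho> by (auto simp: u_def power_le_one mult_left_le_one_le)
    have equi: "\<bar>(P ^^ n) f x - (P ^^ n) f y\<bar> \<le> e" if "x \<in> K" "y \<in> K" "d x y \<le> u" for n x y
    proof -
      have rng: "f x \<in> {lo 0..lo 0 + D 0}" if "x \<in> K" for x
        using between[OF that, of 0] by (simp add: D_def)
      have "(\<Sum>j<n. \<eta> (\<rho> ^ j * u)) \<le> G k"
        unfolding G_def u_def using summable_ignore_initial_segment[OF sm, of k] t \<rho>
        by (subst mult.assoc[symmetric], subst power_add[symmetric])
           (intro sum_le_suminf \<eta>_nonneg, auto)
      then have "(\<Sum>j<n. \<eta> (\<rho> ^ j * u)) * D 0 \<le> G k * D 0"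
        using D_nonneg[of 0] by (rule mult_right_mono)
      moreover have "\<bar>(P ^^ n) f x - (P ^^ n) f y\<bar> \<le> e / 2 + (\<Sum>j<n. \<eta> (\<rho> ^ j * u)) * D 0"
        using P_iter_equicontinuous[OF rng t(2) u(2) that] by simp
      ultimately show ?thesis using k by linarith
    qed
    have "(\<lambda>n. \<rho> ^ n * R) \<longlonglongrightarrow> 0 * R" using \<rho> by (intro tendsto_intros LIMSEQ_power_zero) auto
    then have "eventually (\<lambda>n. \<rho> ^ n * R < u) sequentially"
      using u by (intro order_tendstoD(2)) auto
    \<comment> \<open>After \<open>n\<close> common choices any two points of \<open>K\<close> are
      within \<open>u\<close>.\<close>
    then obtain n where n: "\<rho> ^ n * R \<le> u" by (auto simp: eventually_sequentially intro: less_imp_le)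
    \<comment> \<open>\<open>P_iter_contracts\<close> is applied to \<open>(P ^^ k) f\<close>; since
      \<open>equi\<close> is uniform in \<open>k\<close>, the same \<open>n\<close> and
      \<open>e\<close> serve for every \<open>k\<close>, and \<open>k\<close> may tend to
      infinity.\<close>
    have step: "D (k + n) \<le> \<delta> ^ n * e + (1 - \<delta> ^ n) * D k" for k
    proof (rule D_le)
      fix x y assume xy: "x \<in> K" "y \<in> K"
      have "(P ^^ k) f z \<in> {lo k..lo k + D k}" if "z \<in> K" for z
        using between[OF that, of k] by (simp add: D_def)
      from P_iter_contracts[OF this equi e_le n xy diam[OF xy]]
      show "\<bar>(P ^^ (k + n)) f x - (P ^^ (k + n)) f y\<bar> \<le> \<delta> ^ n * e + (1 - \<delta> ^ n) * D k"
        by (simp add: add.commute[of k] funpow_add)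
    qed
    have "(\<lambda>k. D (k + n)) \<longlonglongrightarrow> h - l" using D_lim by (rule LIMSEQ_ignore_initial_segment)
    moreover have "(\<lambda>k. \<delta> ^ n * e + (1 - \<delta> ^ n) * D k) \<longlonglongrightarrow> \<delta> ^ n * e + (1 - \<delta> ^ n) * (h - l)"
      by (intro tendsto_intros D_lim)
    ultimately have "h - l \<le> \<delta> ^ n * e + (1 - \<delta> ^ n) * (h - l)"
      using step by (intro LIMSEQ_le) auto
    then have "\<delta> ^ n * (h - l - e) \<le> 0" by (simp add: algebra_simps)
    moreover have "0 < \<delta> ^ n * (h - l - e)" using \<delta> e by (simp add: e_def)
    ultimately show False by simp
  qed
  then have "h = l" using D_nonneg D_lim by (metis LIMSEQ_le_const add_0 diff_ge_0_iff_ge eq_iff diff_le_0_iff_le)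
  show ?thesis
  proof (intro exI ballI)
    fix x assume "x \<in> K"
    then show "(\<lambda>n. (P ^^ n) f x) \<longlonglongrightarrow> h"
      using between[of x] by (intro tendsto_sandwich[OF _ _ l[folded \<open>h = l\<close>] h]) auto
  qed
qed

end

section \<open>Bounded invariant sets and the limit functional\<close>

definition origin :: "'i \<Rightarrow> real" where
  "origin = (\<lambda>i\<in>S. 0)"

lemma origin_in_E [simp]: "origin \<in> E"
  by (simp add: origin_def)

definition dball :: "real \<Rightarrow> ('i \<Rightarrow> real) set" where
  "dball r = {x \<in> E. d x origin \<le> r}"

text \<open>If every map moves the origin by at most \<open>R\<close>, a ball of radius
  \<open>r\<close> is invariant as soon as \<open>\<rho> * r + R\<close> is at most
  \<open>r\<close>. All larger radii work too, so any given point lies in an invariant ball.\<close>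

lemma dball_invariant:
  obtains r0 where "0 \<le> r0" "\<And>r s x. r0 \<le> r \<Longrightarrow> s \<in> Sig \<Longrightarrow> x \<in> dball r \<Longrightarrow> F s x \<in> dball r"
proof
  define R where "R = (\<Sum>s\<in>Sig. d (F s origin) origin)"
  have R: "d (F s origin) origin \<le> R" if "s \<in> Sig" for s
    unfolding R_def by (rule member_le_sum[OF that]) (auto simp: d_nonneg finite_Sig)
  show "0 \<le> R / (1 - \<rho>)"
    using \<rho> by (auto simp: R_def intro!: divide_nonneg_nonneg sum_nonneg d_nonneg)
  fix r s x assume r: "R / (1 - \<rho>) \<le> r" and s: "s \<in> Sig" and x: "x \<in> dball r"
  have "d (F s x) origin \<le> \<rho> * d x origin + R"
    using d_triangle[of "F s x" origin "F s origin"] d_F[of s x origin] R[OF s] by linarith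
  also have "\<dots> \<le> \<rho> * r + R" using x \<rho> by (simp add: dball_def)
  also have "\<dots> \<le> r" using r \<rho> by (simp add: field_simps)
  finally show "F s x \<in> dball r" by (simp add: dball_def)
qed

text \<open>The ball lies in a compact box of extensional functions, where continuity is uniform for
  the metric of the function type; what remains is to control that metric by
  \<open>d\<close>.\<close>

lemma uniformly_continuous_on_dball:
  fixes f :: "_ \<Rightarrow> real"
  assumes f: "continuous_on E f" and e: "0 < e"
  shows "\<exists>t>0. \<forall>x\<in>dball r. \<forall>y\<in>dball r. d x y \<le> t \<longrightarrow> \<bar>f x - f y\<bar> \<le> e"
proof -
  let ?K = "\<Pi>\<^sub>E i\<in>S. {-r..r}"
  have "?K \<subseteq> E" by (auto simp: PiE_def)
  then have "uniformly_continuous_on ?K f"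
    using f by (intro compact_uniformly_continuous compact_PiE_cbox) (rule continuous_on_subset)
  then obtain t where t: "t > 0" "\<And>x y. x \<in> ?K \<Longrightarrow> y \<in> ?K \<Longrightarrow> dist y x < t \<Longrightarrow> dist (f y) (f x) < e"
    using e unfolding uniformly_continuous_on_def by metis
  have sub: "dball r \<subseteq> ?K"
  proof
    fix x assume x: "x \<in> dball r"
    have "\<bar>x i\<bar> \<le> r" if "i \<in> S" for i
      using coord_le_d[OF that, of x origin] x that by (simp add: dball_def origin_def)
    then show "x \<in> ?K" using x by (force simp: dball_def PiE_def abs_le_iff)
  qed
  \<comment> \<open>One third, because \<open>dist_fun_le\<close> doubles the bound and the result
    has to stay strictly below \<open>t\<close>.\<close>
  have "\<bar>f x - f y\<bar> \<le> e" if xy: "x \<in> dball r" "y \<in> dball r" "d x y \<le> t / 3" for x y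
  proof -
    have "\<bar>y i - x i\<bar> \<le> t / 3" for i
    proof (cases "i \<in> S")
      case True
      then show ?thesis using coord_le_d[of i y x] xy(3) by (simp add: d_commute)
    next
      case False
      then have "x i = y i" using xy by (auto simp: dball_def extensional_def)
      then show ?thesis using t by simp
    qed
    from dist_fun_le[of y x, OF this] have "dist y x < t" using t by simp
    then show ?thesis using t(2)[of x y] sub xy by (auto simp: dist_real_def abs_minus_commute intro: less_imp_le)
  qed
  then show ?thesis using t by (intro exI[of _ "t / 3"]) auto
qed

text \<open>The functional that turns out to be integration against the invariant measure, available
  before that measure is constructed. Starting from \<open>origin\<close> is a mere
  normalisation.\<close>

definition P_limit :: "(('i \<Rightarrow> real) \<Rightarrow> real) \<Rightarrow> real" where
  "P_limit f = lim (\<lambda>n. (P ^^ n) f origin)"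

text \<open>The radius is taken so large that the invariant ball contains both \<open>x\<close> and
  \<open>origin\<close>; the constant reached on that ball is then the one seen from
  \<open>origin\<close>.\<close>

lemma P_iter_tendsto:
  assumes f: "continuous_on E f" and B: "\<And>x. x \<in> E \<Longrightarrow> \<bar>f x\<bar> \<le> B" and x: "x \<in> E"
  shows "(\<lambda>n. (P ^^ n) f x) \<longlonglongrightarrow> P_limit f"
proof -
  obtain r0 where r0: "0 \<le> r0" "\<And>r s x. r0 \<le> r \<Longrightarrow> s \<in> Sig \<Longrightarrow> x \<in> dball r \<Longrightarrow> F s x \<in> dball r"
    by (rule dball_invariant) blast
  define r where "r = max r0 (d x origin)"
  have mem: "x \<in> dball r" "origin \<in> dball r"
    using x r0 by (auto simp: dball_def r_def d_eq_0)
  have "\<exists>m. \<forall>x\<in>dball r. (\<lambda>n. (P ^^ n) f x) \<longlonglongrightarrow> m"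
  proof (rule P_iter_tendsto_const[where B = B and R = "2 * r"])
    show "F s x \<in> dball r" if "s \<in> Sig" "x \<in> dball r" for s x
      using that by (intro r0) (auto simp: r_def)
    show "d x y \<le> 2 * r" if "x \<in> dball r" "y \<in> dball r" for x y
      using that d_triangle[of x y origin] d_commute[of y origin] by (auto simp: dball_def)
    show "\<exists>t>0. \<forall>x\<in>dball r. \<forall>y\<in>dball r. d x y \<le> t \<longrightarrow> \<bar>f x - f y\<bar> \<le> e" if "0 < e" for e
      using f that by (rule uniformly_continuous_on_dball)
    show "dball r \<noteq> {}" using mem by blast
  qed (use B in \<open>auto simp: dball_def\<close>)
  then obtain m where m: "\<And>x. x \<in> dball r \<Longrightarrow> (\<lambda>n. (P ^^ n) f x) \<longlonglongrightarrow> m" by blast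
  have "P_limit f = m" unfolding P_limit_def by (rule limI) (rule m[OF mem(2)])
  then show ?thesis using m[OF mem(1)] by simp
qed

text \<open>Applying \<open>P\<close> first only shifts the sequence of iterates. This is invariance
  at the level of functionals.\<close>

lemma P_limit_P:
  assumes f: "continuous_on E f" and B: "\<And>x. x \<in> E \<Longrightarrow> \<bar>f x\<bar> \<le> B"
  shows "P_limit (P f) = P_limit f"
proof -
  have "(\<lambda>n. (P ^^ Suc n) f origin) \<longlonglongrightarrow> P_limit f"
    using P_iter_tendsto[OF f B origin_in_E] by (rule LIMSEQ_Suc)
  then show ?thesis
    unfolding P_limit_def[of "P f"] by (intro limI) (simp add: funpow_swap1)
qed

text \<open>
  The attractor is parametrised continuously by a real number \<open>c\<close> whose expansion in base \<open>2 b\<close> lists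
  the past choices, the most recent one first; \<open>\<theta>\<close> is a continuous extension of the shift of the
  expansion and \<open>w\<close> one of the map that reads the first digit.
\<close>

lemma attractor_parametrisation:
  obtains X :: "real \<Rightarrow> 'i \<Rightarrow> real" and step :: "'s \<Rightarrow> real \<Rightarrow> real"
  where "continuous_on UNIV X" "range X \<subseteq> E"
    "\<And>c s. c \<in> {0..1} \<Longrightarrow> s \<in> Sig \<Longrightarrow> step s c \<in> {0..1} \<and> X (step s c) = F s (X c)"
proof -
  define b where "b = card Sig"
  have b: "b > 0" using Sig_nonempty finite_Sig by (simp add: b_def card_gt_0_iff)
  obtain h where h: "bij_betw h Sig {0..<b}"
    using ex_bij_betw_finite_nat[OF finite_Sig] by (auto simp: b_def)
  \<comment> \<open>The triangle wave, i.e. the distance of \<open>2 * real b * y\<close> to the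
    nearest even integer. Only even digits are used, so the intervals
    \<open>{2 * j .. 2 * j + 1}\<close> that carry codes are separated by gaps of length 1, over
    which the shift is interpolated.\<close>
  define \<theta> where "\<theta> y = arccos (cos (pi * (2 * real b * y))) / pi" for y
  \<comment> \<open>A trapezoid in \<open>2 * real b * y\<close>, equal to 1 on the interval of the
    digit of \<open>s\<close> and falling to 0 across the adjacent gaps, so it vanishes on the
    intervals of all other digits.\<close>
  define \<tau> where "\<tau> s y = max 0 (min 1 (3 / 2 - \<bar>2 * real b * y - 2 * real (h s) - 1 / 2\<bar>))" for s y
  define w where "w y i = (\<Sum>s\<in>Sig. \<tau> s y * v s i)" for y i
  define step where "step s c = (c + 2 * real (h s)) / (2 * real b)" for s c
  have \<theta>_cont: "continuous_on UNIV \<theta>"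
    unfolding \<theta>_def by (intro continuous_intros) auto
  have w_cont: "continuous_on UNIV (\<lambda>y. w y i)" for i
    unfolding w_def \<tau>_def by (intro continuous_intros)
  have scaled: "2 * real b * step s c = c + 2 * real (h s)" for s c
    using b by (simp add: step_def)
  have \<theta>_step: "\<theta> (step s c) = c" if c: "c \<in> {0..1}" for s c
  proof -
    have "cos (pi * (c + 2 * real (h s))) = cos (pi * c + 2 * real (h s) * pi)"
      by (simp add: algebra_simps)
    also have "\<dots> = cos (pi * c)"
      unfolding cos_add cos_2npi sin_2npi by simp
    finally show ?thesis
      using c unfolding \<theta>_def scaled by (simp add: arccos_cos)
  qed
  have w_step: "w (step s c) i = v s i" if c: "c \<in> {0..1}" and s: "s \<in> Sig" for s c i
  proof -
    have "\<tau> s' (step s c) = (if s' = s then 1 else 0)" if s': "s' \<in> Sig" for s'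
    proof (cases "s' = s")
      case True
      then show ?thesis using c by (auto simp: \<tau>_def scaled abs_if min_def max_def)
    next
      case False
      then have "h s' \<noteq> h s" using h s s' by (auto simp: bij_betw_def inj_on_def)
      then have "real (h s) - real (h s') \<ge> 1 \<or> real (h s) - real (h s') \<le> -1" by linarith
      then have "\<bar>c + 2 * real (h s) - 2 * real (h s') - 1 / 2\<bar> \<ge> 3 / 2"
        using c by auto
      then show ?thesis using False by (auto simp: \<tau>_def scaled)
    qed
    then show ?thesis unfolding w_def using s by (simp add: if_distrib[of "\<lambda>x. x * _"] sum.delta finite_Sig cong: if_cong)
  qed
  have step_range: "step s c \<in> {0..1}" if "c \<in> {0..1}" "s \<in> Sig" for s c
  proof -
    have "h s < b" using h that by (auto simp: bij_betw_def)
    then have "real (h s) + 1 \<le> real b" by linarith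
    then have "c + 2 * real (h s) \<le> 2 * real b" using that by auto
    then show ?thesis using that b by (auto simp: step_def divide_le_eq_1)
  qed
  \<comment> \<open>\<open>X n\<close> reads \<open>n\<close> digits and composes the corresponding
    maps at \<open>origin\<close>, the first digit being applied last. Off the codes it uses
    interpolated translations, which keeps it continuous on the whole line.\<close>
  define X where "X = rec_nat (\<lambda>y. origin) (\<lambda>n Y y. \<lambda>i\<in>S. H (Y (\<theta> y)) i + w y i)"
  have X0: "X 0 y = origin" and XS: "X (Suc n) y = (\<lambda>i\<in>S. H (X n (\<theta> y)) i + w y i)" for n y
    by (simp_all add: X_def)
  have X_E: "X n y \<in> E" for n y by (cases n) (simp_all add: X0 XS)
  have X_cont: "continuous_on UNIV (X n)" for n
  proof (induction n)
    case (Suc n)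
    show ?case
    proof (rule continuous_on_extensional_coordinatewise[OF X_E])
      fix i assume i: "i \<in> S"
      have "continuous_on UNIV (\<lambda>y. X n (\<theta> y))"
        by (rule continuous_on_compose2[OF Suc \<theta>_cont]) auto
      then have "continuous_on UNIV (\<lambda>y. H (X n (\<theta> y)) i + w y i)"
        by (intro continuous_on_add w_cont continuous_on_compose2[OF continuous_on_H[OF i]]) (auto simp: X_E)
      then show "continuous_on UNIV (\<lambda>y. X (Suc n) y i)" using i by (simp add: XS)
    qed
  qed (simp add: X0 continuous_on_const)
  \<comment> \<open>Bounds the first increment from \<open>X 0\<close> to \<open>X 1\<close>
    uniformly in the argument; each further step gains a factor \<open>\<rho>\<close>.\<close>
  define M where "M = C * (\<Sum>i\<in>S. \<bar>H origin i\<bar> + (\<Sum>s\<in>Sig. \<bar>v s i\<bar>))"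
  have w_bound: "\<bar>w y i\<bar> \<le> (\<Sum>s\<in>Sig. \<bar>v s i\<bar>)" for y i
  proof -
    have "\<bar>\<tau> s y * v s i\<bar> \<le> \<bar>v s i\<bar>" for s
      using mult_right_mono[of "\<bar>\<tau> s y\<bar>" 1 "\<bar>v s i\<bar>"] by (simp add: abs_mult \<tau>_def)
    then show ?thesis unfolding w_def by (intro order_trans[OF sum_abs] sum_mono)
  qed
  have X_step: "d (X (Suc n) y) (X n y) \<le> \<rho> ^ n * M" for n y
  proof (induction n arbitrary: y)
    case 0
    have "d (X 1 y) (X 0 y) \<le> C * (\<Sum>i\<in>S. \<bar>X 1 y i - X 0 y i\<bar>)" by (rule d_le_sum)
    also have "\<dots> \<le> M"
      unfolding M_def
    proof (intro mult_left_mono sum_mono C)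
      fix i assume "i \<in> S"
      then have "\<bar>X 1 y i - X 0 y i\<bar> = \<bar>H origin i + w y i\<bar>" using XS[of 0 y] by (simp add: X0) (simp add: origin_def)
      also have "\<dots> \<le> \<bar>H origin i\<bar> + (\<Sum>s\<in>Sig. \<bar>v s i\<bar>)" using w_bound[of y i] by linarith
      finally show "\<bar>X 1 y i - X 0 y i\<bar> \<le> \<bar>H origin i\<bar> + (\<Sum>s\<in>Sig. \<bar>v s i\<bar>)" .
    qed
    finally show ?case by simp
  next
    case (Suc n)
    have "d (X (Suc (Suc n)) y) (X (Suc n) y) \<le> \<rho> * d (X (Suc n) (\<theta> y)) (X n (\<theta> y))"
      unfolding XS[of "Suc n" y] XS[of n y] by (rule d_affine)
    also have "\<dots> \<le> \<rho> * (\<rho> ^ n * M)" using \<rho> by (intro mult_left_mono Suc) auto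
    finally show ?case by (simp add: algebra_simps)
  qed
  \<comment> \<open>The limit is written as a telescoping series so that the Weierstrass test gives
    uniform convergence and hence continuity.\<close>
  define Y where "Y y = (\<lambda>i\<in>S. X 0 y i + (\<Sum>k. X (Suc k) y i - X k y i))" for y
  have Y_lim: "uniform_limit UNIV (\<lambda>n y. X n y i) (\<lambda>y. Y y i) sequentially" if i: "i \<in> S" for i
  proof -
    have "uniform_limit UNIV (\<lambda>n y. \<Sum>k<n. X (Suc k) y i - X k y i) (\<lambda>y. \<Sum>k. X (Suc k) y i - X k y i) sequentially"
    proof (rule Weierstrass_m_test)
      show "norm (X (Suc n) y i - X n y i) \<le> \<rho> ^ n * M" for n y
        using coord_le_d[OF i, of "X (Suc n) y" "X n y"] X_step[of n y] by simp
      show "summable (\<lambda>n. \<rho> ^ n * M)" using \<rho> by (intro summable_mult2 summable_geometric) simp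
    qed
    then have "uniform_limit UNIV (\<lambda>n y. X 0 y i + (\<Sum>k<n. X (Suc k) y i - X k y i)) (\<lambda>y. Y y i) sequentially"
      unfolding Y_def using i by (simp add: uniform_limit_iff dist_real_def)
    then show ?thesis by (simp add: sum_lessThan_telescope[of "\<lambda>k. X k _ i"])
  qed
  have Y_E: "Y y \<in> E" for y by (simp add: Y_def)
  have Y_cont: "continuous_on UNIV Y"
  proof (rule continuous_on_extensional_coordinatewise[OF Y_E])
    fix i assume "i \<in> S"
    then show "continuous_on UNIV (\<lambda>y. Y y i)"
      using continuous_on_product_then_coordinatewise[OF X_cont, of _ i]
      by (intro uniform_limit_theorem[OF _ Y_lim]) auto
  qed
  have Y_tendsto: "(\<lambda>n. X n y i) \<longlonglongrightarrow> Y y i" if "i \<in> S" for y i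
    using tendsto_uniform_limitI[OF Y_lim[OF that]] by simp
  \<comment> \<open>The recursion of \<open>X\<close> passes to the limit because \<open>H\<close>
    is Lipschitz. At \<open>step s c\<close> the functional equation becomes the conjugacy with
    \<open>F s\<close>.\<close>
  have Y_eq: "Y y i = H (Y (\<theta> y)) i + w y i" if i: "i \<in> S" for y i
  proof -
    have "(\<lambda>n. \<rho> * (C * (\<Sum>j\<in>S. \<bar>X n (\<theta> y) j - Y (\<theta> y) j\<bar>))) \<longlonglongrightarrow> \<rho> * (C * (\<Sum>j\<in>S. \<bar>Y (\<theta> y) j - Y (\<theta> y) j\<bar>))"
      by (intro tendsto_intros Y_tendsto)
    then have lim0: "(\<lambda>n. \<rho> * (C * (\<Sum>j\<in>S. \<bar>X n (\<theta> y) j - Y (\<theta> y) j\<bar>))) \<longlonglongrightarrow> 0" by simp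
    have "\<bar>H (X n (\<theta> y)) i - H (Y (\<theta> y)) i\<bar> \<le> \<rho> * (C * (\<Sum>j\<in>S. \<bar>X n (\<theta> y) j - Y (\<theta> y) j\<bar>))" for n
      using \<rho> by (intro order_trans[OF H_lipschitz[OF i]] mult_left_mono d_le_sum) simp
    then have "(\<lambda>n. H (X n (\<theta> y)) i - H (Y (\<theta> y)) i) \<longlonglongrightarrow> 0"
      by (intro Lim_null_comparison[OF _ lim0]) auto
    then have "(\<lambda>n. H (X n (\<theta> y)) i) \<longlonglongrightarrow> H (Y (\<theta> y)) i" by (simp add: LIM_zero_iff)
    then have "(\<lambda>n. X (Suc n) y i) \<longlonglongrightarrow> H (Y (\<theta> y)) i + w y i"
      using i by (auto simp: XS intro!: tendsto_intros)
    then show ?thesis using LIMSEQ_Suc[OF Y_tendsto[OF i, of y]] LIMSEQ_unique by blast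
  qed
  show ?thesis
  proof (rule that[of Y step])
    fix c s assume cs: "c \<in> {0..1::real}" "s \<in> Sig"
    have "Y (step s c) = F s (Y c)"
    proof (rule extensionalityI[OF Y_E F_in_E])
      fix i assume "i \<in> S"
      then show "Y (step s c) i = F s (Y c) i"
        using Y_eq[of i "step s c"] cs by (simp add: \<theta>_step w_step F_def)
    qed
    then show "step s c \<in> {0..1} \<and> Y (step s c) = F s (Y c)"
      using step_range[OF cs] by blast
  qed (use Y_cont Y_E in auto)
qed

section \<open>The kernel, the laws of the chain and their limit\<close>

abbreviation "state_sp \<equiv> (\<Pi>\<^sub>M i\<in>S. borel) :: ('i \<Rightarrow> real) measure"

lemma space_state_sp: "space state_sp = E"
  by (simp add: space_PiM PiE_def)

lemma measurable_F_pmf: "(\<lambda>s. F s x) \<in> measurable (measure_pmf q) state_sp"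
  by (simp add: space_state_sp)

lemma ker_F: "x \<in> E \<Longrightarrow> ker x = distr (measure_pmf (p x)) state_sp (\<lambda>s. F s x)"
  by (simp add: ker F_def)

lemma integral_pmf: "x \<in> E \<Longrightarrow> (\<integral>s. f s \<partial>measure_pmf (p x)) = (\<Sum>s\<in>Sig. pmf (p x) s * f s)"
  for f :: "'s \<Rightarrow> real"
  using support by (subst integral_measure_pmf_real[OF finite_Sig]) (auto simp: mult.commute)

lemma integral_ker:
  assumes "x \<in> E" "f \<in> borel_measurable state_sp"
  shows "(\<integral>y. f y \<partial>ker x) = P f x"
  using assms by (simp add: ker_F integral_distr[OF measurable_F_pmf] integral_pmf P_def)

lemma prob_space_ker: "x \<in> E \<Longrightarrow> prob_space (ker x)"
  by (simp add: ker_F measure_pmf.prob_space_distr[OF measurable_F_pmf])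

lemma sets_ker: "x \<in> E \<Longrightarrow> sets (ker x) = sets state_sp"
  by (simp add: ker_F)

text \<open>The kernel of a set is \<open>P\<close> applied to its indicator, a finite sum of
  products of measurable functions; the maps and the probabilities are measurable because they are
  continuous.\<close>

lemma measurable_ker: "ker \<in> measurable state_sp (subprob_algebra state_sp)"
proof (rule measurable_subprob_algebra)
  fix A assume A: "A \<in> sets state_sp"
  have [measurable]: "A \<in> sets state_sp" by fact
  have F_meas: "F s \<in> measurable state_sp state_sp" for s
    unfolding F_def
    by (intro measurable_restrict borel_measurable_PiM_continuous continuous_intros continuous_on_H)
  have "emeasure (ker x) A = ennreal (P (indicator A) x)" if "x \<in> E" for x
  proof -
    interpret prob_space "ker x" using that by (rule prob_space_ker)
    have "emeasure (ker x) A = ennreal (\<integral>y. indicator A y \<partial>ker x)"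
      using A sets_ker[OF that] sets.sets_into_space[of A "ker x"]
      by (simp add: emeasure_eq_measure Int_absorb2)
    moreover have "indicat_real A \<in> borel_measurable state_sp" using A by simp
    ultimately show ?thesis using that by (simp only: integral_ker)
  qed
  moreover have "(\<lambda>x. P (indicator A) x) \<in> borel_measurable state_sp"
    unfolding P_def
    by (intro borel_measurable_sum borel_measurable_times borel_measurable_PiM_continuous continuous_on_pmf
        measurable_compose[OF F_meas] borel_measurable_indicator A)
  ultimately show "(\<lambda>x. emeasure (ker x) A) \<in> borel_measurable state_sp"
    by (subst measurable_cong[where g = "\<lambda>x. ennreal (P (indicator A) x)"]) (auto simp: space_state_sp)
qed (auto simp: space_state_sp sets_ker prob_space_ker prob_space_imp_subprob_space)

text \<open>The third claim is the duality between evolving the law and applying \<open>P\<close> to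
  the test function, by which statements about measures reduce to iterates of
  \<open>P\<close>.\<close>

lemma bind_ker:
  assumes "prob_space M" "sets M = sets state_sp"
  shows "prob_space (M \<bind> ker)" "sets (M \<bind> ker) = sets state_sp"
    "\<And>f B. continuous_on E f \<Longrightarrow> (\<And>x. x \<in> E \<Longrightarrow> \<bar>f x\<bar> \<le> B) \<Longrightarrow>
      (\<integral>x. f x \<partial>(M \<bind> ker)) = (\<integral>x. P f x \<partial>M)"
    "\<And>A. A \<in> sets state_sp \<Longrightarrow> emeasure (M \<bind> ker) A = (\<integral>\<^sup>+x. emeasure (ker x) A \<partial>M)"
proof -
  interpret M: prob_space M by fact
  have sp: "space M = E" using sets_eq_imp_space_eq[OF assms(2)] by (simp add: space_state_sp)
  have ker: "ker \<in> measurable M (subprob_algebra state_sp)"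
    using measurable_ker assms(2) by (simp cong: measurable_cong_sets)
  show "prob_space (M \<bind> ker)"
    by (rule M.prob_space_bind[OF AE_I2 ker]) (simp add: sp prob_space_ker)
  show "sets (M \<bind> ker) = sets state_sp"
    using M.not_empty by (intro sets_bind) (auto simp: sp sets_ker)
  show "emeasure (M \<bind> ker) A = (\<integral>\<^sup>+x. emeasure (ker x) A \<partial>M)" if "A \<in> sets state_sp" for A
    using M.not_empty ker that by (rule emeasure_bind)
  fix f :: "_ \<Rightarrow> real" and B assume f: "continuous_on E f" and B: "\<And>x. x \<in> E \<Longrightarrow> \<bar>f x\<bar> \<le> B"
  have fm: "f \<in> borel_measurable state_sp" by (rule borel_measurable_PiM_continuous[OF f])
  have "(\<integral>x. f x \<partial>(M \<bind> ker)) = (\<integral>x. \<integral>y. f y \<partial>ker x \<partial>M)"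
  proof (rule integral_bind[OF fm _ ker, where B = B and B' = 1])
    show "AE x in M. emeasure (ker x) (space (ker x)) \<le> ennreal 1"
      by (rule AE_I2) (simp add: sp prob_space.emeasure_space_1[OF prob_space_ker])
  qed (auto simp: B space_state_sp M.finite_measure_axioms)
  also have "\<dots> = (\<integral>x. P f x \<partial>M)"
    by (rule Bochner_Integration.integral_cong) (auto simp: sp integral_ker fm)
  finally show "(\<integral>x. f x \<partial>(M \<bind> ker)) = (\<integral>x. P f x \<partial>M)" .
qed

text \<open>Duality moves all \<open>k\<close> steps onto the test function, leaving the integral of
  \<open>(P ^^ k) f\<close> against the initial law; dominated convergence with the constant bound
  \<open>B\<close> applies to arbitrary initial laws, without moment conditions.\<close>

lemma integral_law_tendsto:
  assumes \<nu>: "prob_space (\<nu> 0)" "sets (\<nu> 0) = sets state_sp" "\<And>k. \<nu> (Suc k) = \<nu> k \<bind> ker"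
    and f: "continuous_on E f" "\<And>x. x \<in> E \<Longrightarrow> \<bar>f x\<bar> \<le> B"
  shows "(\<lambda>k. \<integral>x. f x \<partial>\<nu> k) \<longlonglongrightarrow> P_limit f"
proof -
  have pr: "prob_space (\<nu> k) \<and> sets (\<nu> k) = sets state_sp" for k
    by (induction k) (auto simp: \<nu> bind_ker)
  have eq: "(\<integral>x. f x \<partial>\<nu> k) = (\<integral>x. (P ^^ k) f x \<partial>\<nu> 0)"
    if "continuous_on E f" "\<And>x. x \<in> E \<Longrightarrow> \<bar>f x\<bar> \<le> B" for f k
    using that
  proof (induction k arbitrary: f)
    case (Suc k)
    have "(\<integral>x. f x \<partial>\<nu> (Suc k)) = (\<integral>x. P f x \<partial>\<nu> k)"
      unfolding \<nu> using pr Suc.prems by (intro bind_ker(3)) auto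
    also have "\<dots> = (\<integral>x. (P ^^ k) (P f) x \<partial>\<nu> 0)"
      using Suc.prems by (intro Suc.IH continuous_on_P P_bounded)
    finally show ?case by (simp add: funpow_swap1)
  qed simp
  interpret prob_space "\<nu> 0" by fact
  have sp: "space (\<nu> 0) = E" using sets_eq_imp_space_eq[OF \<nu>(2)] by (simp add: space_state_sp)
  have "(\<lambda>k. \<integral>x. (P ^^ k) f x \<partial>\<nu> 0) \<longlonglongrightarrow> (\<integral>x. P_limit f \<partial>\<nu> 0)"
  proof (rule integral_dominated_convergence[where w = "\<lambda>_. B"])
    show "(P ^^ k) f \<in> borel_measurable (\<nu> 0)" for k
      using borel_measurable_PiM_continuous[OF P_iter_continuous[OF f(1), of k]] \<nu>(2)
      by (simp cong: measurable_cong_sets)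
    show "AE x in \<nu> 0. (\<lambda>k. (P ^^ k) f x) \<longlonglongrightarrow> P_limit f"
      by (rule AE_I2) (simp add: sp P_iter_tendsto[OF f])
    show "AE x in \<nu> 0. norm ((P ^^ k) f x) \<le> B" for k
      by (rule AE_I2) (simp add: sp P_iter_bounded f)
  qed auto
  then show ?thesis using eq[OF f] by (simp add: prob_space)
qed

lemma limit_measure:
  obtains \<mu> where "prob_space \<mu>" "sets \<mu> = sets state_sp"
    "\<And>f B. continuous_on E f \<Longrightarrow> (\<And>x. x \<in> E \<Longrightarrow> \<bar>f x\<bar> \<le> B) \<Longrightarrow> (\<integral>x. f x \<partial>\<mu>) = P_limit f"
proof -
  obtain X step where X: "continuous_on UNIV X" "range X \<subseteq> E"
    and step: "\<And>c s. c \<in> {0..1::real} \<Longrightarrow> s \<in> Sig \<Longrightarrow> step s c \<in> {0..1} \<and> X (step s c) = F s (X c)"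
    by (rule attractor_parametrisation) blast
  have X_E: "X c \<in> E" for c using X by auto
  \<comment> \<open>A chain of codes whose choice probabilities are read off at the state
    \<open>X c\<close>. Since \<open>X\<close> intertwines \<open>step\<close> and \<open>F\<close>,
    its image is the original chain started at \<open>X 0\<close>.\<close>
  define code where "code = rec_nat (return_pmf 0) (\<lambda>_ q. bind_pmf q (\<lambda>c. map_pmf (\<lambda>s. step s c) (p (X c))))"
  have code: "code 0 = return_pmf 0"
    "code (Suc n) = bind_pmf (code n) (\<lambda>c. map_pmf (\<lambda>s. step s c) (p (X c)))" for n
    by (simp_all add: code_def)
  have code_range: "set_pmf (code n) \<subseteq> {0..1}" for n
  proof (induction n)
    case (Suc n)
    have "step s c \<in> {0..1}" if "c \<in> set_pmf (code n)" "s \<in> set_pmf (p (X c))" for s c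
      using step[of c s] subsetD[OF Suc that(1)] subsetD[OF support[OF X_E] that(2)] by blast
    then show ?case by (auto simp: code simp del: atLeastAtMost_iff)
  qed (simp add: code)
  have code_int: "(\<integral>c. f (X c) \<partial>measure_pmf (code n)) = (P ^^ n) f (X 0)"
    if "\<And>x. x \<in> E \<Longrightarrow> \<bar>f x\<bar> \<le> B" for f B n
    using that
  proof (induction n arbitrary: f)
    case (Suc n)
    have "(\<integral>c. f (X c) \<partial>measure_pmf (code (Suc n))) =
        (\<integral>c. \<integral>c'. f (X c') \<partial>map_pmf (\<lambda>s. step s c) (p (X c)) \<partial>code n)"
      unfolding code measure_pmf_bind using Suc.prems X_E
      by (intro integral_bind[where K = "count_space UNIV" and B = B and B' = 1])
        (auto simp: measure_pmf_in_subprob_algebra measure_pmf.finite_measure_axioms measure_pmf.emeasure_space_1[simplified])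
    \<comment> \<open>The conjugacy holds only for codes in the unit interval and choices in
      \<open>Sig\<close>; both hold almost surely.\<close>
    also have "\<dots> = (\<integral>c. P f (X c) \<partial>code n)"
      using code_range[of n] step
      by (intro integral_cong_AE)
        (auto simp: AE_measure_pmf_iff integral_pmf X_E P_def subset_eq intro!: sum.cong)
    also have "\<dots> = (P ^^ n) (P f) (X 0)" using Suc.prems by (intro Suc.IH P_bounded)
    finally show ?case by (simp add: funpow_swap1)
  qed (simp add: code)
  \<comment> \<open>The same distributions regarded as Borel measures, the setting of tightness and
    weak convergence on the line.\<close>
  define \<kappa> where "\<kappa> n = distr (measure_pmf (code n)) borel (\<lambda>c. c)" for n
  have tight: "tight \<kappa>"
    unfolding tight_def
  proof (intro conjI allI impI)
    show "real_distribution (\<kappa> n)" for n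
      unfolding \<kappa>_def by (rule prob_space.real_distribution_distr[OF measure_pmf.prob_space_axioms]) simp
    fix e :: real assume e: "0 < e"
    \<comment> \<open>The half-open interval begins at -1 because the code 0, where the chain
      starts, must be included.\<close>
    have "measure (\<kappa> n) {-1<..1} = 1" for n
    proof -
      have "measure (\<kappa> n) {-1<..1} = measure (measure_pmf (code n)) {-1<..1}"
        by (simp add: \<kappa>_def measure_distr)
      also have "\<dots> = 1" using code_range[of n] by (subst measure_pmf.prob_eq_1) (auto simp: AE_measure_pmf_iff)
      finally show ?thesis .
    qed
    then show "\<exists>a b. a < b \<and> (\<forall>n. 1 - e < measure (\<kappa> n) {a<..b})"
      using e by (intro exI[of _ "-1"] exI[of _ 1]) auto
  qed
  have "\<exists>r M. strict_mono (r :: nat \<Rightarrow> nat) \<and> real_distribution M \<and> weak_conv_m (\<kappa> \<circ> id \<circ> r) M"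
    by (rule tight_imp_convergent_subsubsequence[OF tight strict_mono_id])
  then obtain r \<Lambda> where r: "strict_mono (r :: nat \<Rightarrow> nat)" and \<Lambda>: "real_distribution \<Lambda>"
    and weak: "weak_conv_m (\<kappa> \<circ> id \<circ> r) \<Lambda>"
    by (elim exE conjE) (rule that)
  have sets_\<Lambda>: "sets \<Lambda> = sets borel" and prob_\<Lambda>: "prob_space \<Lambda>"
    using \<Lambda> by (auto simp: real_distribution_def real_distribution_axioms_def)
  have X_meas: "X \<in> measurable \<Lambda> state_sp"
  proof (rule measurable_PiM_single')
    fix i assume "i \<in> S"
    have "(\<lambda>c. X c i) \<in> borel_measurable borel"
      by (rule borel_measurable_continuous_onI[OF continuous_on_product_then_coordinatewise[OF X(1)]])
    then show "(\<lambda>c. X c i) \<in> borel_measurable \<Lambda>" using sets_\<Lambda> by (simp cong: measurable_cong_sets)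
  next
    show "X \<in> space \<Lambda> \<rightarrow> (\<Pi>\<^sub>E i\<in>S. space borel)" using X_E by (simp add: PiE_def)
  qed
  show ?thesis
  proof (rule that[of "distr \<Lambda> state_sp X"])
    show "prob_space (distr \<Lambda> state_sp X)" by (rule prob_space.prob_space_distr[OF prob_\<Lambda> X_meas])
    fix f :: "_ \<Rightarrow> real" and B assume f: "continuous_on E f" "\<And>x. x \<in> E \<Longrightarrow> \<bar>f x\<bar> \<le> B"
    have fX: "continuous_on UNIV (\<lambda>c. f (X c))"
      by (rule continuous_on_compose2[OF f(1) X(1)]) (use X_E in auto)
    have fX_meas: "(\<lambda>c. f (X c)) \<in> borel_measurable borel" by (rule borel_measurable_continuous_onI[OF fX])
    have "(\<lambda>n. \<integral>c. f (X c) \<partial>(\<kappa> \<circ> id \<circ> r) n) \<longlonglongrightarrow> (\<integral>c. f (X c) \<partial>\<Lambda>)"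
    proof (rule weak_conv_imp_integral_bdd_continuous_conv[OF _ \<Lambda> weak, where B = B])
      show "isCont (\<lambda>c. f (X c)) c" for c using fX by (simp add: continuous_on_eq_continuous_at)
    qed (use f X_E tight in \<open>auto simp: tight_def\<close>)
    moreover have "(\<integral>c. f (X c) \<partial>\<kappa> n) = (P ^^ n) f (X 0)" for n
      using code_int[OF f(2)] fX_meas by (simp add: \<kappa>_def integral_distr)
    ultimately have "(\<lambda>n. (P ^^ r n) f (X 0)) \<longlonglongrightarrow> (\<integral>c. f (X c) \<partial>\<Lambda>)" by simp
    \<comment> \<open>The full sequence of iterates is known to converge, so the subsequence
      supplied by compactness still identifies the integral with \<open>P_limit f\<close>.\<close>
    moreover have "(\<lambda>n. (P ^^ r n) f (X 0)) \<longlonglongrightarrow> P_limit f"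
      using LIMSEQ_subseq_LIMSEQ[OF P_iter_tendsto[OF f X_E[of 0]] r] by (simp add: comp_def)
    ultimately have "(\<integral>c. f (X c) \<partial>\<Lambda>) = P_limit f" by (rule LIMSEQ_unique)
    then show "(\<integral>x. f x \<partial>distr \<Lambda> state_sp X) = P_limit f"
      by (simp add: integral_distr[OF X_meas borel_measurable_PiM_continuous[OF f(1)]])
  qed simp
qed

theorem unique_attractive_invariant_measure:
  obtains \<mu> where "prob_space \<mu>" "sets \<mu> = sets state_sp"
    "\<And>A. A \<in> sets state_sp \<Longrightarrow> (\<integral>\<^sup>+x. emeasure (ker x) A \<partial>\<mu>) = emeasure \<mu> A"
    "\<And>\<mu>'. prob_space \<mu>' \<Longrightarrow> sets \<mu>' = sets state_sp \<Longrightarrow>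
      (\<And>A. A \<in> sets state_sp \<Longrightarrow> (\<integral>\<^sup>+x. emeasure (ker x) A \<partial>\<mu>') = emeasure \<mu>' A) \<Longrightarrow> \<mu>' = \<mu>"
    "\<And>\<nu> (f :: _ \<Rightarrow> real) B. prob_space (\<nu> 0) \<Longrightarrow> sets (\<nu> 0) = sets state_sp \<Longrightarrow>
      (\<And>k. \<nu> (Suc k) = \<nu> k \<bind> ker) \<Longrightarrow>
      continuous_on E f \<Longrightarrow> (\<And>x. x \<in> E \<Longrightarrow> \<bar>f x\<bar> \<le> B) \<Longrightarrow>
      (\<lambda>k. \<integral>x. f x \<partial>\<nu> k) \<longlonglongrightarrow> (\<integral>x. f x \<partial>\<mu>)"
proof -
  obtain \<mu> where \<mu>: "prob_space \<mu>" "sets \<mu> = sets state_sp"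
    "\<And>f B. continuous_on E f \<Longrightarrow> (\<And>x. x \<in> E \<Longrightarrow> \<bar>f x\<bar> \<le> B) \<Longrightarrow> (\<integral>x. f x \<partial>\<mu>) = P_limit f"
    by (rule limit_measure) blast
  have eqI: "\<mu>' = \<mu>" if \<mu>': "prob_space \<mu>'" "sets \<mu>' = sets state_sp"
    "\<And>f. continuous_on E f \<Longrightarrow> (\<And>x. \<bar>f x\<bar> \<le> 1) \<Longrightarrow> (\<integral>x. f x \<partial>\<mu>') = P_limit f" for \<mu>'
  proof (rule measure_eqI_PiM_continuous)
    fix f :: "_ \<Rightarrow> real" assume f: "continuous_on E f" "\<And>x. f x \<in> {0..1}"
    have "\<bar>f x\<bar> \<le> 1" for x using f(2)[of x] by auto
    then show "integral\<^sup>L \<mu>' f = integral\<^sup>L \<mu> f"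
      using \<mu>(3)[OF f(1), of 1] \<mu>'(3)[OF f(1)] by simp
  qed (auto simp: \<mu> \<mu>' prob_space.finite_measure)
  show ?thesis
  proof (rule that[OF \<mu>(1,2)])
    note bind = bind_ker[OF \<mu>(1,2)]
    \<comment> \<open>Both measures represent the functional \<open>P_limit\<close>, by
      \<open>P_limit_P\<close>, and bounded continuous functions determine a measure.\<close>
    have "\<mu> \<bind> ker = \<mu>"
    proof (rule eqI[OF bind(1,2)])
      fix f :: "_ \<Rightarrow> real" assume f: "continuous_on E f" "\<And>x. \<bar>f x\<bar> \<le> 1"
      have "(\<integral>x. f x \<partial>(\<mu> \<bind> ker)) = (\<integral>x. P f x \<partial>\<mu>)" using f by (intro bind(3)) auto
      also have "\<dots> = P_limit (P f)"
        using f by (intro \<mu>(3) continuous_on_P P_bounded) auto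
      also have "\<dots> = P_limit f" using f by (intro P_limit_P) auto
      finally show "(\<integral>x. f x \<partial>(\<mu> \<bind> ker)) = P_limit f" .
    qed
    then show "(\<integral>\<^sup>+x. emeasure (ker x) A \<partial>\<mu>) = emeasure \<mu> A" if "A \<in> sets state_sp" for A
      using bind(4)[OF that] by simp
  next
    fix \<mu>' assume \<mu>': "prob_space \<mu>'" "sets \<mu>' = sets state_sp"
      and inv: "\<And>A. A \<in> sets state_sp \<Longrightarrow> (\<integral>\<^sup>+x. emeasure (ker x) A \<partial>\<mu>') = emeasure \<mu>' A"
    have "\<mu>' \<bind> ker = \<mu>'"
      using bind_ker(2,4)[OF \<mu>'] inv \<mu>'(2) by (intro measure_eqI) auto
    \<comment> \<open>The constant sequence at an invariant measure is a sequence of laws of the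
      chain; a convergent constant sequence of integrals equals its limit.\<close>
    then show "\<mu>' = \<mu>"
      using integral_law_tendsto[where \<nu> = "\<lambda>_. \<mu>'", OF \<mu>']
      by (intro eqI \<mu>') (auto simp: LIMSEQ_const_iff)
  next
    fix \<nu> :: "nat \<Rightarrow> ('i \<Rightarrow> real) measure" and f :: "('i \<Rightarrow> real) \<Rightarrow> real" and B
    assume "prob_space (\<nu> 0)" "sets (\<nu> 0) = sets state_sp" "\<And>k. \<nu> (Suc k) = \<nu> k \<bind> ker"
      and f: "continuous_on E f" "\<And>x. x \<in> E \<Longrightarrow> \<bar>f x\<bar> \<le> B"
    from integral_law_tendsto[OF this] show "(\<lambda>k. \<integral>x. f x \<partial>\<nu> k) \<longlonglongrightarrow> (\<integral>x. f x \<partial>\<mu>)"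
      using \<mu>(3)[OF f] by simp
  qed
qed

end

section \<open>Schur matrices and cascades\<close>

definition l1 :: "real Matrix.vec \<Rightarrow> real" where
  "l1 v = (\<Sum>i<dim_vec v. \<bar>vec_index v i\<bar>)"

lemma l1_nonneg: "0 \<le> l1 v"
  by (simp add: l1_def sum_nonneg)

lemma abs_index_le_l1: "i < dim_vec v \<Longrightarrow> \<bar>vec_index v i\<bar> \<le> l1 v"
  unfolding l1_def by (rule member_le_sum) auto

lemma l1_add:
  assumes "v \<in> carrier_vec n" "w \<in> carrier_vec n"
  shows "l1 (v + w) \<le> l1 v + l1 w"
proof -
  have "(\<Sum>i<n. \<bar>vec_index v i + vec_index w i\<bar>) \<le> (\<Sum>i<n. \<bar>vec_index v i\<bar> + \<bar>vec_index w i\<bar>)"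
    by (intro sum_mono) auto
  then show ?thesis using assms by (simp add: l1_def sum.distrib)
qed

lemma l1_uminus: "l1 (- v) = l1 v"
  by (simp add: l1_def)

lemma l1_smult: "l1 (a \<cdot>\<^sub>v v) = \<bar>a\<bar> * l1 v"
  by (simp add: l1_def abs_mult sum_distrib_left)

lemma l1_finsum_vec:
  assumes "finite I" "\<And>i. i \<in> I \<Longrightarrow> f i \<in> carrier_vec n"
  shows "l1 (finsum_vec TYPE(real) n f I) \<le> (\<Sum>i\<in>I. l1 (f i))"
proof -
  have f: "f \<in> I \<rightarrow> carrier_vec n" using assms(2) by auto
  have "l1 (finsum_vec TYPE(real) n f I) = (\<Sum>j<n. \<bar>\<Sum>i\<in>I. vec_index (f i) j\<bar>)"
    unfolding l1_def using finsum_vec_closed[OF f] assms(1) f by (simp add: index_finsum_vec)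
  also have "\<dots> \<le> (\<Sum>j<n. \<Sum>i\<in>I. \<bar>vec_index (f i) j\<bar>)"
    by (intro sum_mono sum_abs)
  also have "\<dots> = (\<Sum>i\<in>I. \<Sum>j<n. \<bar>vec_index (f i) j\<bar>)"
    by (rule sum.swap)
  also have "\<dots> = (\<Sum>i\<in>I. l1 (f i))"
  proof (rule sum.cong[OF refl])
    fix i assume "i \<in> I"
    then have "dim_vec (f i) = n" using assms(2) carrier_vecD by blast
    then show "(\<Sum>j<n. \<bar>vec_index (f i) j\<bar>) = l1 (f i)" by (simp add: l1_def)
  qed
  finally show ?thesis .
qed

text \<open>\<open>g\<close> embeds the entries of one block into the coordinates of the whole
  state; injectivity prevents a coordinate from being counted twice.\<close>

lemma l1_block_le:
  assumes "finite S" "inj g" "g ` {..<n} \<subseteq> S"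
  shows "l1 (Matrix.vec n (\<lambda>j. z (g j))) \<le> (\<Sum>i\<in>S. \<bar>z i\<bar>)"
proof -
  have "l1 (Matrix.vec n (\<lambda>j. z (g j))) = (\<Sum>j\<in>g ` {..<n}. \<bar>z j\<bar>)"
    using assms(2) by (simp add: l1_def sum.reindex inj_on_def inj_def)
  also have "\<dots> \<le> (\<Sum>i\<in>S. \<bar>z i\<bar>)" using assms by (intro sum_mono2) auto
  finally show ?thesis .
qed

lemma abs_scalar_prod_le_l1: "dim_vec v = dim_vec w \<Longrightarrow> \<bar>scalar_prod v w\<bar> \<le> l1 v * l1 w"
proof -
  assume dim: "dim_vec v = dim_vec w"
  have "\<bar>scalar_prod v w\<bar> \<le> (\<Sum>i<dim_vec w. \<bar>vec_index v i\<bar> * \<bar>vec_index w i\<bar>)"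
    unfolding scalar_prod_def atLeast0LessThan by (rule order_trans[OF sum_abs]) (simp add: abs_mult)
  also have "\<dots> \<le> (\<Sum>i<dim_vec w. l1 v * \<bar>vec_index w i\<bar>)"
    using dim by (intro sum_mono mult_right_mono abs_index_le_l1) auto
  finally show ?thesis by (simp add: l1_def[of w] sum_distrib_left)
qed

lemma mult_mat_vec_column:
  fixes B :: "real mat"
  assumes "B \<in> carrier_mat n 1" "j < n"
  shows "vec_index (B *\<^sub>v Matrix.vec 1 (\<lambda>_. a)) j = B $$ (j, 0) * a"
  using assms by (simp add: scalar_prod_def)

text \<open>The constant is explicit in the bound on the entries, so that one bound valid for all
  powers of a matrix gives one operator bound for all of them.\<close>

lemma l1_mult_mat_vec_bounded:
  assumes M: "M \<in> carrier_mat m n" and b: "\<And>i j. i < m \<Longrightarrow> j < n \<Longrightarrow> \<bar>M $$ (i, j)\<bar> \<le> b"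
    and x: "x \<in> carrier_vec n"
  shows "l1 (M *\<^sub>v x) \<le> real m * b * l1 x"
proof -
  have "\<bar>vec_index (M *\<^sub>v x) i\<bar> \<le> b * l1 x" if i: "i < m" for i
  proof -
    have "vec_index (M *\<^sub>v x) i = (\<Sum>j<n. M $$ (i, j) * vec_index x j)"
      using M x i by (simp add: scalar_prod_def atLeast0LessThan)
    also have "\<bar>\<dots>\<bar> \<le> (\<Sum>j<n. b * \<bar>vec_index x j\<bar>)"
      using b i by (intro order_trans[OF sum_abs] sum_mono) (auto simp: abs_mult intro!: mult_right_mono)
    also have "\<dots> = b * l1 x" using x by (simp add: l1_def sum_distrib_left)
    finally show ?thesis .
  qed
  then have "(\<Sum>i<m. \<bar>vec_index (M *\<^sub>v x) i\<bar>) \<le> (\<Sum>i<m. b * l1 x)" by (intro sum_mono) auto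
  then show ?thesis using M by (simp add: l1_def[of "M *\<^sub>v x"])
qed

lemma l1_mult_mat_vec:
  assumes M: "M \<in> carrier_mat m n"
  obtains K where "0 \<le> K" "\<And>x. x \<in> carrier_vec n \<Longrightarrow> l1 (M *\<^sub>v x) \<le> K * l1 x"
proof
  let ?b = "\<Sum>i<m. \<Sum>j<n. \<bar>M $$ (i, j)\<bar>"
  show "0 \<le> real m * ?b" by (intro mult_nonneg_nonneg sum_nonneg) auto
  fix x :: "real Matrix.vec" assume "x \<in> carrier_vec n"
  moreover have "\<bar>M $$ (i, j)\<bar> \<le> ?b" if "i < m" "j < n" for i j
  proof -
    have "\<bar>M $$ (i, j)\<bar> \<le> (\<Sum>j<n. \<bar>M $$ (i, j)\<bar>)" using that by (intro member_le_sum) auto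
    also have "\<dots> \<le> ?b" using that by (intro member_le_sum[of i _ "\<lambda>i. \<Sum>j<n. \<bar>M $$ (i, j)\<bar>"] sum_nonneg) auto
    finally show ?thesis .
  qed
  ultimately show "l1 (M *\<^sub>v x) \<le> real m * ?b * l1 x" by (intro l1_mult_mat_vec_bounded[OF M])
qed

section \<open>Adapted norms for Schur matrices\<close>

lemma smult_mat_mult_vec: "(a \<cdot>\<^sub>m A) *\<^sub>v x = a \<cdot>\<^sub>v (A *\<^sub>v x)" if "A \<in> carrier_mat m n" "x \<in> carrier_vec n"
  for A :: "'a::comm_ring_1 mat"
  using that by (intro eq_vecI) (auto simp: scalar_prod_def sum_distrib_left mult.assoc)

text \<open>\<open>N\<close> is an adapted norm, compared with \<open>l1\<close> from both sides.
  All conditions are relative to \<open>carrier_vec n\<close>, as the vector type does not fix the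
  dimension.\<close>

definition contracts :: "nat \<Rightarrow> real mat \<Rightarrow> real \<Rightarrow> real \<Rightarrow> (real Matrix.vec \<Rightarrow> real) \<Rightarrow> bool" where
  "contracts n A \<rho> C N \<longleftrightarrow>
     (\<forall>x\<in>carrier_vec n. l1 x \<le> N x \<and> N x \<le> C * l1 x \<and> N (- x) = N x \<and> N (A *\<^sub>v x) \<le> \<rho> * N x \<and>
        (\<forall>y\<in>carrier_vec n. N (x + y) \<le> N x + N y))"

text \<open>For \<open>spectral radius < r < 1\<close> the powers of \<open>A / r\<close> are bounded, so \<open>sup\<^sub>k |(A / r)\<^sup>k x|\<close> is finite.\<close>

lemma schur_contracts:
  assumes schur: "schur A" and A: "A \<in> carrier_mat n n"
  obtains \<rho> C N where "0 < \<rho>" "\<rho> < 1" "0 \<le> C" "contracts n A \<rho> C N"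
\<comment> \<open>In dimension 0 the spectrum is empty and the spectral radius is no maximum; the
  zero function serves as norm there.\<close>
proof (cases "n = 0")
  case True
  then have "contracts n A (1 / 2) 1 (\<lambda>_. 0)"
    by (auto simp: contracts_def l1_def)
  then show ?thesis by (intro that[of "1 / 2" 1]) auto
next
  case False
  let ?c = "map_mat complex_of_real"
  have cA: "?c A \<in> carrier_mat n n" using A by simp
  \<comment> \<open>The midpoint between the spectral radius and 1: dividing by it keeps the
    spectral radius below 1, and it becomes the contraction rate.\<close>
  define r where "r = (spectral_radius (?c A) + 1) / 2"
  have "spectral_radius (?c A) \<in> norm ` spectrum (?c A)"
    using spectral_radius_mem_max(1)[OF cA] False by simp
  then have "0 \<le> spectral_radius (?c A)" "spectral_radius (?c A) < 1"
    using schur by (auto simp: schur_def spectrum_def)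
  then have r: "0 < r" "r < 1" and less_r: "spectral_radius (?c A) < r" by (auto simp: r_def)
  define A' where "A' = (1 / r) \<cdot>\<^sub>m A"
  have A': "A' \<in> carrier_mat n n" using A by (simp add: A'_def)
  have A_A': "A = r \<cdot>\<^sub>m A'" using r A by (auto simp: A'_def)
  have cA': "?c A' \<in> carrier_mat n n" using A' by simp
  have cA_eq: "?c A = complex_of_real r \<cdot>\<^sub>m ?c A'" unfolding A_A' by auto
  have "spectral_radius (?c A') < 1"
  proof -
    have "spectral_radius (?c A') \<in> norm ` spectrum (?c A')"
      using spectral_radius_mem_max(1)[OF cA'] False by simp
    then obtain k where k: "eigenvalue (?c A') k" "spectral_radius (?c A') = cmod k"
      by (auto simp: spectrum_def)
    then obtain w where w: "w \<in> carrier_vec n" "w \<noteq> 0\<^sub>v n" "?c A' *\<^sub>v w = k \<cdot>\<^sub>v w"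
      using A' by (auto simp: eigenvalue_def eigenvector_def)
    have "?c A *\<^sub>v w = (complex_of_real r * k) \<cdot>\<^sub>v w"
      unfolding cA_eq smult_mat_mult_vec[OF cA' w(1)] w(3) by (simp add: smult_smult_assoc)
    then have "eigenvalue (?c A) (complex_of_real r * k)"
      using w A by (auto simp: eigenvalue_def eigenvector_def)
    then have "cmod (complex_of_real r * k) \<le> spectral_radius (?c A)"
      using spectral_radius_mem_max(2)[OF cA] False by (auto simp: spectrum_def)
    then have "r * cmod k \<le> spectral_radius (?c A)" using r by (simp add: norm_mult)
    then have "r * cmod k < r * 1" using less_r by linarith
    then have "cmod k < 1" using mult_less_cancel_left_pos[OF r(1)] by blast
    then show ?thesis using k by simp
  qed
  from spectral_radius_jnf_norm_bound_less_1_upper_triangular[OF cA' this]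
  obtain b where b: "\<And>k. norm_bound (?c A' ^\<^sub>m k) b" by blast
  have entry: "\<bar>(A' ^\<^sub>m k) $$ (i, j)\<bar> \<le> b" if "i < n" "j < n" for k i j
  proof -
    have "?c A' ^\<^sub>m k = ?c (A' ^\<^sub>m k)" by (rule of_real_hom.mat_hom_pow[OF A', symmetric])
    then have "norm_bound (?c (A' ^\<^sub>m k)) b" using b[of k] by simp
    then show ?thesis using that A' by (auto simp: norm_bound_def)
  qed
  define C where "C = real n * b"
  have "0 \<le> b" using entry[of 0 0 0] False by linarith
  then have C: "0 \<le> C" by (simp add: C_def)
  have pow: "l1 (A' ^\<^sub>m k *\<^sub>v x) \<le> C * l1 x" if "x \<in> carrier_vec n" for k x
    unfolding C_def using entry that A' by (intro l1_mult_mat_vec_bounded) auto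
  \<comment> \<open>The term \<open>k = 0\<close> gives the lower comparison with \<open>l1\<close>.
    Applying \<open>A\<close>, which is \<open>r\<close> times \<open>A'\<close>, shifts the
    supremum by one index and yields the factor \<open>r\<close>.\<close>
  define N where "N x = (SUP k. l1 (A' ^\<^sub>m k *\<^sub>v x))" for x
  have bdd: "bdd_above (range (\<lambda>k. l1 (A' ^\<^sub>m k *\<^sub>v x)))" if "x \<in> carrier_vec n" for x
    by (rule bdd_aboveI2) (rule pow[OF that])
  have le_N: "l1 (A' ^\<^sub>m k *\<^sub>v x) \<le> N x" if "x \<in> carrier_vec n" for k x
    unfolding N_def using bdd[OF that] by (rule cSUP_upper[OF UNIV_I])
  have N_le: "N x \<le> c" if "\<And>k. l1 (A' ^\<^sub>m k *\<^sub>v x) \<le> c" for x c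
    unfolding N_def using that by (intro cSUP_least) auto
  have "contracts n A r C N"
    unfolding contracts_def
  proof (intro ballI conjI)
    fix x :: "real Matrix.vec" assume x: "x \<in> carrier_vec n"
    show "l1 x \<le> N x" using le_N[OF x, of 0] x A' by simp
    show "N x \<le> C * l1 x" using N_le pow[OF x] by blast
    have "A' ^\<^sub>m k *\<^sub>v - x = - (A' ^\<^sub>m k *\<^sub>v x)" for k
      using x A' by (intro eq_vecI) (auto simp: scalar_prod_def sum_negf)
    then show "N (- x) = N x" by (simp add: N_def l1_uminus)
    show "N (A *\<^sub>v x) \<le> r * N x"
    proof (rule N_le)
      fix k
      have "A' ^\<^sub>m k *\<^sub>v (A *\<^sub>v x) = r \<cdot>\<^sub>v (A' ^\<^sub>m Suc k *\<^sub>v x)"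
        unfolding A_A' smult_mat_mult_vec[OF A' x] using A' x
        by (simp add: mult_mat_vec[of _ n n] assoc_mult_mat_vec[of _ n n _ n])
      then show "l1 (A' ^\<^sub>m k *\<^sub>v (A *\<^sub>v x)) \<le> r * N x"
        using le_N[OF x, of "Suc k"] r by (simp add: l1_smult)
    qed
    fix y :: "real Matrix.vec" assume y: "y \<in> carrier_vec n"
    show "N (x + y) \<le> N x + N y"
    proof (rule N_le)
      fix k
      have "l1 (A' ^\<^sub>m k *\<^sub>v (x + y)) \<le> l1 (A' ^\<^sub>m k *\<^sub>v x) + l1 (A' ^\<^sub>m k *\<^sub>v y)"
        using A' x y by (subst mult_add_distrib_mat_vec[of _ n n])
          (auto intro!: l1_add[of _ n] mult_mat_vec_carrier[of _ n n])
      then show "l1 (A' ^\<^sub>m k *\<^sub>v (x + y)) \<le> N x + N y"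
        using le_N[OF x, of k] le_N[OF y, of k] by linarith
    qed
  qed
  then show ?thesis using r C by (intro that)
qed

lemma schur_contracts_uniform:
  assumes "finite I" "\<And>i. i \<in> I \<Longrightarrow> schur (A i) \<and> A i \<in> carrier_mat (n i) (n i)"
  shows "\<exists>\<rho> C N. 0 < \<rho> \<and> \<rho> < 1 \<and> 0 \<le> C \<and> (\<forall>i\<in>I. contracts (n i) (A i) \<rho> C (N i))"
proof -
  have "\<forall>i. \<exists>\<rho> C N. i \<in> I \<longrightarrow> 0 < \<rho> \<and> \<rho> < 1 \<and> 0 \<le> C \<and> contracts (n i) (A i) \<rho> C N"
    by (meson assms(2) schur_contracts)
  then obtain \<rho> C N where *: "\<And>i. i \<in> I \<Longrightarrow> 0 < \<rho> i \<and> \<rho> i < 1 \<and> 0 \<le> C i \<and> contracts (n i) (A i) (\<rho> i) (C i) (N i)"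
    by metis
  \<comment> \<open>The worst rate and constant of finitely many blocks. The inserted values 1/2 and
    0 cover an empty family and keep the rate positive.\<close>
  define \<rho>' where "\<rho>' = Max (insert (1 / 2) (\<rho> ` I))"
  define C' where "C' = Max (insert 0 (C ` I))"
  have "1 / 2 \<le> \<rho>'" "0 \<le> C'"
    unfolding \<rho>'_def C'_def by (intro Max_ge; use assms(1) in simp)+
  moreover have "\<rho>' < 1" unfolding \<rho>'_def using assms(1) * by simp
  moreover have "contracts (n i) (A i) \<rho>' C' (N i)" if i: "i \<in> I" for i
  proof -
    have le: "\<rho> i \<le> \<rho>'" "C i \<le> C'" unfolding \<rho>'_def C'_def using assms(1) i by auto
    have c: "contracts (n i) (A i) (\<rho> i) (C i) (N i)" using * i by blast
    show ?thesis
      unfolding contracts_def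
    proof (intro ballI conjI)
      fix x :: "real Matrix.vec" assume x: "x \<in> carrier_vec (n i)"
      then have "0 \<le> N i x" using c l1_nonneg[of x] by (auto simp: contracts_def intro: order_trans)
      then show "N i (A i *\<^sub>v x) \<le> \<rho>' * N i x" "N i x \<le> C' * l1 x"
        using c x mult_right_mono[OF le(1), of "N i x"] mult_right_mono[OF le(2) l1_nonneg, of x]
        by (auto simp: contracts_def intro: order_trans)
    qed (use c in \<open>auto simp: contracts_def\<close>)
  qed
  ultimately show ?thesis by (intro exI[of _ \<rho>'] exI[of _ C'] exI[of _ N]) auto
qed

section \<open>Seminorms on states and cascades of contractions\<close>

definition seminorm_on :: "'i set \<Rightarrow> (('i \<Rightarrow> real) \<Rightarrow> real) \<Rightarrow> bool" where
  "seminorm_on S N \<longleftrightarrow> (\<forall>z. 0 \<le> N z) \<and> (\<forall>z. N (\<lambda>i. - z i) = N z) \<and>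
     (\<forall>z z'. N (\<lambda>i. z i + z' i) \<le> N z + N z') \<and> (\<exists>C\<ge>0. \<forall>z. N z \<le> C * (\<Sum>i\<in>S. \<bar>z i\<bar>))"

lemma seminorm_on_0: "seminorm_on S (\<lambda>_. 0)"
  by (auto simp: seminorm_on_def intro: sum_nonneg)

lemma seminorm_on_add:
  assumes "seminorm_on S N" "seminorm_on S N'"
  shows "seminorm_on S (\<lambda>z. N z + N' z)"
proof -
  obtain C C' where "C \<ge> 0" "\<forall>z. N z \<le> C * (\<Sum>i\<in>S. \<bar>z i\<bar>)" "C' \<ge> 0" "\<forall>z. N' z \<le> C' * (\<Sum>i\<in>S. \<bar>z i\<bar>)"
    using assms by (auto simp: seminorm_on_def)
  then have "\<exists>C\<ge>0. \<forall>z. N z + N' z \<le> C * (\<Sum>i\<in>S. \<bar>z i\<bar>)"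
    by (intro exI[of _ "C + C'"]) (auto simp: distrib_right intro: add_mono)
  moreover have "N (\<lambda>i. z i + z' i) + N' (\<lambda>i. z i + z' i) \<le> N z + N' z + (N z' + N' z')" for z z'
  proof -
    have "N (\<lambda>i. z i + z' i) \<le> N z + N z'" "N' (\<lambda>i. z i + z' i) \<le> N' z + N' z'"
      using assms by (auto simp: seminorm_on_def)
    then show ?thesis by linarith
  qed
  ultimately show ?thesis using assms by (auto simp: seminorm_on_def)
qed

lemma seminorm_on_scale:
  assumes "seminorm_on S N" "0 \<le> a"
  shows "seminorm_on S (\<lambda>z. a * N z)"
proof -
  obtain C where "C \<ge> 0" "\<forall>z. N z \<le> C * (\<Sum>i\<in>S. \<bar>z i\<bar>)"
    using assms by (auto simp: seminorm_on_def)
  then have "\<exists>C\<ge>0. \<forall>z. a * N z \<le> C * (\<Sum>i\<in>S. \<bar>z i\<bar>)"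
    using assms(2) by (intro exI[of _ "a * C"]) (auto simp: mult.assoc intro: mult_left_mono)
  moreover have "a * N (\<lambda>i. z i + z' i) \<le> a * N z + a * N z'" for z z'
    using assms mult_left_mono[of "N (\<lambda>i. z i + z' i)" "N z + N z'" a]
    by (auto simp: seminorm_on_def distrib_left)
  ultimately show ?thesis using assms by (auto simp: seminorm_on_def)
qed

lemma seminorm_on_sum:
  assumes "finite J" "\<And>j. j \<in> J \<Longrightarrow> seminorm_on S (N j)"
  shows "seminorm_on S (\<lambda>z. \<Sum>j\<in>J. N j z)"
  using assms by (induction J rule: finite_induct) (simp_all add: seminorm_on_0 seminorm_on_add)

text \<open>An adapted norm of one block, read as a function of the whole state; sums of these over
  the blocks form the stages of the cascade.\<close>

lemma seminorm_on_block:
  assumes N: "contracts n A \<rho> C N" "0 \<le> C" and S: "finite S" "inj g" "g ` {..<n} \<subseteq> S"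
  shows "seminorm_on S (\<lambda>z. N (Matrix.vec n (\<lambda>j. z (g j))))"
  unfolding seminorm_on_def
proof (intro conjI allI exI)
  let ?v = "\<lambda>z. Matrix.vec n (\<lambda>j. z (g j)) :: real Matrix.vec"
  fix z z' :: "_ \<Rightarrow> real"
  have c: "?v z \<in> carrier_vec n" for z by simp
  show "0 \<le> N (?v z)" using N(1) c[of z] l1_nonneg[of "?v z"] unfolding contracts_def by (meson order_trans)
  have "?v (\<lambda>i. - z i) = - ?v z" by auto
  then show "N (?v (\<lambda>i. - z i)) = N (?v z)" using N(1) c[of z] by (simp add: contracts_def)
  have "?v (\<lambda>i. z i + z' i) = ?v z + ?v z'" by auto
  then show "N (?v (\<lambda>i. z i + z' i)) \<le> N (?v z) + N (?v z')" using N(1) c by (simp add: contracts_def)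
  show "0 \<le> C" by fact
  have "l1 (?v z) \<le> (\<Sum>i\<in>S. \<bar>z i\<bar>)" by (rule l1_block_le[OF S])
  then have "C * l1 (?v z) \<le> C * (\<Sum>i\<in>S. \<bar>z i\<bar>)" using N(2) by (rule mult_left_mono)
  then show "N (?v z) \<le> C * (\<Sum>i\<in>S. \<bar>z i\<bar>)" using N(1) c[of z] unfolding contracts_def by (meson order_trans)
qed

text \<open>Each stage is driven only by the preceding one, so heavier weights on the earlier stages make
  the weighted sum contract.\<close>

lemma cascade_contraction:
  fixes H :: "('i \<Rightarrow> real) \<Rightarrow> 'i \<Rightarrow> real"
  assumes norms: "seminorm_on S a" "seminorm_on S b" "seminorm_on S c"
    and \<rho>: "0 < \<rho>" "\<rho> < 1" and K: "0 \<le> K" "0 \<le> K'"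
    and a: "\<And>x y. a (\<lambda>i. H x i - H y i) \<le> \<rho> * a (\<lambda>i. x i - y i)"
    and b: "\<And>x y. b (\<lambda>i. H x i - H y i) \<le> \<rho> * b (\<lambda>i. x i - y i) + K * a (\<lambda>i. x i - y i)"
    and c: "\<And>x y. c (\<lambda>i. H x i - H y i) \<le> \<rho> * c (\<lambda>i. x i - y i) + K' * b (\<lambda>i. x i - y i)"
  obtains N \<rho>' where "0 < \<rho>'" "\<rho>' < 1" "seminorm_on S N" "\<And>z. a z + b z + c z \<le> N z"
    "\<And>x y. N (\<lambda>i. H x i - H y i) \<le> \<rho>' * N (\<lambda>i. x i - y i)"
proof -
  \<comment> \<open>Half of the contraction gap: \<open>\<rho> + g\<close> is the midpoint of
    \<open>\<rho>\<close> and 1.\<close>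
  define g where "g = (1 - \<rho>) / 2"
  have g: "0 < g" using \<rho> by (simp add: g_def)
  \<comment> \<open>The weights are fixed backwards along the cascade: \<open>g * W\<close> absorbs
    the coupling \<open>K'\<close> into the last stage, then \<open>g * V\<close> absorbs
    \<open>W * K\<close> into the middle one. Adding 1 keeps both weights at least 1, so that
    \<open>N\<close> dominates the plain sum.\<close>
  define W where "W = K' / g + 1"
  define V where "V = W * K / g + 1"
  have W: "1 \<le> W" "g * W = K' + g" using K g by (simp_all add: W_def field_simps)
  have V: "1 \<le> V" "g * V = W * K + g" using K g W by (simp_all add: V_def field_simps)
  define N where "N z = V * a z + W * b z + c z" for z
  have nonneg: "0 \<le> a z" "0 \<le> b z" "0 \<le> c z" for z using norms by (simp_all add: seminorm_on_def)
  show ?thesis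
  proof (rule that[of "\<rho> + g" N])
    show "0 < \<rho> + g" "\<rho> + g < 1" using \<rho> by (simp_all add: g_def field_simps)
    show "seminorm_on S N"
      unfolding N_def using W V by (intro seminorm_on_add seminorm_on_scale norms) auto
    show "a z + b z + c z \<le> N z" for z
      unfolding N_def using nonneg[of z] mult_right_mono[OF W(1), of "b z"] mult_right_mono[OF V(1), of "a z"]
      by simp
    fix x y
    let ?d = "\<lambda>i. x i - y i" and ?D = "\<lambda>i. H x i - H y i"
    have "N ?D \<le> V * (\<rho> * a ?d) + W * (\<rho> * b ?d + K * a ?d) + (\<rho> * c ?d + K' * b ?d)"
      unfolding N_def using W V by (intro add_mono mult_left_mono a b c) auto
    also have "\<dots> = \<rho> * N ?d + W * K * a ?d + K' * b ?d" by (simp add: N_def algebra_simps)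
    also have "\<dots> \<le> \<rho> * N ?d + (g * V) * a ?d + (g * W) * b ?d + g * c ?d"
      unfolding W V using nonneg g by (simp add: distrib_right)
    also have "\<dots> = (\<rho> + g) * N ?d" by (simp add: N_def algebra_simps)
    finally show "N ?D \<le> (\<rho> + g) * N ?d" .
  qed
qed

section \<open>Dini moduli\<close>

text \<open>The last clause is the discrete form of the Dini condition. It is demanded for every
  ratio and every starting scale, because the contraction rate comes from the loop and not from the
  probabilities.\<close>

definition dini_modulus :: "real set \<Rightarrow> (real \<Rightarrow> real) \<Rightarrow> (real \<Rightarrow> real) \<Rightarrow> bool" where
  "dini_modulus A f \<omega> \<longleftrightarrow> (\<forall>t. 0 \<le> \<omega> t) \<and> (\<forall>t t'. t \<le> t' \<longrightarrow> \<omega> t \<le> \<omega> t') \<and>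
    (\<forall>x\<in>A. \<forall>y\<in>A. \<bar>f x - f y\<bar> \<le> \<omega> \<bar>x - y\<bar>) \<and>
    (\<forall>\<rho> t. 0 < \<rho> \<longrightarrow> \<rho> < 1 \<longrightarrow> 0 \<le> t \<longrightarrow> summable (\<lambda>n. \<omega> (\<rho> ^ n * t)))"

text \<open>On the shell between \<open>\<rho> ^ Suc n\<close> and \<open>\<rho> ^ n\<close> the
  integrand is at least \<open>\<omega> (\<rho> ^ Suc n) / \<rho> ^ n\<close>, and the shell has
  length \<open>(1 - \<rho>) * \<rho> ^ n\<close>. Its share of the Dini integral is thus at least
  \<open>(1 - \<rho>) * \<omega> (\<rho> ^ Suc n)\<close>, which bounds the partial sums.\<close>

lemma dini_continuous_modulus:
  assumes dini: "dini_continuous_on A f" and range: "\<And>s. s \<in> A \<Longrightarrow> f s \<in> {0..1}"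
  shows "\<exists>\<omega>. dini_modulus A f \<omega>"
proof -
  let ?m = "modulus_of_continuity A f"
  define \<omega> where "\<omega> t = enn2real (?m t)" for t
  \<comment> \<open>Values in the unit interval make the extended modulus finite, so nothing is lost
    in passing to a real one.\<close>
  have "\<bar>f x - f y\<bar> \<le> 1" if "x \<in> A" "y \<in> A" for x y
    using range[OF that(1)] range[OF that(2)] by auto
  then have "?m t \<le> 1" for t
    unfolding modulus_of_continuity_def by (intro SUP_least) (auto simp flip: ennreal_1 intro: ennreal_leI)
  then have m: "?m t = ennreal (\<omega> t)" for t
    unfolding \<omega>_def using le_less_trans[OF _ ennreal_one_less_top, of "?m t"] by simp
  have nonneg: "0 \<le> \<omega> t" for t by (simp add: \<omega>_def)
  have mono: "\<omega> t \<le> \<omega> t'" if "t \<le> t'" for t t'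
  proof -
    have "?m t \<le> ?m t'"
      unfolding modulus_of_continuity_def using that by (intro SUP_subset_mono) auto
    then show ?thesis by (simp add: m nonneg)
  qed
  have modulus: "\<bar>f x - f y\<bar> \<le> \<omega> \<bar>x - y\<bar>" if "x \<in> A" "y \<in> A" for x y
  proof -
    have "ennreal \<bar>f x - f y\<bar> \<le> ?m \<bar>x - y\<bar>"
      unfolding modulus_of_continuity_def using that by (intro SUP_upper2[of "(x, y)"]) auto
    then show ?thesis by (simp add: m nonneg)
  qed
  have geometric: "summable (\<lambda>n. \<omega> (\<rho> ^ n))" if \<rho>: "0 < \<rho>" "\<rho> < 1" for \<rho>
  proof -
    define I where "I = enn2real (\<integral>\<^sup>+t\<in>{0<..1}. ?m t / ennreal t \<partial>lborel)"
    have I: "(\<integral>\<^sup>+t\<in>{0<..1}. ?m t / ennreal t \<partial>lborel) = ennreal I"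
      using dini by (simp add: I_def dini_continuous_on_def)
    \<comment> \<open>The smallest value allowed by monotonicity on the n-th shell: numerator at its
      left end, denominator at its right end.\<close>
    define c where "c n = \<omega> (\<rho> ^ Suc n) / \<rho> ^ n" for n
    have c: "0 \<le> c n" for n using \<rho> by (simp add: c_def nonneg)
    have bound: "(1 - \<rho>) * (\<Sum>n<k. \<omega> (\<rho> ^ Suc n)) \<le> I" for k
    proof -
      have disjoint: "n = n'" if "s \<in> {\<rho> ^ Suc n<..\<rho> ^ n}" "s \<in> {\<rho> ^ Suc n'<..\<rho> ^ n'}" for s n n'
      proof (rule ccontr)
        assume "n \<noteq> n'"
        then have "Suc n \<le> n' \<or> Suc n' \<le> n" by auto
        then have "\<rho> ^ n' \<le> \<rho> ^ Suc n \<or> \<rho> ^ n \<le> \<rho> ^ Suc n'"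
          using \<rho> power_decreasing[of _ _ \<rho>] by (meson less_imp_le)
        then show False using that by auto
      qed
      have pointwise: "(\<Sum>n<k. ennreal (c n) * indicator {\<rho> ^ Suc n<..\<rho> ^ n} s)
          \<le> ?m s / ennreal s * indicator {0<..1} s" for s
      proof (cases "\<exists>n<k. s \<in> {\<rho> ^ Suc n<..\<rho> ^ n}")
        case True
        then obtain n where n: "n < k" "s \<in> {\<rho> ^ Suc n<..\<rho> ^ n}" by blast
        have "0 < \<rho> ^ Suc n" using \<rho> by simp
        moreover have "\<rho> ^ n \<le> 1" using \<rho> by (simp add: power_le_one)
        ultimately have s: "0 < s" "s \<le> 1" using n(2) unfolding greaterThanAtMost_iff by linarith+
        have "(\<Sum>n<k. ennreal (c n) * indicator {\<rho> ^ Suc n<..\<rho> ^ n} s)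
            = (\<Sum>n'<k. if n' = n then ennreal (c n) else 0)"
        proof (rule sum.cong[OF refl])
          fix n'
          show "ennreal (c n') * indicator {\<rho> ^ Suc n'<..\<rho> ^ n'} s = (if n' = n then ennreal (c n) else 0)"
          proof (cases "n' = n")
            case True
            then show ?thesis unfolding True using n(2) by (simp only: indicator_simps if_True mult_1_right)
          next
            case False
            then have "s \<notin> {\<rho> ^ Suc n'<..\<rho> ^ n'}" using disjoint[OF n(2), of n'] by blast
            with False show ?thesis by (simp only: indicator_simps if_False mult_zero_right simp_thms)
          qed
        qed
        also have "\<dots> = ennreal (c n)" using n by simp
        also have "c n \<le> \<omega> s / s"
          unfolding c_def using n s \<rho> by (intro frac_le mono nonneg) auto
        also have "ennreal (\<omega> s / s) = ?m s / ennreal s * indicator {0<..1} s"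
          using s by (simp add: m divide_ennreal nonneg)
        finally show ?thesis by (simp add: ennreal_leI)
      next
        case False
        then have "ennreal (c n) * indicator {\<rho> ^ Suc n<..\<rho> ^ n} s = 0" if "n < k" for n
        proof -
          have "s \<notin> {\<rho> ^ Suc n<..\<rho> ^ n}" using that False by blast
          then show ?thesis by (simp only: indicator_simps mult_zero_right simp_thms)
        qed
        then have "(\<Sum>n<k. ennreal (c n) * indicator {\<rho> ^ Suc n<..\<rho> ^ n} s) = 0"
          by (intro sum.neutral ballI) (simp only: lessThan_iff)
        then show ?thesis by (simp only: zero_le)
      qed
      have "ennreal ((1 - \<rho>) * (\<Sum>n<k. \<omega> (\<rho> ^ Suc n))) = (\<Sum>n<k. ennreal (c n) * ennreal (\<rho> ^ n - \<rho> ^ Suc n))"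
      proof -
        have "c n * (\<rho> ^ n - \<rho> ^ Suc n) = (1 - \<rho>) * \<omega> (\<rho> ^ Suc n)" for n
          using \<rho> by (simp add: c_def field_simps)
        moreover have "0 \<le> \<rho> ^ n - \<rho> ^ Suc n" for n
          using \<rho> power_decreasing[of n "Suc n" \<rho>] by simp
        ultimately show ?thesis
          using \<rho> c by (simp add: sum_distrib_left sum_ennreal nonneg flip: ennreal_mult)
      qed
      also have "\<dots> = (\<integral>\<^sup>+s. (\<Sum>n<k. ennreal (c n) * indicator {\<rho> ^ Suc n<..\<rho> ^ n} s) \<partial>lborel)"
      proof -
        have le: "\<rho> ^ Suc n \<le> \<rho> ^ n" for n using \<rho> power_decreasing[of n "Suc n" \<rho>] by simp
        have "(\<integral>\<^sup>+s. (\<Sum>n<k. ennreal (c n) * indicator {\<rho> ^ Suc n<..\<rho> ^ n} s) \<partial>lborel)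
            = (\<Sum>n<k. \<integral>\<^sup>+s. ennreal (c n) * indicator {\<rho> ^ Suc n<..\<rho> ^ n} s \<partial>lborel)"
          by (rule nn_integral_sum) simp
        also have "\<dots> = (\<Sum>n<k. ennreal (c n) * ennreal (\<rho> ^ n - \<rho> ^ Suc n))"
          using le by (simp only: nn_integral_cmult_indicator sets_lborel greaterThanAtMost_borel emeasure_lborel_Ioc)
        finally show ?thesis by simp
      qed
      also have "\<dots> \<le> (\<integral>\<^sup>+s. ?m s / ennreal s * indicator {0<..1} s \<partial>lborel)"
        by (intro nn_integral_mono pointwise)
      also have "\<dots> = ennreal I" by (rule I)
      finally show ?thesis by (simp add: I_def)
    qed
    have "summable (\<lambda>n. \<omega> (\<rho> ^ Suc n))"
    proof (rule summableI_nonneg_bounded)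
      show "(\<Sum>n<k. \<omega> (\<rho> ^ Suc n)) \<le> I / (1 - \<rho>)" for k
        using bound[of k] \<rho> by (simp add: field_simps)
    qed (rule nonneg)
    then show ?thesis by (rule summable_Suc_iff[of "\<lambda>n. \<omega> (\<rho> ^ n)", THEN iffD1])
  qed
  \<comment> \<open>For a general starting scale, finitely many steps bring it below 1, after which
    the case of scale 1 dominates.\<close>
  have "summable (\<lambda>n. \<omega> (\<rho> ^ n * t))" if \<rho>: "0 < \<rho>" "\<rho> < 1" and t: "0 \<le> t" for \<rho> t
  proof -
    have "(\<lambda>n. \<rho> ^ n * t) \<longlonglongrightarrow> 0 * t" using \<rho> by (intro tendsto_intros LIMSEQ_power_zero) auto
    then have "eventually (\<lambda>n. \<rho> ^ n * t < 1) sequentially" by (intro order_tendstoD(2)) auto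
    then obtain k where k: "\<rho> ^ k * t < 1" by (auto simp: eventually_sequentially)
    have "\<omega> (\<rho> ^ (n + k) * t) \<le> \<omega> (\<rho> ^ n)" for n
    proof (rule mono)
      have "\<rho> ^ n * (\<rho> ^ k * t) \<le> \<rho> ^ n * 1" using k \<rho> by (intro mult_left_mono) auto
      then show "\<rho> ^ (n + k) * t \<le> \<rho> ^ n" by (simp add: power_add mult.assoc)
    qed
    then have "summable (\<lambda>n. \<omega> (\<rho> ^ (n + k) * t))"
      by (intro summable_comparison_test'[OF geometric[OF \<rho>], of 0]) (auto simp: nonneg)
    then show ?thesis by (rule summable_iff_shift[of "\<lambda>n. \<omega> (\<rho> ^ n * t)" k, THEN iffD1])
  qed
  then show ?thesis unfolding dini_modulus_def using nonneg mono modulus by blast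
qed

lemma pmf_index_pmf:
  assumes "\<And>j. j \<in> {1..n} \<Longrightarrow> 0 \<le> w j" "(\<Sum>j = 1..n. w j) = 1"
  shows "pmf (index_pmf n w) j = (if j \<in> {1..n} then w j else 0)"
  unfolding index_pmf_def
proof (rule pmf_embed_pmf)
  show "0 \<le> (if x \<in> {1..n} then w x else 0)" for x using assms(1) by auto
  have "(\<integral>\<^sup>+x. ennreal (if x \<in> {1..n} then w x else 0) \<partial>count_space UNIV)
      = (\<Sum>x\<in>{1..n}. ennreal (if x \<in> {1..n} then w x else 0))"
    by (rule nn_integral_count_space'[of "{1..n}"]) auto
  also have "\<dots> = (\<Sum>x\<in>{1..n}. ennreal (w x))" by (rule sum.cong) auto
  also have "\<dots> = 1" using assms by (subst sum_ennreal) auto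
  finally show "(\<integral>\<^sup>+x. ennreal (if x \<in> {1..n} then w x else 0) \<partial>count_space UNIV) = 1" .
qed

section \<open>The closed loop\<close>

instance coord :: countable
  by countable_datatype

locale stable_loop =
  fixes L :: loop
  assumes compat: "compatible L"
    and systems_schur: "\<And>q i. q \<in> {1..ens_num L} \<Longrightarrow> i \<in> {1..sys_num L q} \<Longrightarrow> schur (sys_A L q i)"
    and filters_stable: "\<And>q. q \<in> {1..ens_num L} \<Longrightarrow> schur (filt_A L q)"
    and controllers_stable: "\<And>q. q \<in> {1..ens_num L} \<Longrightarrow> schur (ctrl_A L q)"
begin

section \<open>Dimensions and Lipschitz bounds of the signals\<close>

abbreviation "Q \<equiv> {1..ens_num L}"
abbreviation "J \<equiv> SIGMA q:Q. {1..sys_num L q}"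
abbreviation "S \<equiv> state_index L"

lemma carriers:
  "q \<in> Q \<Longrightarrow> i \<in> {1..sys_num L q} \<Longrightarrow> sys_A L q i \<in> carrier_mat (sys_dim L q i) (sys_dim L q i)"
  "q \<in> Q \<Longrightarrow> i \<in> {1..sys_num L q} \<Longrightarrow> sys_c L q i \<in> carrier_vec (sys_dim L q i)"
  "q \<in> Q \<Longrightarrow> i \<in> {1..sys_num L q} \<Longrightarrow> j \<in> {1..b_num L q i} \<Longrightarrow> b_val L q i j \<in> carrier_vec (sys_dim L q i)"
  "q \<in> Q \<Longrightarrow> filt_A L q \<in> carrier_mat (filt_dim L q) (filt_dim L q)"
  "q \<in> Q \<Longrightarrow> filt_B L q \<in> carrier_mat (filt_dim L q) 1"
  "q \<in> Q \<Longrightarrow> filt_C L q \<in> carrier_mat (filt_out L q) (filt_dim L q)"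
  "q \<in> Q \<Longrightarrow> ctrl_A L q \<in> carrier_mat (ctrl_dim L q) (ctrl_dim L q)"
  "q \<in> Q \<Longrightarrow> ctrl_B L q \<in> carrier_mat (ctrl_dim L q) (ctrl_in L q)"
  "q \<in> Q \<Longrightarrow> ctrl_C L q \<in> carrier_mat 1 (ctrl_dim L q)"
  "q \<in> Q \<Longrightarrow> ctrl_D L q \<in> carrier_mat 1 (ctrl_in L q)"
  "q \<in> Q \<Longrightarrow> ext_input L q \<in> carrier_vec (ctrl_in L q)"
  "q \<in> Q \<Longrightarrow> q' \<in> Q \<Longrightarrow> coupling L q q' \<in> carrier_mat (ctrl_in L q) (filt_out L q')"
  using compat unfolding compatible_def by blast+

lemma state_carriers [simp]:
  "sys_state L x q i \<in> carrier_vec (sys_dim L q i)"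
  "filt_state L x q \<in> carrier_vec (filt_dim L q)"
  "ctrl_state L x q \<in> carrier_vec (ctrl_dim L q)"
  by (simp_all add: sys_state_def filt_state_def ctrl_state_def)

lemma state_diff:
  "sys_state L (\<lambda>c. x c - y c) q i = sys_state L x q i - sys_state L y q i"
  "filt_state L (\<lambda>c. x c - y c) q = filt_state L x q - filt_state L y q"
  "ctrl_state L (\<lambda>c. x c - y c) q = ctrl_state L x q - ctrl_state L y q"
  by (auto simp: sys_state_def filt_state_def ctrl_state_def)

lemma finite_state_index: "finite S"
proof -
  have "S = (\<lambda>(q, i, j). Sys q i j) ` (SIGMA q:Q. SIGMA i:{1..sys_num L q}. {..<sys_dim L q i}) \<union>
      (\<lambda>(q, j). Filt q j) ` (SIGMA q:Q. {..<filt_dim L q}) \<union>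
      (\<lambda>(q, j). Ctrl q j) ` (SIGMA q:Q. {..<ctrl_dim L q})"
    by (auto simp: state_index_def image_iff)
  then show ?thesis by (simp only: finite_Un) (intro conjI finite_imageI finite_SigmaI; simp)
qed

lemma block_subset:
  "q \<in> Q \<Longrightarrow> i \<in> {1..sys_num L q} \<Longrightarrow> Sys q i ` {..<sys_dim L q i} \<subseteq> S"
  "q \<in> Q \<Longrightarrow> Filt q ` {..<filt_dim L q} \<subseteq> S"
  "q \<in> Q \<Longrightarrow> Ctrl q ` {..<ctrl_dim L q} \<subseteq> S"
  by (auto simp: state_index_def)

lemma error_signal_carrier: "p \<in> Q \<Longrightarrow> error_signal L x p \<in> carrier_vec (ctrl_in L p)"
  unfolding error_signal_def
  by (intro minus_carrier_vec carriers finsum_vec_closed Pi_I mult_mat_vec_carrier[OF carriers(12)]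
      mult_mat_vec_carrier[OF carriers(6)] state_carriers) auto

text \<open>Only the filter states enter on the right-hand side: this is what lets the controllers
  form a stage driven by the filters alone.\<close>

lemma error_signal_lipschitz:
  assumes p: "p \<in> Q"
  shows "\<exists>K\<ge>0. \<forall>x y. l1 (error_signal L x p - error_signal L y p) \<le>
    K * (\<Sum>q\<in>Q. l1 (filt_state L (\<lambda>c. x c - y c) q))"
proof -
  let ?M = "\<lambda>q v. coupling L p q *\<^sub>v (filt_C L q *\<^sub>v v)"
  have M: "?M q v \<in> carrier_vec (ctrl_in L p)" if "q \<in> Q" "v \<in> carrier_vec (filt_dim L q)" for q v
    using that by (intro mult_mat_vec_carrier[OF carriers(12)] mult_mat_vec_carrier[OF carriers(6)] p)
  have "\<exists>K\<ge>0. \<forall>v\<in>carrier_vec (filt_dim L q). l1 (?M q v) \<le> K * l1 v" if q: "q \<in> Q" for q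
  proof -
    obtain K where "0 \<le> K" "\<And>v. v \<in> carrier_vec (filt_dim L q) \<Longrightarrow> l1 ((coupling L p q * filt_C L q) *\<^sub>v v) \<le> K * l1 v"
      using l1_mult_mat_vec[OF mult_carrier_mat[OF carriers(12)[OF p q] carriers(6)[OF q]]] by blast
    then show ?thesis
      using assoc_mult_mat_vec[OF carriers(12)[OF p q] carriers(6)[OF q]] by (intro exI[of _ K]) auto
  qed
  then obtain K where K: "\<And>q. q \<in> Q \<Longrightarrow> 0 \<le> K q"
    "\<And>q v. q \<in> Q \<Longrightarrow> v \<in> carrier_vec (filt_dim L q) \<Longrightarrow> l1 (?M q v) \<le> K q * l1 v"
    by metis
  show ?thesis
  proof (intro exI[of _ "\<Sum>q\<in>Q. K q"] conjI allI)
    show "0 \<le> (\<Sum>q\<in>Q. K q)" by (intro sum_nonneg K)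
    fix x y :: state
    let ?d = "\<lambda>c. x c - y c"
    have f: "(\<lambda>q. ?M q (filt_state L z q)) \<in> Q \<rightarrow> carrier_vec (ctrl_in L p)" for z
      by (intro Pi_I M state_carriers)
    \<comment> \<open>The constant external input cancels, leaving the negated coupling of the
      filter differences.\<close>
    have "error_signal L x p - error_signal L y p =
        - finsum_vec TYPE(real) (ctrl_in L p) (\<lambda>q. ?M q (filt_state L ?d q)) Q"
    proof (rule eq_vecI)
      fix j assume "j < dim_vec (- finsum_vec TYPE(real) (ctrl_in L p) (\<lambda>q. ?M q (filt_state L ?d q)) Q)"
      then have j: "j < ctrl_in L p" using finsum_vec_closed[OF f[of ?d]] by simp
      have dim: "dim_vec (finsum_vec TYPE(real) (ctrl_in L p) (\<lambda>q. ?M q (filt_state L z q)) Q) = ctrl_in L p" for z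
        using finsum_vec_closed[OF f[of z]] by simp
      have lin: "vec_index (?M q (filt_state L ?d q)) j =
          vec_index (?M q (filt_state L x q)) j - vec_index (?M q (filt_state L y q)) j" if q: "q \<in> Q" for q
        unfolding state_diff(2) mult_minus_distrib_mat_vec[OF carriers(6)[OF q] state_carriers(2) state_carriers(2)]
          mult_minus_distrib_mat_vec[OF carriers(12)[OF p q] mult_mat_vec_carrier[OF carriers(6)[OF q] state_carriers(2)]
            mult_mat_vec_carrier[OF carriers(6)[OF q] state_carriers(2)]]
        by (rule index_minus_vec(1)) (use j carriers(12)[OF p q] in simp)
      show "vec_index (error_signal L x p - error_signal L y p) j =
          vec_index (- finsum_vec TYPE(real) (ctrl_in L p) (\<lambda>q. ?M q (filt_state L ?d q)) Q) j"
        using j carriers(11)[OF p] lin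
        by (simp add: error_signal_def dim index_finsum_vec[OF _ j f] sum_subtractf del: One_nat_def atLeastAtMost_iff)
    next
      show "dim_vec (error_signal L x p - error_signal L y p) =
          dim_vec (- finsum_vec TYPE(real) (ctrl_in L p) (\<lambda>q. ?M q (filt_state L ?d q)) Q)"
        using error_signal_carrier[OF p, of y] finsum_vec_closed[OF f[of ?d]] by simp
    qed
    then have "l1 (error_signal L x p - error_signal L y p) \<le> (\<Sum>q\<in>Q. l1 (?M q (filt_state L ?d q)))"
      using l1_finsum_vec[of Q "\<lambda>q. ?M q (filt_state L ?d q)" "ctrl_in L p"] M by (simp add: l1_uminus)
    also have "\<dots> \<le> (\<Sum>q\<in>Q. (\<Sum>q\<in>Q. K q) * l1 (filt_state L ?d q))"
    proof (rule sum_mono)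
      fix q assume q: "q \<in> Q"
      have "l1 (?M q (filt_state L ?d q)) \<le> K q * l1 (filt_state L ?d q)" using q by (intro K) auto
      also have "\<dots> \<le> (\<Sum>q\<in>Q. K q) * l1 (filt_state L ?d q)"
        using q by (intro mult_right_mono member_le_sum K l1_nonneg) auto
      finally show "l1 (?M q (filt_state L ?d q)) \<le> (\<Sum>q\<in>Q. K q) * l1 (filt_state L ?d q)" .
    qed
    finally show "l1 (error_signal L x p - error_signal L y p) \<le> (\<Sum>q\<in>Q. K q) * (\<Sum>q\<in>Q. l1 (filt_state L ?d q))"
      by (simp add: sum_distrib_left)
  qed
qed

text \<open>Each signal is affine in the state. The bound carries moduli of the probabilities, which
  are functions of the signal, over to the state.\<close>

lemma control_signal_lipschitz:
  assumes p: "p \<in> Q"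
  shows "\<exists>K\<ge>0. \<forall>x y. \<bar>control_signal L x p - control_signal L y p\<bar> \<le> K * (\<Sum>c\<in>S. \<bar>x c - y c\<bar>)"
proof -
  obtain K1 where K1: "0 \<le> K1" "\<And>v. v \<in> carrier_vec (ctrl_dim L p) \<Longrightarrow> l1 (ctrl_C L p *\<^sub>v v) \<le> K1 * l1 v"
    using l1_mult_mat_vec[OF carriers(9)[OF p]] by blast
  obtain K2 where K2: "0 \<le> K2" "\<And>v. v \<in> carrier_vec (ctrl_in L p) \<Longrightarrow> l1 (ctrl_D L p *\<^sub>v v) \<le> K2 * l1 v"
    using l1_mult_mat_vec[OF carriers(10)[OF p]] by blast
  obtain K3 where K3: "0 \<le> K3" "\<And>x y. l1 (error_signal L x p - error_signal L y p) \<le>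
      K3 * (\<Sum>q\<in>Q. l1 (filt_state L (\<lambda>c. x c - y c) q))"
    using error_signal_lipschitz[OF p] by blast
  show ?thesis
  proof (intro exI[of _ "K1 + K2 * (K3 * real (card Q))"] conjI allI)
    show "0 \<le> K1 + K2 * (K3 * real (card Q))" using K1 K2 K3 by simp
    fix x y :: state
    let ?d = "\<lambda>c. x c - y c"
    let ?s = "\<Sum>c\<in>S. \<bar>x c - y c\<bar>"
    let ?e = "error_signal L x p - error_signal L y p"
    note e = error_signal_carrier[OF p]
    have e': "?e \<in> carrier_vec (ctrl_in L p)" by (intro minus_carrier_vec e)
    have "control_signal L x p - control_signal L y p =
        vec_index (ctrl_C L p *\<^sub>v ctrl_state L ?d p) 0 + vec_index (ctrl_D L p *\<^sub>v ?e) 0"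
      unfolding state_diff
        mult_minus_distrib_mat_vec[OF carriers(9)[OF p] state_carriers(3) state_carriers(3)]
        mult_minus_distrib_mat_vec[OF carriers(10)[OF p] e e]
      using carriers(9,10)[OF p] by (simp add: control_signal_def)
    then have "\<bar>control_signal L x p - control_signal L y p\<bar> \<le>
        \<bar>vec_index (ctrl_C L p *\<^sub>v ctrl_state L ?d p) 0\<bar> + \<bar>vec_index (ctrl_D L p *\<^sub>v ?e) 0\<bar>"
      by simp
    also have "\<dots> \<le> l1 (ctrl_C L p *\<^sub>v ctrl_state L ?d p) + l1 (ctrl_D L p *\<^sub>v ?e)"
      using carriers(9,10)[OF p] by (intro add_mono abs_index_le_l1) auto
    also have "\<dots> \<le> K1 * ?s + K2 * (K3 * (real (card Q) * ?s))"
    proof (intro add_mono)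
      have "l1 (ctrl_state L ?d p) \<le> ?s"
        unfolding ctrl_state_def using finite_state_index block_subset(3)[OF p]
        by (intro l1_block_le) (auto simp: inj_def)
      then show "l1 (ctrl_C L p *\<^sub>v ctrl_state L ?d p) \<le> K1 * ?s"
        using K1 by (intro order_trans[OF K1(2)] mult_left_mono) auto
      have "(\<Sum>q\<in>Q. l1 (filt_state L ?d q)) \<le> (\<Sum>q\<in>Q. ?s)"
        unfolding filt_state_def using finite_state_index block_subset(2)
        by (intro sum_mono l1_block_le) (auto simp: inj_def)
      then have "l1 ?e \<le> K3 * (real (card Q) * ?s)"
        using K3 by (intro order_trans[OF K3(2)] mult_left_mono) auto
      then show "l1 (ctrl_D L p *\<^sub>v ?e) \<le> K2 * (K3 * (real (card Q) * ?s))"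
        using K2 e' by (intro order_trans[OF K2(2)] mult_left_mono) auto
    qed
    also have "\<dots> = (K1 + K2 * (K3 * real (card Q))) * ?s" by (simp add: algebra_simps)
    finally show "\<bar>control_signal L x p - control_signal L y p\<bar> \<le> (K1 + K2 * (K3 * real (card Q))) * ?s" .
  qed
qed

section \<open>Splitting the update into a common drift and random offsets\<close>

definition drift :: "state \<Rightarrow> state" where
  "drift x = (\<lambda>c. case c of
       Sys q i j \<Rightarrow> vec_index (sys_A L q i *\<^sub>v sys_state L x q i) j
     | Filt q j \<Rightarrow> vec_index (filt_A L q *\<^sub>v filt_state L x q) j +
         filt_B L q $$ (j, 0) * (\<Sum>i = 1..sys_num L q. scalar_prod (sys_c L q i) (sys_state L x q i))
     | Ctrl q j \<Rightarrow> vec_index (next_ctrl L x q) j)"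

text \<open>The controllers have offset 0 because they see the current filter state, and the random
  choices reach them only through the filters, one step later. The external input, being
  deterministic, belongs to \<open>drift\<close>.\<close>

definition offset :: "choices \<Rightarrow> state" where
  "offset \<sigma> = (\<lambda>c. case c of
       Sys q i j \<Rightarrow> vec_index (b_val L q i (fst (\<sigma> (q, i)))) j
     | Filt q j \<Rightarrow> filt_B L q $$ (j, 0) * (\<Sum>i = 1..sys_num L q. d_val L q i (snd (\<sigma> (q, i))))
     | Ctrl q j \<Rightarrow> 0)"

text \<open>The hypothesis secures the declared dimension of the chosen vector \<open>b\<close>, on
  which the entries of a vector sum depend; the scalars \<open>d\<close> impose no such
  condition.\<close>

lemma next_state_eq:
  assumes "\<And>q i. (q, i) \<in> J \<Longrightarrow> fst (\<sigma> (q, i)) \<in> {1..b_num L q i}"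
  shows "next_state L x \<sigma> = (\<lambda>c\<in>S. drift x c + offset \<sigma> c)"
  unfolding next_state_def
proof (rule restrict_ext)
  fix c assume "c \<in> S"
  then consider (Sys) q i j where "c = Sys q i j" "q \<in> Q" "i \<in> {1..sys_num L q}" "j < sys_dim L q i"
    | (Filt) q j where "c = Filt q j" "q \<in> Q" "j < filt_dim L q"
    | (Ctrl) q j where "c = Ctrl q j" "q \<in> Q" "j < ctrl_dim L q"
    by (auto simp: state_index_def)
  then show "(case c of Sys q i j \<Rightarrow> vec_index (next_sys L x \<sigma> q i) j
      | Filt q j \<Rightarrow> vec_index (next_filt L x \<sigma> q) j
      | Ctrl q j \<Rightarrow> vec_index (next_ctrl L x q) j) = drift x c + offset \<sigma> c"
  proof cases
    case Sys
    have "b_val L q i (fst (\<sigma> (q, i))) \<in> carrier_vec (sys_dim L q i)"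
      using Sys assms by (intro carriers) auto
    then show ?thesis using Sys by (simp add: drift_def offset_def next_sys_def)
  next
    case Filt
    have "vec_index (next_filt L x \<sigma> q) j = vec_index (filt_A L q *\<^sub>v filt_state L x q) j +
        vec_index (filt_B L q *\<^sub>v Matrix.vec 1 (\<lambda>_. ensemble_output L x \<sigma> q)) j"
      unfolding next_filt_def using Filt carriers(5)[OF Filt(2)] by (intro index_add_vec) auto
    then show ?thesis
      unfolding mult_mat_vec_column[OF carriers(5)[OF Filt(2)] Filt(3)]
      using Filt by (simp add: drift_def offset_def ensemble_output_def sum.distrib distrib_left)
  next
    case Ctrl
    then show ?thesis by (simp add: drift_def offset_def)
  qed
qed

text \<open>The three equations are the block triangular structure: the systems evolve on their own,
  the filters are driven by the systems, and the controllers by the filters. The feedback loop is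
  closed solely through the choice probabilities.\<close>

lemma drift_diff:
  "q \<in> Q \<Longrightarrow> i \<in> {1..sys_num L q} \<Longrightarrow> sys_state L (\<lambda>c. drift x c - drift y c) q i =
    sys_A L q i *\<^sub>v sys_state L (\<lambda>c. x c - y c) q i"
  "q \<in> Q \<Longrightarrow> filt_state L (\<lambda>c. drift x c - drift y c) q =
    filt_A L q *\<^sub>v filt_state L (\<lambda>c. x c - y c) q + filt_B L q *\<^sub>v Matrix.vec 1 (\<lambda>_.
      \<Sum>i = 1..sys_num L q. scalar_prod (sys_c L q i) (sys_state L (\<lambda>c. x c - y c) q i))"
  "q \<in> Q \<Longrightarrow> ctrl_state L (\<lambda>c. drift x c - drift y c) q =
    ctrl_A L q *\<^sub>v ctrl_state L (\<lambda>c. x c - y c) q + ctrl_B L q *\<^sub>v (error_signal L x q - error_signal L y q)"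
proof -
  assume q: "q \<in> Q"
  {
    assume i: "i \<in> {1..sys_num L q}"
    show "sys_state L (\<lambda>c. drift x c - drift y c) q i = sys_A L q i *\<^sub>v sys_state L (\<lambda>c. x c - y c) q i"
      unfolding state_diff(1)[of x y] mult_minus_distrib_mat_vec[OF carriers(1)[OF q i] state_carriers(1) state_carriers(1)]
      using carriers(1)[OF q i] by (intro eq_vecI) (auto simp: sys_state_def drift_def)
  }
  have c: "scalar_prod (sys_c L q i) (sys_state L (\<lambda>c. x c - y c) q i) =
      scalar_prod (sys_c L q i) (sys_state L x q i) - scalar_prod (sys_c L q i) (sys_state L y q i)"
    if "i \<in> {1..sys_num L q}" for i
    unfolding state_diff(1) by (rule scalar_prod_minus_distrib[OF carriers(2)[OF q that]]) auto
  have c_sum: "(\<Sum>i = 1..sys_num L q. scalar_prod (sys_c L q i) (sys_state L (\<lambda>c. x c - y c) q i)) =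
      (\<Sum>i = 1..sys_num L q. scalar_prod (sys_c L q i) (sys_state L x q i)) -
      (\<Sum>i = 1..sys_num L q. scalar_prod (sys_c L q i) (sys_state L y q i))"
    unfolding sum_subtractf[symmetric] by (rule sum.cong[OF refl c])
  show "filt_state L (\<lambda>c. drift x c - drift y c) q =
    filt_A L q *\<^sub>v filt_state L (\<lambda>c. x c - y c) q + filt_B L q *\<^sub>v Matrix.vec 1 (\<lambda>_.
      \<Sum>i = 1..sys_num L q. scalar_prod (sys_c L q i) (sys_state L (\<lambda>c. x c - y c) q i))"
    (is "?l = ?A + ?B")
  proof (rule eq_vecI)
    fix j assume "j < dim_vec (?A + ?B)"
    then have j: "j < filt_dim L q" using carriers(5)[OF q] by simp
    have "vec_index (?A + ?B) j = vec_index ?A j + vec_index ?B j"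
      using j carriers(5)[OF q] by (intro index_add_vec) auto
    also have "vec_index ?A j = vec_index (filt_A L q *\<^sub>v filt_state L x q) j - vec_index (filt_A L q *\<^sub>v filt_state L y q) j"
      unfolding state_diff(2) mult_minus_distrib_mat_vec[OF carriers(4)[OF q] state_carriers(2) state_carriers(2)]
      using j carriers(4)[OF q] by (intro index_minus_vec) auto
    finally show "vec_index ?l j = vec_index (?A + ?B) j"
      unfolding mult_mat_vec_column[OF carriers(5)[OF q] j] c_sum
      using j by (simp add: filt_state_def drift_def right_diff_distrib)
  qed (use carriers(5)[OF q] in \<open>auto simp: filt_state_def\<close>)
  note e = error_signal_carrier[OF q]
  show "ctrl_state L (\<lambda>c. drift x c - drift y c) q =
    ctrl_A L q *\<^sub>v ctrl_state L (\<lambda>c. x c - y c) q + ctrl_B L q *\<^sub>v (error_signal L x q - error_signal L y q)"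
    unfolding state_diff(3)[of x y] mult_minus_distrib_mat_vec[OF carriers(7)[OF q] state_carriers(3) state_carriers(3)]
      mult_minus_distrib_mat_vec[OF carriers(8)[OF q] e e]
    using carriers(7,8)[OF q]
    by (intro eq_vecI) (auto simp: ctrl_state_def drift_def next_ctrl_def)
qed

end

lemma (in stable_loop) contracting_norm:
  obtains N \<rho> where "0 < \<rho>" "\<rho> < 1" "seminorm_on S N" "\<And>z c. c \<in> S \<Longrightarrow> \<bar>z c\<bar> \<le> N z"
    "\<And>x y. N (\<lambda>c. drift x c - drift y c) \<le> \<rho> * N (\<lambda>c. x c - y c)"
proof -
  \<comment> \<open>Coordinate 0 is only a tag for its block, present even when the block has
    dimension 0. A single index set for all blocks yields a common rate and constant.\<close>
  define blocks where "blocks = (\<lambda>(q, i). Sys q i 0) ` J \<union> (\<lambda>q. Filt q 0) ` Q \<union> (\<lambda>q. Ctrl q 0) ` Q"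
  define bA where "bA c = (case c of Sys q i j \<Rightarrow> sys_A L q i | Filt q j \<Rightarrow> filt_A L q | Ctrl q j \<Rightarrow> ctrl_A L q)" for c
  define bn where "bn c = (case c of Sys q i j \<Rightarrow> sys_dim L q i | Filt q j \<Rightarrow> filt_dim L q | Ctrl q j \<Rightarrow> ctrl_dim L q)" for c
  have "finite blocks" by (simp add: blocks_def)
  moreover have "schur (bA c) \<and> bA c \<in> carrier_mat (bn c) (bn c)" if "c \<in> blocks" for c
    using that systems_schur filters_stable controllers_stable carriers(1,4,7)
    by (auto simp: blocks_def bA_def bn_def)
  ultimately have "\<exists>\<rho> C N. 0 < \<rho> \<and> \<rho> < 1 \<and> 0 \<le> C \<and> (\<forall>c\<in>blocks. contracts (bn c) (bA c) \<rho> C (N c))"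
    by (rule schur_contracts_uniform)
  then obtain \<rho> C N where \<rho>: "0 < \<rho>" "\<rho> < 1" and C: "0 \<le> C"
    and N: "\<And>c. c \<in> blocks \<Longrightarrow> contracts (bn c) (bA c) \<rho> C (N c)"
    by blast
  define Ns where "Ns q i = N (Sys q i 0)" for q i
  define Nf where "Nf q = N (Filt q 0)" for q
  define Nc where "Nc q = N (Ctrl q 0)" for q
  have Ns: "contracts (sys_dim L q i) (sys_A L q i) \<rho> C (Ns q i)" if "q \<in> Q" "i \<in> {1..sys_num L q}" for q i
  proof -
    have "Sys q i 0 \<in> blocks" using that by (force simp: blocks_def)
    from N[OF this] show ?thesis by (simp add: bA_def bn_def Ns_def)
  qed
  have Nf: "contracts (filt_dim L q) (filt_A L q) \<rho> C (Nf q)" if "q \<in> Q" for q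
    using N[of "Filt q 0"] that by (auto simp: blocks_def bA_def bn_def Nf_def)
  have Nc: "contracts (ctrl_dim L q) (ctrl_A L q) \<rho> C (Nc q)" if "q \<in> Q" for q
    using N[of "Ctrl q 0"] that by (auto simp: blocks_def bA_def bn_def Nc_def)
  define a where "a z = (\<Sum>q\<in>Q. \<Sum>i = 1..sys_num L q. Ns q i (sys_state L z q i))" for z
  define b where "b z = (\<Sum>q\<in>Q. Nf q (filt_state L z q))" for z
  define c where "c z = (\<Sum>q\<in>Q. Nc q (ctrl_state L z q))" for z
  have norms: "seminorm_on S a" "seminorm_on S b" "seminorm_on S c"
    unfolding a_def b_def c_def sys_state_def filt_state_def ctrl_state_def
    by (intro seminorm_on_sum finite_atLeastAtMost
        seminorm_on_block[OF Ns C finite_state_index _ block_subset(1)]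
        seminorm_on_block[OF Nf C finite_state_index _ block_subset(2)]
        seminorm_on_block[OF Nc C finite_state_index _ block_subset(3)]; simp add: inj_def)+
  have l1_sys: "l1 (sys_state L z q i) \<le> Ns q i (sys_state L z q i)" if "q \<in> Q" "i \<in> {1..sys_num L q}" for z q i
    using Ns[OF that] by (simp add: contracts_def)
  have l1_filt: "l1 (filt_state L z q) \<le> Nf q (filt_state L z q)" if "q \<in> Q" for z q
    using Nf[OF that] by (simp add: contracts_def)
  have l1_ctrl: "l1 (ctrl_state L z q) \<le> Nc q (ctrl_state L z q)" if "q \<in> Q" for z q
    using Nc[OF that] by (simp add: contracts_def)
  note pos = order_trans[OF l1_nonneg l1_sys] order_trans[OF l1_nonneg l1_filt] order_trans[OF l1_nonneg l1_ctrl]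
  have sys_le_a: "(\<Sum>i = 1..sys_num L q. Ns q i (sys_state L z q i)) \<le> a z" if "q \<in> Q" for q z
    unfolding a_def using that pos(1)
    by (intro member_le_sum[of q Q "\<lambda>q. \<Sum>i = 1..sys_num L q. Ns q i (sys_state L z q i)"] sum_nonneg) auto
  have a_contracts: "a (\<lambda>i. drift x i - drift y i) \<le> \<rho> * a (\<lambda>i. x i - y i)" for x y
    unfolding a_def sum_distrib_left
  proof (intro sum_mono)
    fix q i assume "q \<in> Q" "i \<in> {1..sys_num L q}"
    then show "Ns q i (sys_state L (\<lambda>c. drift x c - drift y c) q i) \<le> \<rho> * Ns q i (sys_state L (\<lambda>i. x i - y i) q i)"
      using Ns[of q i] by (simp only: drift_diff(1)) (simp add: contracts_def)
  qed
  have "\<exists>K\<ge>0. \<forall>x y. Nf q (filt_state L (\<lambda>i. drift x i - drift y i) q) \<le>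
      \<rho> * Nf q (filt_state L (\<lambda>i. x i - y i) q) + K * a (\<lambda>i. x i - y i)" if q: "q \<in> Q" for q
  proof -
    obtain K where K: "0 \<le> K" "\<And>v. v \<in> carrier_vec 1 \<Longrightarrow> l1 (filt_B L q *\<^sub>v v) \<le> K * l1 v"
      using l1_mult_mat_vec[OF carriers(5)[OF q]] by blast
    define M where "M = (\<Sum>i = 1..sys_num L q. l1 (sys_c L q i))"
    have M: "0 \<le> M" by (simp add: M_def sum_nonneg l1_nonneg)
    show ?thesis
    \<comment> \<open>\<open>M\<close> bounds the output vectors of the ensemble, \<open>K\<close>
      the filter input matrix, and \<open>C\<close> converts \<open>l1\<close> into the adapted
      norm.\<close>
    proof (intro exI[of _ "C * (K * M)"] conjI allI)
      show "0 \<le> C * (K * M)" using C K M by simp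
      fix x y :: state
      let ?d = "\<lambda>i. x i - y i"
      define s where "s = (\<Sum>i = 1..sys_num L q. scalar_prod (sys_c L q i) (sys_state L ?d q i))"
      have "\<bar>s\<bar> \<le> (\<Sum>i = 1..sys_num L q. M * Ns q i (sys_state L ?d q i))"
        unfolding s_def
      proof (rule order_trans[OF sum_abs sum_mono])
        fix i assume i: "i \<in> {1..sys_num L q}"
        have "dim_vec (sys_c L q i) = dim_vec (sys_state L ?d q i)"
          using carriers(2)[OF q i] by (simp add: sys_state_def)
        then have "\<bar>scalar_prod (sys_c L q i) (sys_state L ?d q i)\<bar> \<le> l1 (sys_c L q i) * l1 (sys_state L ?d q i)"
          by (rule abs_scalar_prod_le_l1)
        also have "\<dots> \<le> M * Ns q i (sys_state L ?d q i)"
          unfolding M_def using i q by (intro mult_mono member_le_sum l1_sys l1_nonneg sum_nonneg) auto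
        finally show "\<bar>scalar_prod (sys_c L q i) (sys_state L ?d q i)\<bar> \<le> M * Ns q i (sys_state L ?d q i)" .
      qed
      also have "\<dots> \<le> M * a ?d"
        unfolding sum_distrib_left[symmetric] by (intro mult_left_mono sys_le_a q M)
      finally have s: "\<bar>s\<bar> \<le> M * a ?d" .
      let ?B = "filt_B L q *\<^sub>v Matrix.vec 1 (\<lambda>_. s)"
      have B: "?B \<in> carrier_vec (filt_dim L q)" by (rule mult_mat_vec_carrier[OF carriers(5)[OF q]]) simp
      have A: "filt_A L q *\<^sub>v filt_state L ?d q \<in> carrier_vec (filt_dim L q)"
        by (rule mult_mat_vec_carrier[OF carriers(4)[OF q]]) simp
      have "Nf q (filt_state L (\<lambda>i. drift x i - drift y i) q) \<le> Nf q (filt_A L q *\<^sub>v filt_state L ?d q) + Nf q ?B"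
        unfolding drift_diff(2)[OF q] s_def[symmetric] using Nf[OF q] A B by (simp add: contracts_def)
      also have "\<dots> \<le> \<rho> * Nf q (filt_state L ?d q) + C * l1 ?B"
        using Nf[OF q] B by (intro add_mono) (simp_all add: contracts_def)
      also have "l1 ?B \<le> K * l1 (Matrix.vec 1 (\<lambda>_. s))" by (intro K) simp
      also have "l1 (Matrix.vec 1 (\<lambda>_. s)) = \<bar>s\<bar>" by (simp add: l1_def)
      also have "\<rho> * Nf q (filt_state L ?d q) + C * (K * \<bar>s\<bar>) \<le> \<rho> * Nf q (filt_state L ?d q) + C * (K * (M * a ?d))"
        using C K by (intro add_left_mono mult_left_mono s)
      finally show "Nf q (filt_state L (\<lambda>i. drift x i - drift y i) q) \<le>
          \<rho> * Nf q (filt_state L ?d q) + C * (K * M) * a ?d"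
        using C by (simp add: mult.assoc mult_left_mono)
    qed
  qed
  then obtain Kf where Kf: "\<And>q. q \<in> Q \<Longrightarrow> 0 \<le> Kf q"
    "\<And>q x y. q \<in> Q \<Longrightarrow> Nf q (filt_state L (\<lambda>i. drift x i - drift y i) q) \<le>
      \<rho> * Nf q (filt_state L (\<lambda>i. x i - y i) q) + Kf q * a (\<lambda>i. x i - y i)"
    by metis
  have b_contracts: "b (\<lambda>i. drift x i - drift y i) \<le> \<rho> * b (\<lambda>i. x i - y i) + (\<Sum>q\<in>Q. Kf q) * a (\<lambda>i. x i - y i)" for x y
    unfolding b_def sum_distrib_left sum_distrib_right sum.distrib[symmetric] by (intro sum_mono Kf)
  have "\<exists>K\<ge>0. \<forall>x y. Nc q (ctrl_state L (\<lambda>i. drift x i - drift y i) q) \<le>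
      \<rho> * Nc q (ctrl_state L (\<lambda>i. x i - y i) q) + K * b (\<lambda>i. x i - y i)" if q: "q \<in> Q" for q
  proof -
    obtain K where K: "0 \<le> K" "\<And>v. v \<in> carrier_vec (ctrl_in L q) \<Longrightarrow> l1 (ctrl_B L q *\<^sub>v v) \<le> K * l1 v"
      using l1_mult_mat_vec[OF carriers(8)[OF q]] by blast
    obtain M where M: "0 \<le> M" "\<And>x y. l1 (error_signal L x q - error_signal L y q) \<le>
        M * (\<Sum>q\<in>Q. l1 (filt_state L (\<lambda>c. x c - y c) q))"
      using error_signal_lipschitz[OF q] by blast
    show ?thesis
    \<comment> \<open>Here \<open>M\<close> is the Lipschitz constant of the error signal and
      \<open>K\<close> bounds the controller input matrix.\<close>
    proof (intro exI[of _ "C * (K * M)"] conjI allI)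
      show "0 \<le> C * (K * M)" using C K M by simp
      fix x y :: state
      let ?d = "\<lambda>i. x i - y i"
      let ?e = "error_signal L x q - error_signal L y q"
      let ?B = "ctrl_B L q *\<^sub>v ?e"
      have e: "?e \<in> carrier_vec (ctrl_in L q)" by (intro minus_carrier_vec error_signal_carrier q)
      have "(\<Sum>q\<in>Q. l1 (filt_state L ?d q)) \<le> b ?d" unfolding b_def by (intro sum_mono l1_filt)
      then have le: "l1 ?e \<le> M * b ?d"
        using M by (intro order_trans[OF M(2)] mult_left_mono) auto
      have B: "?B \<in> carrier_vec (ctrl_dim L q)" by (rule mult_mat_vec_carrier[OF carriers(8)[OF q] e])
      have A: "ctrl_A L q *\<^sub>v ctrl_state L ?d q \<in> carrier_vec (ctrl_dim L q)"
        by (rule mult_mat_vec_carrier[OF carriers(7)[OF q]]) simp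
      have "Nc q (ctrl_state L (\<lambda>i. drift x i - drift y i) q) \<le> Nc q (ctrl_A L q *\<^sub>v ctrl_state L ?d q) + Nc q ?B"
        unfolding drift_diff(3)[OF q] using Nc[OF q] A B by (simp add: contracts_def)
      also have "\<dots> \<le> \<rho> * Nc q (ctrl_state L ?d q) + C * l1 ?B"
        using Nc[OF q] B by (intro add_mono) (simp_all add: contracts_def)
      also have "\<dots> \<le> \<rho> * Nc q (ctrl_state L ?d q) + C * (K * (M * b ?d))"
        using C K e le by (intro add_left_mono mult_left_mono order_trans[OF K(2)]) auto
      finally show "Nc q (ctrl_state L (\<lambda>i. drift x i - drift y i) q) \<le>
          \<rho> * Nc q (ctrl_state L ?d q) + C * (K * M) * b ?d"
        by (simp add: mult.assoc)
    qed
  qed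
  then obtain Kc where Kc: "\<And>q. q \<in> Q \<Longrightarrow> 0 \<le> Kc q"
    "\<And>q x y. q \<in> Q \<Longrightarrow> Nc q (ctrl_state L (\<lambda>i. drift x i - drift y i) q) \<le>
      \<rho> * Nc q (ctrl_state L (\<lambda>i. x i - y i) q) + Kc q * b (\<lambda>i. x i - y i)"
    by metis
  have c_contracts: "c (\<lambda>i. drift x i - drift y i) \<le> \<rho> * c (\<lambda>i. x i - y i) + (\<Sum>q\<in>Q. Kc q) * b (\<lambda>i. x i - y i)" for x y
    unfolding c_def sum_distrib_left sum_distrib_right sum.distrib[symmetric] by (intro sum_mono Kc)
  have "0 \<le> (\<Sum>q\<in>Q. Kf q)" "0 \<le> (\<Sum>q\<in>Q. Kc q)" by (intro sum_nonneg Kf Kc; assumption)+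
  note stages = this
  obtain N' \<rho>' where N': "0 < \<rho>'" "\<rho>' < 1" "seminorm_on S N'" "\<And>z. a z + b z + c z \<le> N' z"
    "\<And>x y. N' (\<lambda>i. drift x i - drift y i) \<le> \<rho>' * N' (\<lambda>i. x i - y i)"
    by (rule cascade_contraction[where H = drift, OF norms \<rho> stages a_contracts b_contracts c_contracts]) (rule that)
  have nonneg: "0 \<le> a z" "0 \<le> b z" "0 \<le> c z" for z using norms by (simp_all add: seminorm_on_def)
  have "\<bar>z k\<bar> \<le> N' z" if "k \<in> S" for z k
  proof -
    have "\<bar>z k\<bar> \<le> a z + b z + c z"
    proof -
      from that consider (Sys) q i j where "k = Sys q i j" "q \<in> Q" "i \<in> {1..sys_num L q}" "j < sys_dim L q i"
        | (Filt) q j where "k = Filt q j" "q \<in> Q" "j < filt_dim L q"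
        | (Ctrl) q j where "k = Ctrl q j" "q \<in> Q" "j < ctrl_dim L q"
        by (auto simp: state_index_def)
      then show ?thesis
      proof cases
        case Sys
        have "\<bar>z k\<bar> \<le> l1 (sys_state L z q i)"
          using abs_index_le_l1[of j "sys_state L z q i"] Sys by (simp add: sys_state_def)
        also have "\<dots> \<le> Ns q i (sys_state L z q i)" using Sys by (intro l1_sys)
        also have "\<dots> \<le> (\<Sum>i = 1..sys_num L q. Ns q i (sys_state L z q i))"
          using Sys pos(1) by (intro member_le_sum[of i _ "\<lambda>i. Ns q i (sys_state L z q i)"]) auto
        also have "\<dots> \<le> a z" using Sys by (intro sys_le_a)
        finally show ?thesis using nonneg[of z] by linarith
      next
        case Filt
        have "\<bar>z k\<bar> \<le> l1 (filt_state L z q)"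
          using abs_index_le_l1[of j "filt_state L z q"] Filt by (simp add: filt_state_def)
        also have "\<dots> \<le> Nf q (filt_state L z q)" using Filt by (intro l1_filt)
        also have "\<dots> \<le> b z"
          unfolding b_def using Filt pos(2) by (intro member_le_sum[of q _ "\<lambda>q. Nf q (filt_state L z q)"]) auto
        finally show ?thesis using nonneg[of z] by linarith
      next
        case Ctrl
        have "\<bar>z k\<bar> \<le> l1 (ctrl_state L z q)"
          using abs_index_le_l1[of j "ctrl_state L z q"] Ctrl by (simp add: ctrl_state_def)
        also have "\<dots> \<le> Nc q (ctrl_state L z q)" using Ctrl by (intro l1_ctrl)
        also have "\<dots> \<le> c z"
          unfolding c_def using Ctrl pos(3) by (intro member_le_sum[of q _ "\<lambda>q. Nc q (ctrl_state L z q)"]) auto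
        finally show ?thesis using nonneg[of z] by linarith
      qed
    qed
    then show ?thesis using N'(4)[of z] by linarith
  qed
  then show ?thesis using N' by (intro that[of \<rho>' N'])
qed

section \<open>The random choices and their probabilities\<close>

lemma PiE_dflt_mono: "(\<And>k. k \<in> A \<Longrightarrow> B k \<subseteq> B' k) \<Longrightarrow> PiE_dflt A d B \<subseteq> PiE_dflt A d B'"
  by (auto simp: PiE_dflt_def)

text \<open>Admissibility is assumed at every state, so the choice probabilities are genuine
  distributions throughout and any two states can be compared.\<close>

locale controlled_loop = stable_loop +
  assumes control_admissible: "\<And>q \<xi>. q \<in> {1..ens_num L} \<Longrightarrow> \<xi> \<in> space (state_space L) \<Longrightarrow>
      control_signal L \<xi> q \<in> admissible L q"
    and b_range: "\<And>q i j s. q \<in> {1..ens_num L} \<Longrightarrow> i \<in> {1..sys_num L q} \<Longrightarrow> j \<in> {1..b_num L q i} \<Longrightarrow>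
      s \<in> admissible L q \<Longrightarrow> b_prob L q i j s \<in> {0..1}"
    and d_range: "\<And>q i l s. q \<in> {1..ens_num L} \<Longrightarrow> i \<in> {1..sys_num L q} \<Longrightarrow> l \<in> {1..d_num L q i} \<Longrightarrow>
      s \<in> admissible L q \<Longrightarrow> d_prob L q i l s \<in> {0..1}"
    and b_dini: "\<And>q i j. q \<in> {1..ens_num L} \<Longrightarrow> i \<in> {1..sys_num L q} \<Longrightarrow> j \<in> {1..b_num L q i} \<Longrightarrow>
      dini_continuous_on (admissible L q) (b_prob L q i j)"
    and d_dini: "\<And>q i l. q \<in> {1..ens_num L} \<Longrightarrow> i \<in> {1..sys_num L q} \<Longrightarrow> l \<in> {1..d_num L q i} \<Longrightarrow>
      dini_continuous_on (admissible L q) (d_prob L q i l)"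
    and b_sum: "\<And>q i s. q \<in> {1..ens_num L} \<Longrightarrow> i \<in> {1..sys_num L q} \<Longrightarrow> s \<in> admissible L q \<Longrightarrow>
      (\<Sum>j = 1..b_num L q i. b_prob L q i j s) = 1"
    and d_sum: "\<And>q i s. q \<in> {1..ens_num L} \<Longrightarrow> i \<in> {1..sys_num L q} \<Longrightarrow> s \<in> admissible L q \<Longrightarrow>
      (\<Sum>l = 1..d_num L q i. d_prob L q i l s) = 1"
    and b_lower: "\<And>q i j. q \<in> {1..ens_num L} \<Longrightarrow> i \<in> {1..sys_num L q} \<Longrightarrow> j \<in> {1..b_num L q i} \<Longrightarrow>
      \<exists>\<delta>>0. \<forall>s\<in>admissible L q. \<delta> \<le> b_prob L q i j s"
    and d_lower: "\<And>q i l. q \<in> {1..ens_num L} \<Longrightarrow> i \<in> {1..sys_num L q} \<Longrightarrow> l \<in> {1..d_num L q i} \<Longrightarrow>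
      \<exists>\<delta>>0. \<forall>s\<in>admissible L q. \<delta> \<le> d_prob L q i l s"
begin

abbreviation "E \<equiv> extensional S :: state set"

lemma space_state_space: "space (state_space L) = E"
  by (simp add: state_space_def space_PiM PiE_def)

text \<open>Outside the index set a choice takes the default value of \<open>Pi_pmf\<close>, which
  makes the set finite and the product formula for probabilities exact.\<close>

definition Sig :: "choices set" where
  "Sig = PiE_dflt J undefined (\<lambda>(q, i). {1..b_num L q i} \<times> {1..d_num L q i})"

definition weight :: "state \<Rightarrow> nat \<times> nat \<Rightarrow> nat \<times> nat \<Rightarrow> real" where
  "weight x = (\<lambda>(q, i) (j, l). b_prob L q i j (control_signal L x q) * d_prob L q i l (control_signal L x q))"

lemma finite_Sig: "finite Sig"
  unfolding Sig_def by (intro finite_PiE_dflt) auto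

lemma Sig_in:
  assumes "\<sigma> \<in> Sig" "q \<in> Q" "i \<in> {1..sys_num L q}"
  shows "fst (\<sigma> (q, i)) \<in> {1..b_num L q i}" "snd (\<sigma> (q, i)) \<in> {1..d_num L q i}"
proof -
  have "\<sigma> (q, i) \<in> {1..b_num L q i} \<times> {1..d_num L q i}"
    using assms unfolding Sig_def PiE_dflt_def by fastforce
  then show "fst (\<sigma> (q, i)) \<in> {1..b_num L q i}" "snd (\<sigma> (q, i)) \<in> {1..d_num L q i}"
    by (simp_all only: mem_Times_iff)
qed

lemma admissible_signal: "q \<in> Q \<Longrightarrow> x \<in> E \<Longrightarrow> control_signal L x q \<in> admissible L q"
  using control_admissible by (simp add: space_state_space)

lemma pmf_choice_components:
  assumes x: "x \<in> E" and q: "q \<in> Q" and i: "i \<in> {1..sys_num L q}"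
  shows "pmf (index_pmf (b_num L q i) (\<lambda>j. b_prob L q i j (control_signal L x q))) j =
      (if j \<in> {1..b_num L q i} then b_prob L q i j (control_signal L x q) else 0)"
    and "pmf (index_pmf (d_num L q i) (\<lambda>l. d_prob L q i l (control_signal L x q))) l =
      (if l \<in> {1..d_num L q i} then d_prob L q i l (control_signal L x q) else 0)"
proof -
  note s = admissible_signal[OF q x]
  show "pmf (index_pmf (b_num L q i) (\<lambda>j. b_prob L q i j (control_signal L x q))) j =
      (if j \<in> {1..b_num L q i} then b_prob L q i j (control_signal L x q) else 0)"
    using b_range[OF q i _ s] b_sum[OF q i s] by (intro pmf_index_pmf) auto
  show "pmf (index_pmf (d_num L q i) (\<lambda>l. d_prob L q i l (control_signal L x q))) l =
      (if l \<in> {1..d_num L q i} then d_prob L q i l (control_signal L x q) else 0)"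
    using d_range[OF q i _ s] d_sum[OF q i s] by (intro pmf_index_pmf) auto
qed

lemma pmf_choice:
  assumes x: "x \<in> E" and \<sigma>: "\<sigma> \<in> Sig"
  shows "pmf (choice_pmf L x) \<sigma> = (\<Prod>k\<in>J. weight x k (\<sigma> k))"
proof -
  have "pmf (choice_pmf L x) \<sigma> = (\<Prod>k\<in>J. pmf ((\<lambda>(q, i). pair_pmf
          (index_pmf (b_num L q i) (\<lambda>j. b_prob L q i j (control_signal L x q)))
          (index_pmf (d_num L q i) (\<lambda>l. d_prob L q i l (control_signal L x q)))) k) (\<sigma> k))"
    unfolding choice_pmf_def
  proof (rule pmf_Pi')
    show "\<sigma> k = undefined" if "k \<notin> J" for k
      using \<sigma> that unfolding Sig_def PiE_dflt_def by blast
  qed auto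
  also have "\<dots> = (\<Prod>k\<in>J. weight x k (\<sigma> k))"
  proof (rule prod.cong[OF refl])
    fix k assume "k \<in> J"
    then obtain q i where k: "k = (q, i)" "q \<in> Q" "i \<in> {1..sys_num L q}" by blast
    obtain j l where jl: "\<sigma> (q, i) = (j, l)" by (cases "\<sigma> (q, i)")
    have "j \<in> {1..b_num L q i}" "l \<in> {1..d_num L q i}" using Sig_in[OF \<sigma> k(2,3)] jl by simp_all
    then show "pmf ((\<lambda>(q, i). pair_pmf
          (index_pmf (b_num L q i) (\<lambda>j. b_prob L q i j (control_signal L x q)))
          (index_pmf (d_num L q i) (\<lambda>l. d_prob L q i l (control_signal L x q)))) k) (\<sigma> k) = weight x k (\<sigma> k)"
      unfolding k(1) prod.case jl pmf_pair pmf_choice_components[OF x k(2,3)] weight_def by (simp only: if_True)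
  qed
  finally show ?thesis .
qed

lemma set_pmf_choice:
  assumes x: "x \<in> E"
  shows "set_pmf (choice_pmf L x) \<subseteq> Sig"
proof -
  have sub: "set_pmf (index_pmf (b_num L q i) (\<lambda>j. b_prob L q i j (control_signal L x q))) \<subseteq> {1..b_num L q i}"
    "set_pmf (index_pmf (d_num L q i) (\<lambda>l. d_prob L q i l (control_signal L x q))) \<subseteq> {1..d_num L q i}"
    if "q \<in> Q" "i \<in> {1..sys_num L q}" for q i
    unfolding set_pmf_eq pmf_choice_components[OF x that] by (auto split: if_splits)
  let ?p = "\<lambda>(q, i). pair_pmf
          (index_pmf (b_num L q i) (\<lambda>j. b_prob L q i j (control_signal L x q)))
          (index_pmf (d_num L q i) (\<lambda>l. d_prob L q i l (control_signal L x q)))"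
  have "(set_pmf \<circ> ?p) k \<subseteq> (\<lambda>(q, i). {1..b_num L q i} \<times> {1..d_num L q i}) k" if "k \<in> J" for k
  proof -
    obtain q i where k: "k = (q, i)" "q \<in> Q" "i \<in> {1..sys_num L q}"
      using \<open>k \<in> J\<close> by blast
    show ?thesis unfolding k(1) comp_def prod.case set_pair_pmf by (rule Sigma_mono[OF sub[OF k(2,3)]])
  qed
  then have "PiE_dflt J undefined (set_pmf \<circ> ?p) \<subseteq> Sig"
    unfolding Sig_def by (rule PiE_dflt_mono)
  moreover have "set_pmf (choice_pmf L x) \<subseteq> PiE_dflt J undefined (set_pmf \<circ> ?p)"
    unfolding choice_pmf_def by (rule set_Pi_pmf_subset') auto
  ultimately show ?thesis by blast
qed

text \<open>The affine form of the update holds on \<open>Sig\<close>, which carries the choice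
  distribution, and almost sure equality of the maps suffices for equal image measures.\<close>

lemma transition_kernel_eq:
  assumes x: "x \<in> E"
  shows "transition_kernel L x = distr (measure_pmf (choice_pmf L x)) (\<Pi>\<^sub>M c\<in>S. borel) (\<lambda>\<sigma>. \<lambda>c\<in>S. drift x c + offset \<sigma> c)"
  unfolding transition_kernel_def state_space_def
proof (rule distr_cong_AE)
  show "AE \<sigma> in measure_pmf (choice_pmf L x). next_state L x \<sigma> = (\<lambda>c\<in>S. drift x c + offset \<sigma> c)"
  proof (rule AE_pmfI)
    fix \<sigma> assume "\<sigma> \<in> set_pmf (choice_pmf L x)"
    then have "\<sigma> \<in> Sig" using set_pmf_choice[OF x] by blast
    then show "next_state L x \<sigma> = (\<lambda>c\<in>S. drift x c + offset \<sigma> c)"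
      using Sig_in(1) by (intro next_state_eq) blast
  qed
qed (auto simp: space_PiM next_state_def)

text \<open>By independence a joint choice has a product probability, bounded below by the product
  of the individual bounds; \<open>Sig\<close> is finite, so a minimum over it remains
  positive.\<close>

lemma choice_minorized:
  obtains \<delta> where "0 < \<delta>" "\<And>x \<sigma>. x \<in> E \<Longrightarrow> \<sigma> \<in> Sig \<Longrightarrow> \<delta> \<le> pmf (choice_pmf L x) \<sigma>"
proof -
  have "\<forall>q i j. \<exists>\<delta>. q \<in> Q \<longrightarrow> i \<in> {1..sys_num L q} \<longrightarrow> j \<in> {1..b_num L q i} \<longrightarrow>
      0 < \<delta> \<and> (\<forall>s\<in>admissible L q. \<delta> \<le> b_prob L q i j s)"
    using b_lower by meson
  then obtain \<delta>b where \<delta>b: "\<And>q i j. q \<in> Q \<Longrightarrow> i \<in> {1..sys_num L q} \<Longrightarrow> j \<in> {1..b_num L q i} \<Longrightarrow>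
      0 < \<delta>b q i j \<and> (\<forall>s\<in>admissible L q. \<delta>b q i j \<le> b_prob L q i j s)"
    by metis
  have "\<forall>q i l. \<exists>\<delta>. q \<in> Q \<longrightarrow> i \<in> {1..sys_num L q} \<longrightarrow> l \<in> {1..d_num L q i} \<longrightarrow>
      0 < \<delta> \<and> (\<forall>s\<in>admissible L q. \<delta> \<le> d_prob L q i l s)"
    using d_lower by meson
  then obtain \<delta>d where \<delta>d: "\<And>q i l. q \<in> Q \<Longrightarrow> i \<in> {1..sys_num L q} \<Longrightarrow> l \<in> {1..d_num L q i} \<Longrightarrow>
      0 < \<delta>d q i l \<and> (\<forall>s\<in>admissible L q. \<delta>d q i l \<le> d_prob L q i l s)"
    by metis
  define m where "m \<sigma> = (\<Prod>(q, i)\<in>J. \<delta>b q i (fst (\<sigma> (q, i))) * \<delta>d q i (snd (\<sigma> (q, i))))" for \<sigma> :: choices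
  have m_pos: "0 < m \<sigma>" if \<sigma>: "\<sigma> \<in> Sig" for \<sigma>
    unfolding m_def
  proof (rule prod_pos, clarify)
    fix q i assume "q \<in> Q" "i \<in> {1..sys_num L q}"
    then show "0 < \<delta>b q i (fst (\<sigma> (q, i))) * \<delta>d q i (snd (\<sigma> (q, i)))"
      using \<delta>b \<delta>d Sig_in[OF \<sigma>] by (meson mult_pos_pos)
  qed
  have m_le: "m \<sigma> \<le> pmf (choice_pmf L x) \<sigma>" if x: "x \<in> E" and \<sigma>: "\<sigma> \<in> Sig" for x \<sigma>
    unfolding pmf_choice[OF that] m_def
  proof (rule prod_mono, clarify)
    fix q i assume qi: "q \<in> Q" "i \<in> {1..sys_num L q}"
    note in' = Sig_in[OF \<sigma> qi]
    have b: "0 < \<delta>b q i (fst (\<sigma> (q, i)))" "\<delta>b q i (fst (\<sigma> (q, i))) \<le> b_prob L q i (fst (\<sigma> (q, i))) (control_signal L x q)"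
      using \<delta>b[OF qi in'(1)] admissible_signal[OF qi(1) x] by blast+
    have d: "0 < \<delta>d q i (snd (\<sigma> (q, i)))" "\<delta>d q i (snd (\<sigma> (q, i))) \<le> d_prob L q i (snd (\<sigma> (q, i))) (control_signal L x q)"
      using \<delta>d[OF qi in'(2)] admissible_signal[OF qi(1) x] by blast+
    have "weight x (q, i) (\<sigma> (q, i)) = b_prob L q i (fst (\<sigma> (q, i))) (control_signal L x q) *
        d_prob L q i (snd (\<sigma> (q, i))) (control_signal L x q)"
      by (simp add: weight_def case_prod_beta)
    then show "0 \<le> \<delta>b q i (fst (\<sigma> (q, i))) * \<delta>d q i (snd (\<sigma> (q, i))) \<and>
        \<delta>b q i (fst (\<sigma> (q, i))) * \<delta>d q i (snd (\<sigma> (q, i))) \<le> weight x (q, i) (\<sigma> (q, i))"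
      using b d by (auto intro!: mult_mono)
  qed
  show ?thesis
  proof (rule that)
    show "0 < Min (insert 1 (m ` Sig))" using finite_Sig m_pos by simp
    fix x \<sigma> assume "x \<in> E" "\<sigma> \<in> Sig"
    then have "Min (insert 1 (m ` Sig)) \<le> m \<sigma>" using finite_Sig by (intro Min_le) auto
    then show "Min (insert 1 (m ` Sig)) \<le> pmf (choice_pmf L x) \<sigma>"
      using m_le[OF \<open>x \<in> E\<close> \<open>\<sigma> \<in> Sig\<close>] by linarith
  qed
qed

text \<open>Products of factors bounded by 1 differ by at most the sum of the differences of the
  factors. Each factor depends on the state through a signal that is Lipschitz in \<open>N\<close>,
  so its difference is bounded by Dini moduli at a rescaled distance.\<close>

lemma choice_variation:
  assumes N: "\<And>z. 0 \<le> N z" "\<And>z c. c \<in> S \<Longrightarrow> \<bar>z c\<bar> \<le> N z"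
  obtains \<eta> :: "real \<Rightarrow> real" where "\<And>t. 0 \<le> \<eta> t" "\<And>t t'. t \<le> t' \<Longrightarrow> \<eta> t \<le> \<eta> t'"
    "\<And>\<rho> t. 0 < \<rho> \<Longrightarrow> \<rho> < 1 \<Longrightarrow> 0 \<le> t \<Longrightarrow> summable (\<lambda>n. \<eta> (\<rho> ^ n * t))"
    "\<And>x y. x \<in> E \<Longrightarrow> y \<in> E \<Longrightarrow>
      (\<Sum>\<sigma>\<in>Sig. \<bar>pmf (choice_pmf L x) \<sigma> - pmf (choice_pmf L y) \<sigma>\<bar>) \<le> \<eta> (N (\<lambda>c. x c - y c))"
proof -
  have "\<exists>\<omega>. q \<in> Q \<longrightarrow> i \<in> {1..sys_num L q} \<longrightarrow> j \<in> {1..b_num L q i} \<longrightarrow>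
      dini_modulus (admissible L q) (b_prob L q i j) \<omega>" for q i j
    using dini_continuous_modulus[OF b_dini b_range] by blast
  then obtain \<omega>b where \<omega>b: "\<And>q i j. q \<in> Q \<Longrightarrow> i \<in> {1..sys_num L q} \<Longrightarrow> j \<in> {1..b_num L q i} \<Longrightarrow>
      dini_modulus (admissible L q) (b_prob L q i j) (\<omega>b q i j)"
    by metis
  have "\<exists>\<omega>. q \<in> Q \<longrightarrow> i \<in> {1..sys_num L q} \<longrightarrow> l \<in> {1..d_num L q i} \<longrightarrow>
      dini_modulus (admissible L q) (d_prob L q i l) \<omega>" for q i l
    using dini_continuous_modulus[OF d_dini d_range] by blast
  then obtain \<omega>d where \<omega>d: "\<And>q i l. q \<in> Q \<Longrightarrow> i \<in> {1..sys_num L q} \<Longrightarrow> l \<in> {1..d_num L q i} \<Longrightarrow>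
      dini_modulus (admissible L q) (d_prob L q i l) (\<omega>d q i l)"
    by metis
  obtain K where K: "\<And>q. q \<in> Q \<Longrightarrow> 0 \<le> K q"
    "\<And>q x y. q \<in> Q \<Longrightarrow> \<bar>control_signal L x q - control_signal L y q\<bar> \<le> K q * (\<Sum>c\<in>S. \<bar>x c - y c\<bar>)"
    using control_signal_lipschitz by metis
  \<comment> \<open>One Lipschitz constant for all signals; the number of coordinates appears
    because \<open>N\<close> bounds each coordinate separately.\<close>
  define M where "M = (\<Sum>q\<in>Q. K q) * real (card S)"
  have M: "0 \<le> M" unfolding M_def by (intro mult_nonneg_nonneg sum_nonneg K) auto
  have signal: "\<bar>control_signal L x q - control_signal L y q\<bar> \<le> M * N (\<lambda>c. x c - y c)" if q: "q \<in> Q" for q x y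
  proof -
    have "(\<Sum>c\<in>S. \<bar>x c - y c\<bar>) \<le> (\<Sum>c\<in>S. N (\<lambda>c. x c - y c))"
      using N(2)[of _ "\<lambda>c. x c - y c"] by (intro sum_mono)
    then have sum: "(\<Sum>c\<in>S. \<bar>x c - y c\<bar>) \<le> real (card S) * N (\<lambda>c. x c - y c)" by simp
    have "K q \<le> (\<Sum>q\<in>Q. K q)" using q K by (intro member_le_sum) auto
    then have "K q * (\<Sum>c\<in>S. \<bar>x c - y c\<bar>) \<le> (\<Sum>q\<in>Q. K q) * (real (card S) * N (\<lambda>c. x c - y c))"
      using K by (intro mult_mono sum sum_nonneg) auto
    then show ?thesis using K(2)[OF q, of x y] by (simp add: M_def mult.assoc)
  qed
  \<comment> \<open>Summing the moduli over all alternatives, not just the chosen ones, makes the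
    bound independent of the joint choice.\<close>
  define G where "G t = (\<Sum>k\<in>J. (\<Sum>j = 1..b_num L (fst k) (snd k). \<omega>b (fst k) (snd k) j (M * t)) +
      (\<Sum>l = 1..d_num L (fst k) (snd k). \<omega>d (fst k) (snd k) l (M * t)))" for t
  have J: "fst k \<in> Q" "snd k \<in> {1..sys_num L (fst k)}" if "k \<in> J" for k
    using that by auto
  have pos: "0 \<le> \<omega>b (fst k) (snd k) j t" if "k \<in> J" "j \<in> {1..b_num L (fst k) (snd k)}" for k j t
    using \<omega>b[OF J[OF that(1)] that(2)] by (simp add: dini_modulus_def)
  have pos': "0 \<le> \<omega>d (fst k) (snd k) l t" if "k \<in> J" "l \<in> {1..d_num L (fst k) (snd k)}" for k l t
    using \<omega>d[OF J[OF that(1)] that(2)] by (simp add: dini_modulus_def)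
  have mono: "\<omega>b (fst k) (snd k) j t \<le> \<omega>b (fst k) (snd k) j t'"
    if "k \<in> J" "j \<in> {1..b_num L (fst k) (snd k)}" "t \<le> t'" for k j t t'
    using \<omega>b[OF J[OF that(1)] that(2)] that(3) by (simp add: dini_modulus_def)
  have mono': "\<omega>d (fst k) (snd k) l t \<le> \<omega>d (fst k) (snd k) l t'"
    if "k \<in> J" "l \<in> {1..d_num L (fst k) (snd k)}" "t \<le> t'" for k l t t'
    using \<omega>d[OF J[OF that(1)] that(2)] that(3) by (simp add: dini_modulus_def)
  have diff: "\<bar>weight x k (\<sigma> k) - weight y k (\<sigma> k)\<bar> \<le>
      (\<Sum>j = 1..b_num L (fst k) (snd k). \<omega>b (fst k) (snd k) j (M * N (\<lambda>c. x c - y c))) +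
      (\<Sum>l = 1..d_num L (fst k) (snd k). \<omega>d (fst k) (snd k) l (M * N (\<lambda>c. x c - y c)))"
    and weight_range: "\<bar>weight x k (\<sigma> k)\<bar> \<le> 1"
    if x: "x \<in> E" and y: "y \<in> E" and \<sigma>: "\<sigma> \<in> Sig" and k: "k \<in> J" for x y \<sigma> k
  proof -
    obtain q i where qi: "k = (q, i)" "q \<in> Q" "i \<in> {1..sys_num L q}" using k by blast
    obtain j l where jl: "\<sigma> (q, i) = (j, l)" by (cases "\<sigma> (q, i)")
    have j: "j \<in> {1..b_num L q i}" and l: "l \<in> {1..d_num L q i}"
      using Sig_in[OF \<sigma> qi(2,3)] jl by simp_all
    define sx sy where "sx = control_signal L x q" and "sy = control_signal L y q"
    have s: "sx \<in> admissible L q" "sy \<in> admissible L q"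
      using admissible_signal qi x y by (auto simp: sx_def sy_def)
    have w: "weight x k (\<sigma> k) = b_prob L q i j sx * d_prob L q i l sx"
      "weight y k (\<sigma> k) = b_prob L q i j sy * d_prob L q i l sy"
      by (simp_all add: weight_def qi jl sx_def sy_def)
    have b: "b_prob L q i j sx \<in> {0..1}" "b_prob L q i j sy \<in> {0..1}"
      using b_range[OF qi(2,3) j] s by blast+
    have d: "d_prob L q i l sx \<in> {0..1}" "d_prob L q i l sy \<in> {0..1}"
      using d_range[OF qi(2,3) l] s by blast+
    show "\<bar>weight x k (\<sigma> k)\<bar> \<le> 1"
      unfolding w using b d by (simp add: abs_mult mult_le_one)
    let ?t = "M * N (\<lambda>c. x c - y c)"
    have t: "\<bar>sx - sy\<bar> \<le> ?t" using signal[OF qi(2)] by (simp add: sx_def sy_def)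
    have "\<bar>b_prob L q i j sx - b_prob L q i j sy\<bar> \<le> \<omega>b q i j \<bar>sx - sy\<bar>"
      using \<omega>b[OF qi(2,3) j] s by (simp add: dini_modulus_def)
    also have "\<dots> \<le> \<omega>b q i j ?t" using mono[OF k, of j, OF _ t] j by (simp add: qi)
    also have "\<dots> \<le> (\<Sum>j = 1..b_num L q i. \<omega>b q i j ?t)"
      using j pos[OF k] by (intro member_le_sum) (auto simp: qi)
    finally have bb: "\<bar>b_prob L q i j sx - b_prob L q i j sy\<bar> \<le> (\<Sum>j = 1..b_num L q i. \<omega>b q i j ?t)" .
    have "\<bar>d_prob L q i l sx - d_prob L q i l sy\<bar> \<le> \<omega>d q i l \<bar>sx - sy\<bar>"
      using \<omega>d[OF qi(2,3) l] s by (simp add: dini_modulus_def)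
    also have "\<dots> \<le> \<omega>d q i l ?t" using mono'[OF k, of l, OF _ t] l by (simp add: qi)
    also have "\<dots> \<le> (\<Sum>l = 1..d_num L q i. \<omega>d q i l ?t)"
      using l pos'[OF k] by (intro member_le_sum) (auto simp: qi)
    finally have dd: "\<bar>d_prob L q i l sx - d_prob L q i l sy\<bar> \<le> (\<Sum>l = 1..d_num L q i. \<omega>d q i l ?t)" .
    have "weight x k (\<sigma> k) - weight y k (\<sigma> k) =
        (b_prob L q i j sx - b_prob L q i j sy) * d_prob L q i l sx + b_prob L q i j sy * (d_prob L q i l sx - d_prob L q i l sy)"
      unfolding w by (simp add: algebra_simps)
    then have "\<bar>weight x k (\<sigma> k) - weight y k (\<sigma> k)\<bar> \<le>
        \<bar>b_prob L q i j sx - b_prob L q i j sy\<bar> * \<bar>d_prob L q i l sx\<bar> + \<bar>b_prob L q i j sy\<bar> * \<bar>d_prob L q i l sx - d_prob L q i l sy\<bar>"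
      by (simp only: abs_mult[symmetric] abs_triangle_ineq)
    also have "\<dots> \<le> \<bar>b_prob L q i j sx - b_prob L q i j sy\<bar> + \<bar>d_prob L q i l sx - d_prob L q i l sy\<bar>"
      using b d by (intro add_mono mult_right_le_one_le mult_left_le_one_le) auto
    finally show "\<bar>weight x k (\<sigma> k) - weight y k (\<sigma> k)\<bar> \<le>
        (\<Sum>j = 1..b_num L (fst k) (snd k). \<omega>b (fst k) (snd k) j ?t) +
        (\<Sum>l = 1..d_num L (fst k) (snd k). \<omega>d (fst k) (snd k) l ?t)"
      unfolding qi(1) fst_conv snd_conv using bb dd by linarith
  qed
  show ?thesis
  proof (rule that[of "\<lambda>t. real (card Sig) * G t"])
    show "0 \<le> real (card Sig) * G t" for t
      unfolding G_def by (intro mult_nonneg_nonneg add_nonneg_nonneg sum_nonneg pos pos') auto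
    show "real (card Sig) * G t \<le> real (card Sig) * G t'" if "t \<le> t'" for t t'
      unfolding G_def using that M
      by (intro mult_left_mono add_mono sum_mono mono mono') auto
    show "summable (\<lambda>n. real (card Sig) * G (\<rho> ^ n * t))" if \<rho>: "0 < \<rho>" "\<rho> < 1" and t: "0 \<le> t" for \<rho> t
    proof -
      \<comment> \<open>Rescaling by \<open>M\<close> only changes the starting scale of the
        geometric sequence, and \<open>dini_modulus\<close> covers every starting scale.\<close>
      have Mt: "M * (\<rho> ^ n * t) = \<rho> ^ n * (M * t)" for n by simp
      have Mt0: "0 \<le> M * t" using M t by simp
      have "summable (\<lambda>n. \<omega>b (fst k) (snd k) j (\<rho> ^ n * (M * t)))" if "k \<in> J" "j \<in> {1..b_num L (fst k) (snd k)}" for k j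
        using \<omega>b[OF J[OF that(1)] that(2)] \<rho> Mt0 unfolding dini_modulus_def by blast
      moreover have "summable (\<lambda>n. \<omega>d (fst k) (snd k) l (\<rho> ^ n * (M * t)))" if "k \<in> J" "l \<in> {1..d_num L (fst k) (snd k)}" for k l
        using \<omega>d[OF J[OF that(1)] that(2)] \<rho> Mt0 unfolding dini_modulus_def by blast
      ultimately show ?thesis
        unfolding G_def Mt by (intro summable_mult summable_sum summable_add)
    qed
    fix x y assume xy: "x \<in> E" "y \<in> E"
    have "\<bar>pmf (choice_pmf L x) \<sigma> - pmf (choice_pmf L y) \<sigma>\<bar> \<le> G (N (\<lambda>c. x c - y c))" if \<sigma>: "\<sigma> \<in> Sig" for \<sigma>
    proof -
      have "norm ((\<Prod>k\<in>J. weight x k (\<sigma> k)) - (\<Prod>k\<in>J. weight y k (\<sigma> k))) \<le>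
          (\<Sum>k\<in>J. norm (weight x k (\<sigma> k) - weight y k (\<sigma> k)))"
        using weight_range[OF xy \<sigma>] weight_range[OF xy(2,1) \<sigma>]
        by (intro norm_prod_diff) (simp_all only: real_norm_def)
      also have "\<dots> \<le> G (N (\<lambda>c. x c - y c))"
        unfolding G_def real_norm_def by (intro sum_mono diff xy \<sigma>)
      finally show ?thesis unfolding pmf_choice[OF xy(1) \<sigma>] pmf_choice[OF xy(2) \<sigma>] real_norm_def .
    qed
    then have "(\<Sum>\<sigma>\<in>Sig. \<bar>pmf (choice_pmf L x) \<sigma> - pmf (choice_pmf L y) \<sigma>\<bar>) \<le> (\<Sum>\<sigma>\<in>Sig. G (N (\<lambda>c. x c - y c)))"
      by (rule sum_mono)
    then show "(\<Sum>\<sigma>\<in>Sig. \<bar>pmf (choice_pmf L x) \<sigma> - pmf (choice_pmf L y) \<sigma>\<bar>) \<le> real (card Sig) * G (N (\<lambda>c. x c - y c))"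
      by simp
  qed
qed

lemma chain_contractive:
  "\<exists>N \<rho> C \<delta> \<eta>. contractive_chain S drift N Sig offset (choice_pmf L) (transition_kernel L) \<rho> C \<delta> \<eta>"
proof -
  obtain N \<rho> where \<rho>: "0 < \<rho>" "\<rho> < 1" and N: "seminorm_on S N" "\<And>z c. c \<in> S \<Longrightarrow> \<bar>z c\<bar> \<le> N z"
    "\<And>x y. N (\<lambda>c. drift x c - drift y c) \<le> \<rho> * N (\<lambda>c. x c - y c)"
    by (rule contracting_norm) blast
  have N_nonneg: "0 \<le> N z" for z using N(1) by (simp add: seminorm_on_def)
  obtain C where C: "0 \<le> C" "\<And>z. N z \<le> C * (\<Sum>c\<in>S. \<bar>z c\<bar>)"
    using N(1) by (auto simp: seminorm_on_def)
  obtain \<delta> where \<delta>: "0 < \<delta>" "\<And>x \<sigma>. x \<in> E \<Longrightarrow> \<sigma> \<in> Sig \<Longrightarrow> \<delta> \<le> pmf (choice_pmf L x) \<sigma>"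
    by (rule choice_minorized) blast
  obtain \<eta> :: "real \<Rightarrow> real" where \<eta>: "\<And>t. 0 \<le> \<eta> t" "\<And>t t'. t \<le> t' \<Longrightarrow> \<eta> t \<le> \<eta> t'"
    "\<And>\<rho> t. 0 < \<rho> \<Longrightarrow> \<rho> < 1 \<Longrightarrow> 0 \<le> t \<Longrightarrow> summable (\<lambda>n. \<eta> (\<rho> ^ n * t))"
    "\<And>x y. x \<in> E \<Longrightarrow> y \<in> E \<Longrightarrow>
      (\<Sum>\<sigma>\<in>Sig. \<bar>pmf (choice_pmf L x) \<sigma> - pmf (choice_pmf L y) \<sigma>\<bar>) \<le> \<eta> (N (\<lambda>c. x c - y c))"
    by (rule choice_variation[where N = N, OF N_nonneg]) (rule N(2), assumption, rule that)
  have "contractive_chain S drift N Sig offset (choice_pmf L) (transition_kernel L) \<rho> C \<delta> \<eta>"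
  proof
    show "finite S" by (rule finite_state_index)
    show "finite Sig" by (rule finite_Sig)
    show "0 \<le> N z" for z by (rule N_nonneg)
    show "\<bar>z c\<bar> \<le> N z" if "c \<in> S" for z c using that by (rule N(2))
    show "N z \<le> C * (\<Sum>c\<in>S. \<bar>z c\<bar>)" for z by (rule C(2))
    show "N (\<lambda>c. z c + z' c) \<le> N z + N z'" "N (\<lambda>c. - z c) = N z" for z z'
      using N(1) by (simp_all add: seminorm_on_def)
    show "N (\<lambda>c. drift x c - drift y c) \<le> \<rho> * N (\<lambda>c. x c - y c)" for x y by (rule N(3))
    show "0 < \<rho>" "\<rho> < 1" "0 \<le> C" "0 < \<delta>" by (fact \<rho> C(1) \<delta>(1))+
    show "set_pmf (choice_pmf L x) \<subseteq> Sig" if "x \<in> E" for x using that by (rule set_pmf_choice)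
    show "(\<Sum>\<sigma>\<in>Sig. \<bar>pmf (choice_pmf L x) \<sigma> - pmf (choice_pmf L y) \<sigma>\<bar>) \<le> \<eta> (N (\<lambda>c. x c - y c))"
      if "x \<in> E" "y \<in> E" for x y using that by (rule \<eta>(4))
    show "0 \<le> \<eta> t" for t by (rule \<eta>(1))
    show "\<eta> t \<le> \<eta> t'" if "t \<le> t'" for t t' using that by (rule \<eta>(2))
    show "summable (\<lambda>n. \<eta> (\<rho> ^ n * t))" if "0 \<le> t" for t using \<rho> that by (rule \<eta>(3))
    show "\<delta> \<le> pmf (choice_pmf L x) \<sigma>" if "x \<in> E" "\<sigma> \<in> Sig" for x \<sigma> using that by (rule \<delta>(2))
    show "transition_kernel L x = distr (measure_pmf (choice_pmf L x)) (\<Pi>\<^sub>M c\<in>S. borel)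
        (\<lambda>\<sigma>. \<lambda>c\<in>S. drift x c + offset \<sigma> c)" if "x \<in> E" for x
      using that by (rule transition_kernel_eq)
  qed
  then show ?thesis by blast
qed

end

theorem mainTheorem4:
  fixes L :: loop
  assumes compat: "compatible L"
    and systems_schur: "\<And>q i. q \<in> {1..ens_num L} \<Longrightarrow> i \<in> {1..sys_num L q} \<Longrightarrow> schur (sys_A L q i)"
    and filters_stable: "\<And>q. q \<in> {1..ens_num L} \<Longrightarrow> schur (filt_A L q)"
    and controllers_stable: "\<And>q. q \<in> {1..ens_num L} \<Longrightarrow> schur (ctrl_A L q)"
    and control_admissible: "\<And>q \<xi>. q \<in> {1..ens_num L} \<Longrightarrow> \<xi> \<in> space (state_space L) \<Longrightarrow>
      control_signal L \<xi> q \<in> admissible L q"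
    and b_range: "\<And>q i j s. q \<in> {1..ens_num L} \<Longrightarrow> i \<in> {1..sys_num L q} \<Longrightarrow> j \<in> {1..b_num L q i} \<Longrightarrow>
      s \<in> admissible L q \<Longrightarrow> b_prob L q i j s \<in> {0..1}"
    and d_range: "\<And>q i l s. q \<in> {1..ens_num L} \<Longrightarrow> i \<in> {1..sys_num L q} \<Longrightarrow> l \<in> {1..d_num L q i} \<Longrightarrow>
      s \<in> admissible L q \<Longrightarrow> d_prob L q i l s \<in> {0..1}"
    and b_dini: "\<And>q i j. q \<in> {1..ens_num L} \<Longrightarrow> i \<in> {1..sys_num L q} \<Longrightarrow> j \<in> {1..b_num L q i} \<Longrightarrow>
      dini_continuous_on (admissible L q) (b_prob L q i j)"
    and d_dini: "\<And>q i l. q \<in> {1..ens_num L} \<Longrightarrow> i \<in> {1..sys_num L q} \<Longrightarrow> l \<in> {1..d_num L q i} \<Longrightarrow>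
      dini_continuous_on (admissible L q) (d_prob L q i l)"
    and b_sum: "\<And>q i s. q \<in> {1..ens_num L} \<Longrightarrow> i \<in> {1..sys_num L q} \<Longrightarrow> s \<in> admissible L q \<Longrightarrow>
      (\<Sum>j = 1..b_num L q i. b_prob L q i j s) = 1"
    and d_sum: "\<And>q i s. q \<in> {1..ens_num L} \<Longrightarrow> i \<in> {1..sys_num L q} \<Longrightarrow> s \<in> admissible L q \<Longrightarrow>
      (\<Sum>l = 1..d_num L q i. d_prob L q i l s) = 1"
    and b_lower: "\<And>q i j. q \<in> {1..ens_num L} \<Longrightarrow> i \<in> {1..sys_num L q} \<Longrightarrow> j \<in> {1..b_num L q i} \<Longrightarrow>
      \<exists>\<delta>>0. \<forall>s\<in>admissible L q. \<delta> \<le> b_prob L q i j s"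
    and d_lower: "\<And>q i l. q \<in> {1..ens_num L} \<Longrightarrow> i \<in> {1..sys_num L q} \<Longrightarrow> l \<in> {1..d_num L q i} \<Longrightarrow>
      \<exists>\<delta>>0. \<forall>s\<in>admissible L q. \<delta> \<le> d_prob L q i l s"
  shows "\<exists>\<mu>. invariant_measure L \<mu> \<and>
    (\<forall>\<mu>'. invariant_measure L \<mu>' \<longrightarrow> \<mu>' = \<mu>) \<and>
    (\<forall>\<nu>. prob_measure_on (state_space L) \<nu> \<longrightarrow>
       converges_weakly (state_topology L) (law L \<nu>) \<mu>)"
proof -
  interpret controlled_loop L
    using assms by unfold_locales
  obtain N \<rho> C \<delta> \<eta> where chain: "contractive_chain S drift N Sig offset (choice_pmf L) (transition_kernel L) \<rho> C \<delta> \<eta>"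
    using chain_contractive by blast
  show ?thesis
  proof (rule contractive_chain.unique_attractive_invariant_measure[OF chain, folded state_space_def])
    fix \<mu> assume \<mu>: "prob_space \<mu>" "sets \<mu> = sets (state_space L)"
      "\<And>A. A \<in> sets (state_space L) \<Longrightarrow> (\<integral>\<^sup>+x. emeasure (transition_kernel L x) A \<partial>\<mu>) = emeasure \<mu> A"
      and uniq: "\<And>\<mu>'. prob_space \<mu>' \<Longrightarrow> sets \<mu>' = sets (state_space L) \<Longrightarrow>
        (\<And>A. A \<in> sets (state_space L) \<Longrightarrow> (\<integral>\<^sup>+x. emeasure (transition_kernel L x) A \<partial>\<mu>') = emeasure \<mu>' A) \<Longrightarrow> \<mu>' = \<mu>"
      and conv: "\<And>\<nu> (f :: state \<Rightarrow> real) B. prob_space (\<nu> 0) \<Longrightarrow> sets (\<nu> 0) = sets (state_space L) \<Longrightarrow>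
        (\<And>k. \<nu> (Suc k) = \<nu> k \<bind> transition_kernel L) \<Longrightarrow>
        continuous_on E f \<Longrightarrow> (\<And>x. x \<in> E \<Longrightarrow> \<bar>f x\<bar> \<le> B) \<Longrightarrow>
        (\<lambda>k. \<integral>x. f x \<partial>\<nu> k) \<longlonglongrightarrow> (\<integral>x. f x \<partial>\<mu>)"
    show ?thesis
    proof (intro exI conjI allI impI)
      show "invariant_measure L \<mu>"
        using \<mu> by (simp add: invariant_measure_def prob_measure_on_def)
      show "\<mu>' = \<mu>" if "invariant_measure L \<mu>'" for \<mu>'
        using that by (intro uniq) (auto simp: invariant_measure_def prob_measure_on_def)
      fix \<nu> assume \<nu>: "prob_measure_on (state_space L) \<nu>"
      show "converges_weakly (state_topology L) (law L \<nu>) \<mu>"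
        unfolding converges_weakly_def
      proof (intro allI impI, elim conjE)
        fix f :: "state \<Rightarrow> real"
        assume f: "continuous_map (state_topology L) euclidean f" and bounded: "bounded (f ` topspace (state_topology L))"
        obtain B where "\<And>x. x \<in> topspace (state_topology L) \<Longrightarrow> \<bar>f x\<bar> \<le> B"
          using bounded by (auto simp: bounded_iff)
        \<comment> \<open>The test function is bounded on the topspace only; its values off the
          extensional functions remain uncontrolled, and \<open>conv\<close> asks for a bound on
          \<open>E\<close> alone.\<close>
        then have B: "\<bar>f x\<bar> \<le> B" if "x \<in> E" for x
          using that by (simp add: state_topology_def PiE_def)
        have "continuous_on E f"
          using f unfolding state_topology_def by (rule continuous_map_product_imp_continuous_on)
        from conv[where \<nu> = "law L \<nu>", OF _ _ _ this B] \<nu>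
        show "(\<lambda>k. \<integral>x. f x \<partial>law L \<nu> k) \<longlonglongrightarrow> (\<integral>x. f x \<partial>\<mu>)"
          by (simp add: prob_measure_on_def)
      qed
    qed
  qed
qed

end
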